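(* Let $\mathbb{E}=(\mathbb{E}_\alpha)_{\alpha>\alpha_*}$ be a scale of Banach spaces. Let $(A(t))_{t\ge0}\subset L(\mathbb{E})$ satisfy (A1), let $(V(s,t))_{t\ge s\ge0}$ satisfy (A2)$^*$, (A3)$^*$, (A4)$^*$, and let $(B(t))_{t\ge0}\subset L(\mathbb{E})$ satisfy (B1), (B2). Let $W(s,t)$ be the perturbed backward family associated with $V$ and $B$, and $T(\alpha',\alpha)=\frac{\alpha-\alpha'}{2KeM(\alpha)}$ (conditions and definitions are in the context). Then: (a) For all $\alpha'<\alpha''<\alpha$, $k\in\mathbb{E}_\alpha$ and $s\ge0$, the map $$[s,s+\min\{T(\alpha',\alpha),T(\alpha',\alpha'')\})\ni t\mapsto W_{\alpha\alpha'}(s,t)k\in\mathbb{E}_{\alpha'}$$ is continuously differentiable with $\frac{\partial}{\partial t}W_{\alpha\alpha'}(s,t)k=W_{\alpha''\alpha'}(s,t)(A_{\alpha\alpha''}(t)+B_{\alpha\alpha''}(t))k$. (b) For all $\alpha'<\alpha''<\alpha$, $k\in\mathbb{E}_\alpha$ and $t\ge0$, the map $$(t-\min\{T(\alpha',\alpha),T(\alpha'',\alpha)\},t]\cap[0,\infty)\ni s\mapsto W_{\alpha\alpha'}(s,t)k\in\mathbb{E}_{\alpha'}$$ is continuously differentiable with $\frac{\partial}{\partial s}W_{\alpha\alpha'}(s,t)k=-(A_{\alpha''\alpha'}(s)+B_{\alpha''\alpha'}(s))W_{\alpha\alpha''}(s,t)k$. (c) Fix $t>0$, $\alpha'<\alpha$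 and $k\in\mathbb{E}_\alpha$. Let $T\in(0,t]$ and let $v$ be a solution on $[t-T,t]$ to the backward Cauchy problem $$\frac{d}{ds}i_{\alpha'\alpha''}v(s)=-(A_{\alpha'\alpha''}(s)+B_{\alpha'\alpha''}(s))v(s),\quad v(t)=k,\quad s\in[t-T,t].$$ Then $v(s)=W_{\alpha\alpha'}(s,t)k$ for any $s$ with $t-\min\{T,T(\alpha',\alpha)\}<s\le t$.
   Context: Scale of Banach spaces: $\alpha_*\in\mathbb{R}$ is fixed and $\mathbb{E}=(\mathbb{E}_\alpha)_{\alpha>\alpha_*}$ is a family of Banach spaces with $\mathbb{E}_\alpha\subset\mathbb{E}_{\alpha'}$ and $\|\cdot\|_{\alpha'}\le\|\cdot\|_\alpha$ for $\alpha'<\alpha$. Writing $\alpha'<\alpha$ always includes $\alpha'>\alpha_*$. $i_{\alpha\alpha'}\in L(\mathbb{E}_\alpha,\mathbb{E}_{\alpha'})$ denotes the embedding; $\|\cdot\|_{\alpha\alpha'}$ is the operator norm on $L(\mathbb{E}_\alpha,\mathbb{E}_{\alpha'})$. $L(\mathbb{E})$ is the set of collections $A=(A_{\alpha\alpha'})_{\alpha'<\alpha}$, $A_{\alpha\alpha'}\in L(\mathbb{E}_\alpha,\mathbb{E}_{\alpha'})$, with $A_{\alpha''\alpha'}=i_{\alpha\alpha'}A_{\alpha''\alpha}=A_{\alpha\alpha'}i_{\alpha''\alpha}$ for all $\alpha'<\alpha<\alpha''$. Composition in $L(\mathbb{E})$: $(AB)_{\alpha\alpha'}:=A_{\beta\alpha'}B_{\alpha\beta}$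 for any $\beta\in(\alpha',\alpha)$ (independent of $\beta$). (A1) For all $\alpha'<\alpha$, $t\mapsto A_{\alpha\alpha'}(t)\in L(\mathbb{E}_\alpha,\mathbb{E}_{\alpha'})$ is continuous in the operator norm on $[0,\infty)$. (A2)$^*$ $V(s,t)\in L(\mathbb{E})$ for all $t\ge s\ge0$, $V_{\alpha\alpha'}(t,t)=i_{\alpha\alpha'}$ for all $\alpha'<\alpha$, $t\ge0$, and for any $\alpha'<\alpha$, $k\in\mathbb{E}_\alpha$ the map $(s,t)\mapsto V_{\alpha\alpha'}(s,t)k$ is continuous in $\mathbb{E}_{\alpha'}$. (A3)$^*$ For any $\alpha'<\alpha''<\alpha$, $k\in\mathbb{E}_\alpha$, $0\le s\le t$: $V_{\alpha\alpha'}(s,t)k=k+\int_s^tV_{\alpha''\alpha'}(s,r)A_{\alpha\alpha''}(r)k\,dr$ and $V_{\alpha\alpha'}(s,t)k=k+\int_s^tA_{\alpha''\alpha'}(r)V_{\alpha\alpha''}(r,t)k\,dr$, where the integrals exist in $\mathbb{E}_{\alpha'}$. (A4)$^*$ There is a constant $K\ge1$ with $\|V_{\alpha\alpha'}(s,t)\|_{\alpha\alpha'}\le K$ for all $0\le s\le t$ and $\alpha'<\alpha$. (B1) For all $\alpha'<\alpha$ and $k\in\mathbb{E}_\alpha$, $t\mapsto B_{\alpha\alpha'}(t)k\in\mathbb{E}_{\alpha'}$ is continuous on $[0,\infty)$. (B2) There is an increasing continuous function $M:(\alpha_*,\infty)\to[0,\infty)$ with $\|B_{\alpha\alpha'}(t)\|_{\alpha\alpha'}\le\frac{M(\alpha)}{\alpha-\alpha'}$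 for all $t\ge0$, $\alpha'<\alpha$. Perturbed backward family: put $T(\alpha',\alpha):=\frac{\alpha-\alpha'}{2KeM(\alpha)}$ with $1/0:=+\infty$. $W$ is the family $\{W_{\alpha\alpha'}(s,t)\in L(\mathbb{E}_\alpha,\mathbb{E}_{\alpha'}):\alpha'<\alpha,\ 0\le s\le t,\ t-s<T(\alpha',\alpha)\}$ with the following properties (under (A2)$^*$, (A4)$^*$, (B1), (B2) it exists and is unique): (i) $(s,t)\mapsto W_{\alpha\alpha'}(s,t)$ is strongly continuous, $W_{\alpha\alpha'}(t,t)=i_{\alpha\alpha'}$, $\|W_{\alpha\alpha'}(s,t)\|_{\alpha\alpha'}\le\frac{T(\alpha',\alpha)}{T(\alpha',\alpha)-(t-s)}K$; (ii) for $\alpha'<\alpha''<\alpha$, $W_{\alpha\alpha'}(s,t)=i_{\alpha''\alpha'}W_{\alpha\alpha''}(s,t)$ if $t-s<\min\{T(\alpha',\alpha),T(\alpha'',\alpha)\}$ and $W_{\alpha\alpha'}(s,t)=W_{\alpha''\alpha'}(s,t)i_{\alpha\alpha''}$ if $t-s<\min\{T(\alpha',\alpha),T(\alpha',\alpha'')\}$; (iii) $W_{\alpha\alpha'}(s,t)k=V_{\alpha\alpha'}(s,t)k+\int_s^tW_{\alpha''\alpha'}(s,r)(B(r)V(r,t))_{\alpha\alpha''}k\,dr$ for $k\in\mathbb{E}_\alpha$, $\alpha'<\alpha''<\alpha$, $t-s<\min\{T(\alpha',\alpha),T(\alpha',\alpha'')\}$; (iv) $W_{\alpha\alpha'}(s,t)k=V_{\alpha\alpha'}(s,t)k+\int_s^t(V(s,r)B(r))_{\alpha''\alpha'}W_{\alpha\alpha''}(r,t)k\,dr$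 for $k\in\mathbb{E}_\alpha$, $\alpha'<\alpha''<\alpha$, $t-s<\min\{T(\alpha',\alpha),T(\alpha'',\alpha)\}$. Solution to the backward Cauchy problem: for $\alpha_*<\alpha'<\alpha$, $k\in\mathbb{E}_\alpha$, $t>0$, $T\in(0,t]$, a solution on $[t-T,t]$ is a function $v\in C([t-T,t];\mathbb{E}_{\alpha'})$ with $v(t)=k$ (in $\mathbb{E}_{\alpha'}$) such that for all $\alpha''\in(\alpha_*,\alpha')$: $i_{\alpha'\alpha''}v\in C^1([t-T,t];\mathbb{E}_{\alpha''})$ and $\frac{d}{ds}i_{\alpha'\alpha''}v(s)=-(A_{\alpha'\alpha''}(s)+B_{\alpha'\alpha''}(s))v(s)$ for $s\in[t-T,t]$. *)

theory Defs
  imports "HOL-Analysis.Analysis"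
begin

text \<open>
  The members of a scale are linear subspaces of one ambient real vector space, each with its
  own complete norm. A normed space is a pair of a carrier and a norm function whose values
  outside the carrier are irrelevant; its topology is that of the library locale
  \<open>Metric_space\<close>. That locale asks for a nonnegative symmetric distance on the whole type,
  hence the truncation outside the carrier.
\<close>

definition ndist :: "'a::real_vector set \<Rightarrow> ('a \<Rightarrow> real) \<Rightarrow> 'a \<Rightarrow> 'a \<Rightarrow> real" where
  "ndist X n x y = (if x \<in> X \<and> y \<in> X then n (x - y) else 0)"

definition ntop :: "'a::real_vector set \<Rightarrow> ('a \<Rightarrow> real) \<Rightarrow> 'a topology" where
  "ntop X n = Metric_space.mtopology X (ndist X n)"

definition normed_on :: "'a::real_vector set \<Rightarrow> ('a \<Rightarrow> real) \<Rightarrow> bool" where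
  "normed_on X n \<longleftrightarrow> subspace X \<and>
     (\<forall>x\<in>X. 0 \<le> n x \<and> (n x = 0 \<longleftrightarrow> x = 0)) \<and>
     (\<forall>x\<in>X. \<forall>c. n (c *\<^sub>R x) = \<bar>c\<bar> * n x) \<and>
     (\<forall>x\<in>X. \<forall>y\<in>X. n (x + y) \<le> n x + n y)"

definition banach_on :: "'a::real_vector set \<Rightarrow> ('a \<Rightarrow> real) \<Rightarrow> bool" where
  "banach_on X n \<longleftrightarrow> normed_on X n \<and> Metric_space.mcomplete X (ndist X n)"

lemma Metric_space_ndist:
  assumes "normed_on X n"
  shows "Metric_space X (ndist X n)"
proof
  have X: "subspace X"
    and nonneg: "\<And>x. x \<in> X \<Longrightarrow> 0 \<le> n x"
    and zero: "\<And>x. x \<in> X \<Longrightarrow> n x = 0 \<longleftrightarrow> x = 0"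
    and scale: "\<And>x c. x \<in> X \<Longrightarrow> n (c *\<^sub>R x) = \<bar>c\<bar> * n x"
    and tri: "\<And>x y. x \<in> X \<Longrightarrow> y \<in> X \<Longrightarrow> n (x + y) \<le> n x + n y"
    using assms unfolding normed_on_def by blast+
  note diff = subspace_diff[OF X]
  show "0 \<le> ndist X n x y" for x y
    by (simp add: ndist_def nonneg diff)
  show "ndist X n x y = ndist X n y x" for x y
    using scale[of "y - x" "-1"] diff[of y x] by (simp add: ndist_def)
  show "ndist X n x y = 0 \<longleftrightarrow> x = y" if "x \<in> X" "y \<in> X" for x y
    using zero[of "x - y"] diff that by (simp add: ndist_def)
  show "ndist X n x z \<le> ndist X n x y + ndist X n y z"
    if "x \<in> X" "y \<in> X" "z \<in> X" for x y z
    using tri[of "x - y" "y - z"] diff that by (simp add: ndist_def)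
qed

definition bounded_op ::
  "'a::real_vector set \<Rightarrow> ('a \<Rightarrow> real) \<Rightarrow> 'a set \<Rightarrow> ('a \<Rightarrow> real) \<Rightarrow> ('a \<Rightarrow> 'a) \<Rightarrow> bool" where
  "bounded_op X n Y m f \<longleftrightarrow>
     (\<forall>x\<in>X. f x \<in> Y) \<and>
     (\<forall>x\<in>X. \<forall>y\<in>X. f (x + y) = f x + f y) \<and>
     (\<forall>x\<in>X. \<forall>c. f (c *\<^sub>R x) = c *\<^sub>R f x) \<and>
     (\<exists>C. \<forall>x\<in>X. m (f x) \<le> C * n x)"

definition op_norm :: "'a set \<Rightarrow> ('a \<Rightarrow> real) \<Rightarrow> ('a \<Rightarrow> real) \<Rightarrow> ('a \<Rightarrow> 'a) \<Rightarrow> real" where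
  "op_norm X n m f = (SUP x\<in>{x \<in> X. n x \<le> 1}. m (f x))"

definition cont_into ::
  "'b::topological_space set \<Rightarrow> 'a::real_vector set \<Rightarrow> ('a \<Rightarrow> real) \<Rightarrow> ('b \<Rightarrow> 'a) \<Rightarrow> bool" where
  "cont_into S X n f \<longleftrightarrow> continuous_map (top_of_set S) (ntop X n) f"

text \<open>
  This is \<open>has_integral\<close> on \<open>{s..t}\<close> with convergence in the given normed space; for a
  continuous integrand it is the Riemann integral.
\<close>

definition integral_into ::
  "'a::real_vector set \<Rightarrow> ('a \<Rightarrow> real) \<Rightarrow> (real \<Rightarrow> 'a) \<Rightarrow> real \<Rightarrow> real \<Rightarrow> 'a \<Rightarrow> bool" where
  "integral_into X n f s t I \<longleftrightarrow> (\<forall>r\<in>{s..t}. f r \<in> X) \<and>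
     limitin (ntop X n) (\<lambda>p. \<Sum>(x, k)\<in>p. measure lborel k *\<^sub>R f x) I (division_filter {s..t})"

definition deriv_into ::
  "'a::real_vector set \<Rightarrow> ('a \<Rightarrow> real) \<Rightarrow> (real \<Rightarrow> 'a) \<Rightarrow> 'a \<Rightarrow> real \<Rightarrow> real set \<Rightarrow> bool" where
  "deriv_into X n f D t S \<longleftrightarrow>
     limitin (ntop X n) (\<lambda>r. inverse (r - t) *\<^sub>R (f r - f t)) D (at t within S)"

text \<open>
  \<open>f\<close> is continuously differentiable on \<open>S\<close> (one-sidedly at end points belonging to \<open>S\<close>), with
  derivative \<open>f'\<close>.
\<close>

definition C1_into ::
  "real set \<Rightarrow> 'a::real_vector set \<Rightarrow> ('a \<Rightarrow> real) \<Rightarrow> (real \<Rightarrow> 'a) \<Rightarrow> (real \<Rightarrow> 'a) \<Rightarrow> bool" where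
  "C1_into S X n f f' \<longleftrightarrow> (\<forall>t\<in>S. f t \<in> X) \<and>
     (\<forall>t\<in>S. deriv_into X n f (f' t) t S) \<and> cont_into S X n f'"

text \<open>
  \<open>E \<alpha>\<close> and \<open>N \<alpha>\<close> are meaningful for \<open>\<alpha> > a\<close>, where \<open>a\<close> is the lower end of the scale.
  As the spaces are literally nested, the embeddings are identities on elements and are not
  written.
\<close>

definition banach_scale :: "real \<Rightarrow> (real \<Rightarrow> 'a::real_vector set) \<Rightarrow> (real \<Rightarrow> 'a \<Rightarrow> real) \<Rightarrow> bool" where
  "banach_scale a E N \<longleftrightarrow>
     (\<forall>\<alpha>>a. banach_on (E \<alpha>) (N \<alpha>)) \<and>
     (\<forall>\<alpha>' \<alpha>. a < \<alpha>' \<and> \<alpha>' < \<alpha> \<longrightarrow> E \<alpha> \<subseteq> E \<alpha>' \<and> (\<forall>x\<in>E \<alpha>. N \<alpha>' x \<le> N \<alpha> x))"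

text \<open>In \<open>A \<alpha> \<alpha>'\<close> the first index is that of the domain, the second that of the codomain.\<close>

type_synonym 'a collection = "real \<Rightarrow> real \<Rightarrow> 'a \<Rightarrow> 'a"

definition scale_op ::
  "real \<Rightarrow> (real \<Rightarrow> 'a::real_vector set) \<Rightarrow> (real \<Rightarrow> 'a \<Rightarrow> real) \<Rightarrow> 'a collection \<Rightarrow> bool" where
  "scale_op a E N A \<longleftrightarrow>
     (\<forall>\<alpha>' \<alpha>. a < \<alpha>' \<and> \<alpha>' < \<alpha> \<longrightarrow> bounded_op (E \<alpha>) (N \<alpha>) (E \<alpha>') (N \<alpha>') (A \<alpha> \<alpha>')) \<and>
     (\<forall>\<alpha>' \<alpha> \<alpha>''. a < \<alpha>' \<and> \<alpha>' < \<alpha> \<and> \<alpha> < \<alpha>'' \<longrightarrow>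
        (\<forall>x\<in>E \<alpha>''. A \<alpha>'' \<alpha>' x = A \<alpha>'' \<alpha> x \<and> A \<alpha>'' \<alpha>' x = A \<alpha> \<alpha>' x))"

text \<open>
  The composition factors through an arbitrary intermediate space; the midpoint is a
  representative choice, immaterial by the lemma below.
\<close>

definition scale_comp :: "'a collection \<Rightarrow> 'a collection \<Rightarrow> 'a collection" where
  "scale_comp A B \<alpha> \<alpha>' x = (let \<beta> = (\<alpha>' + \<alpha>) / 2 in A \<beta> \<alpha>' (B \<alpha> \<beta> x))"

lemma scale_opD:
  assumes "scale_op a E N A" "a < \<alpha>'" "\<alpha>' < \<alpha>" "\<alpha> < \<alpha>''" "x \<in> E \<alpha>''"
  shows "A \<alpha>'' \<alpha>' x = A \<alpha>'' \<alpha> x" "A \<alpha>'' \<alpha>' x = A \<alpha> \<alpha>' x"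
  using assms unfolding scale_op_def by blast+

lemma scale_op_mem:
  assumes "scale_op a E N A" "a < \<alpha>'" "\<alpha>' < \<alpha>" "x \<in> E \<alpha>"
  shows "A \<alpha> \<alpha>' x \<in> E \<alpha>'"
  using assms unfolding scale_op_def bounded_op_def by blast

lemma scale_comp_eq:
  assumes A: "scale_op a E N A" and B: "scale_op a E N B"
    and "a < \<alpha>'" "\<alpha>' < \<beta>" "\<beta> < \<alpha>" "x \<in> E \<alpha>"
  shows "scale_comp A B \<alpha> \<alpha>' x = A \<beta> \<alpha>' (B \<alpha> \<beta> x)"
proof -
  have le: "A \<beta>1 \<alpha>' (B \<alpha> \<beta>1 x) = A \<beta>2 \<alpha>' (B \<alpha> \<beta>2 x)"
    if "\<alpha>' < \<beta>1" "\<beta>1 < \<beta>2" "\<beta>2 < \<alpha>" for \<beta>1 \<beta>2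
  proof -
    have pos: "a < \<beta>1" "a < \<beta>2" using assms(3) that by linarith+
    have "B \<alpha> \<beta>2 x \<in> E \<beta>2"
      by (rule scale_op_mem[OF B pos(2) that(3) \<open>x \<in> E \<alpha>\<close>])
    then have "A \<beta>2 \<alpha>' (B \<alpha> \<beta>2 x) = A \<beta>1 \<alpha>' (B \<alpha> \<beta>2 x)"
      by (rule scale_opD(2)[OF A assms(3) that(1,2)])
    moreover have "B \<alpha> \<beta>1 x = B \<alpha> \<beta>2 x"
      by (rule scale_opD(1)[OF B pos(1) that(2,3) \<open>x \<in> E \<alpha>\<close>])
    ultimately show ?thesis by simp
  qed
  have "\<alpha>' < (\<alpha>' + \<alpha>) / 2" "(\<alpha>' + \<alpha>) / 2 < \<alpha>"
    using assms by auto
  then have "A ((\<alpha>' + \<alpha>) / 2) \<alpha>' (B \<alpha> ((\<alpha>' + \<alpha>) / 2) x) = A \<beta> \<alpha>' (B \<alpha> \<beta> x)"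
    using le[of "(\<alpha>' + \<alpha>) / 2" \<beta>] le[of \<beta> "(\<alpha>' + \<alpha>) / 2"] assms(4,5)
    by (metis linorder_cases)
  then show ?thesis
    by (simp add: scale_comp_def Let_def)
qed

definition cond_A1 ::
  "real \<Rightarrow> (real \<Rightarrow> 'a::real_vector set) \<Rightarrow> (real \<Rightarrow> 'a \<Rightarrow> real) \<Rightarrow> (real \<Rightarrow> 'a collection) \<Rightarrow> bool" where
  "cond_A1 a E N A \<longleftrightarrow>
     (\<forall>\<alpha>' \<alpha> t. a < \<alpha>' \<and> \<alpha>' < \<alpha> \<and> 0 \<le> t \<longrightarrow>
        ((\<lambda>r. op_norm (E \<alpha>) (N \<alpha>) (N \<alpha>') (\<lambda>x. A r \<alpha> \<alpha>' x - A t \<alpha> \<alpha>' x)) \<longlongrightarrow> 0) (at t within {0..}))"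

definition cond_A2 ::
  "real \<Rightarrow> (real \<Rightarrow> 'a::real_vector set) \<Rightarrow> (real \<Rightarrow> 'a \<Rightarrow> real) \<Rightarrow> (real \<Rightarrow> real \<Rightarrow> 'a collection) \<Rightarrow> bool" where
  "cond_A2 a E N V \<longleftrightarrow>
     (\<forall>s t. 0 \<le> s \<and> s \<le> t \<longrightarrow> scale_op a E N (V s t)) \<and>
     (\<forall>\<alpha>' \<alpha> t. a < \<alpha>' \<and> \<alpha>' < \<alpha> \<and> 0 \<le> t \<longrightarrow> (\<forall>k\<in>E \<alpha>. V t t \<alpha> \<alpha>' k = k)) \<and>
     (\<forall>\<alpha>' \<alpha>. a < \<alpha>' \<and> \<alpha>' < \<alpha> \<longrightarrow>
        (\<forall>k\<in>E \<alpha>. cont_into {(s, t). 0 \<le> s \<and> s \<le> t} (E \<alpha>') (N \<alpha>') (\<lambda>(s, t). V s t \<alpha> \<alpha>' k)))"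

definition cond_A3 ::
  "real \<Rightarrow> (real \<Rightarrow> 'a::real_vector set) \<Rightarrow> (real \<Rightarrow> 'a \<Rightarrow> real) \<Rightarrow> (real \<Rightarrow> 'a collection) \<Rightarrow>
   (real \<Rightarrow> real \<Rightarrow> 'a collection) \<Rightarrow> bool" where
  "cond_A3 a E N A V \<longleftrightarrow>
     (\<forall>\<alpha>' \<alpha>'' \<alpha> s t. a < \<alpha>' \<and> \<alpha>' < \<alpha>'' \<and> \<alpha>'' < \<alpha> \<and> 0 \<le> s \<and> s \<le> t \<longrightarrow> (\<forall>k\<in>E \<alpha>.
        integral_into (E \<alpha>') (N \<alpha>') (\<lambda>r. V s r \<alpha>'' \<alpha>' (A r \<alpha> \<alpha>'' k)) s t (V s t \<alpha> \<alpha>' k - k) \<and>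
        integral_into (E \<alpha>') (N \<alpha>') (\<lambda>r. A r \<alpha>'' \<alpha>' (V r t \<alpha> \<alpha>'' k)) s t (V s t \<alpha> \<alpha>' k - k)))"

definition cond_A4 ::
  "real \<Rightarrow> (real \<Rightarrow> 'a::real_vector set) \<Rightarrow> (real \<Rightarrow> 'a \<Rightarrow> real) \<Rightarrow> real \<Rightarrow>
   (real \<Rightarrow> real \<Rightarrow> 'a collection) \<Rightarrow> bool" where
  "cond_A4 a E N K V \<longleftrightarrow> 1 \<le> K \<and>
     (\<forall>\<alpha>' \<alpha> s t. a < \<alpha>' \<and> \<alpha>' < \<alpha> \<and> 0 \<le> s \<and> s \<le> t \<longrightarrow>
        op_norm (E \<alpha>) (N \<alpha>) (N \<alpha>') (V s t \<alpha> \<alpha>') \<le> K)"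

definition cond_B1 ::
  "real \<Rightarrow> (real \<Rightarrow> 'a::real_vector set) \<Rightarrow> (real \<Rightarrow> 'a \<Rightarrow> real) \<Rightarrow> (real \<Rightarrow> 'a collection) \<Rightarrow> bool" where
  "cond_B1 a E N B \<longleftrightarrow>
     (\<forall>\<alpha>' \<alpha>. a < \<alpha>' \<and> \<alpha>' < \<alpha> \<longrightarrow>
        (\<forall>k\<in>E \<alpha>. cont_into {0..} (E \<alpha>') (N \<alpha>') (\<lambda>t. B t \<alpha> \<alpha>' k)))"

text \<open>\<open>M\<close> may vanish on an initial interval, so increasing means nondecreasing.\<close>

definition cond_B2 ::
  "real \<Rightarrow> (real \<Rightarrow> 'a::real_vector set) \<Rightarrow> (real \<Rightarrow> 'a \<Rightarrow> real) \<Rightarrow> (real \<Rightarrow> real) \<Rightarrow>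
   (real \<Rightarrow> 'a collection) \<Rightarrow> bool" where
  "cond_B2 a E N M B \<longleftrightarrow>
     mono_on {a<..} M \<and> continuous_on {a<..} M \<and> (\<forall>\<alpha>>a. 0 \<le> M \<alpha>) \<and>
     (\<forall>\<alpha>' \<alpha> t. a < \<alpha>' \<and> \<alpha>' < \<alpha> \<and> 0 \<le> t \<longrightarrow>
        op_norm (E \<alpha>) (N \<alpha>) (N \<alpha>') (B t \<alpha> \<alpha>') \<le> M \<alpha> / (\<alpha> - \<alpha>'))"

definition lifespan :: "real \<Rightarrow> (real \<Rightarrow> real) \<Rightarrow> real \<Rightarrow> real \<Rightarrow> ereal" where
  "lifespan K M \<alpha>' \<alpha> =
     (if M \<alpha> = 0 then \<infinity> else ereal ((\<alpha> - \<alpha>') / (2 * K * exp 1 * M \<alpha>)))"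

text \<open>\<open>\<tau> / (\<tau> - u)\<close>, read as its limit \<open>1\<close> for \<open>\<tau> = \<infinity>\<close>; the division of \<open>ereal\<close> would give \<open>0\<close>.\<close>

definition lifespan_factor :: "ereal \<Rightarrow> real \<Rightarrow> real" where
  "lifespan_factor \<tau> u = (if \<tau> = \<infinity> then 1 else real_of_ereal \<tau> / (real_of_ereal \<tau> - u))"

text \<open>
  \<open>W s t \<alpha> \<alpha>'\<close> is constrained only for \<open>a < \<alpha>' < \<alpha>\<close>, \<open>0 \<le> s \<le> t\<close> and
  \<open>t - s < lifespan K M \<alpha>' \<alpha>\<close>, where the properties below determine it uniquely.
\<close>

definition perturbed_backward_family ::
  "real \<Rightarrow> (real \<Rightarrow> 'a::real_vector set) \<Rightarrow> (real \<Rightarrow> 'a \<Rightarrow> real) \<Rightarrow> real \<Rightarrow> (real \<Rightarrow> real) \<Rightarrow>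
   (real \<Rightarrow> real \<Rightarrow> 'a collection) \<Rightarrow> (real \<Rightarrow> 'a collection) \<Rightarrow>
   (real \<Rightarrow> real \<Rightarrow> 'a collection) \<Rightarrow> bool" where
  "perturbed_backward_family a E N K M V B W \<longleftrightarrow>
    (let T = lifespan K M in
     (\<forall>\<alpha>' \<alpha>. a < \<alpha>' \<and> \<alpha>' < \<alpha> \<longrightarrow>
        (\<forall>s t. 0 \<le> s \<and> s \<le> t \<and> ereal (t - s) < T \<alpha>' \<alpha> \<longrightarrow>
           bounded_op (E \<alpha>) (N \<alpha>) (E \<alpha>') (N \<alpha>') (W s t \<alpha> \<alpha>') \<and>
           op_norm (E \<alpha>) (N \<alpha>) (N \<alpha>') (W s t \<alpha> \<alpha>') \<le> lifespan_factor (T \<alpha>' \<alpha>) (t - s) * K) \<and>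
        (\<forall>k\<in>E \<alpha>.
           (\<forall>t\<ge>0. W t t \<alpha> \<alpha>' k = k) \<and>
           cont_into {(s, t). 0 \<le> s \<and> s \<le> t \<and> ereal (t - s) < T \<alpha>' \<alpha>} (E \<alpha>') (N \<alpha>')
             (\<lambda>(s, t). W s t \<alpha> \<alpha>' k))) \<and>
     (\<forall>\<alpha>' \<alpha>'' \<alpha> s t. a < \<alpha>' \<and> \<alpha>' < \<alpha>'' \<and> \<alpha>'' < \<alpha> \<and> 0 \<le> s \<and> s \<le> t \<longrightarrow> (\<forall>k\<in>E \<alpha>.
        (ereal (t - s) < min (T \<alpha>' \<alpha>) (T \<alpha>'' \<alpha>) \<longrightarrow>
           W s t \<alpha> \<alpha>' k = W s t \<alpha> \<alpha>'' k \<and>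
           integral_into (E \<alpha>') (N \<alpha>')
             (\<lambda>r. scale_comp (V s r) (B r) \<alpha>'' \<alpha>' (W r t \<alpha> \<alpha>'' k)) s t
             (W s t \<alpha> \<alpha>' k - V s t \<alpha> \<alpha>' k)) \<and>
        (ereal (t - s) < min (T \<alpha>' \<alpha>) (T \<alpha>' \<alpha>'') \<longrightarrow>
           W s t \<alpha> \<alpha>' k = W s t \<alpha>'' \<alpha>' k \<and>
           integral_into (E \<alpha>') (N \<alpha>')
             (\<lambda>r. W s r \<alpha>'' \<alpha>' (scale_comp (B r) (V r t) \<alpha> \<alpha>'' k)) s t
             (W s t \<alpha> \<alpha>' k - V s t \<alpha> \<alpha>' k)))))"

definition backward_solution ::
  "real \<Rightarrow> (real \<Rightarrow> 'a::real_vector set) \<Rightarrow> (real \<Rightarrow> 'a \<Rightarrow> real) \<Rightarrow> (real \<Rightarrow> 'a collection) \<Rightarrow>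
   (real \<Rightarrow> 'a collection) \<Rightarrow> real \<Rightarrow> 'a \<Rightarrow> real \<Rightarrow> real \<Rightarrow> (real \<Rightarrow> 'a) \<Rightarrow> bool" where
  "backward_solution a E N A B \<alpha>' k t T v \<longleftrightarrow>
     cont_into {t - T..t} (E \<alpha>') (N \<alpha>') v \<and> v t = k \<and>
     (\<forall>\<alpha>''. a < \<alpha>'' \<and> \<alpha>'' < \<alpha>' \<longrightarrow>
        C1_into {t - T..t} (E \<alpha>'') (N \<alpha>'') v
          (\<lambda>s. - (A s \<alpha>' \<alpha>'' (v s) + B s \<alpha>' \<alpha>'' (v s))))"

end

theory Submission
  imports Defs
begin

text \<open>
  Both derivative formulas come from differentiating the integral equations that define \<open>W\<close>. In
  \<open>W(s,t)k = V(s,t)k + \<integral>\<^sub>s\<^sup>t W(s,r)B(r)V(r,t)k dr\<close> the time \<open>t\<close> occurs as the upper limit and inside \<open>V\<close>,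
  and \<open>\<partial>\<^sub>tV(r,t)k = V(r,t)A(t)k\<close>. Formally the derivative is therefore
  \<open>V(s,t)A(t)k + W(s,t)B(t)k + \<integral>\<^sub>s\<^sup>t W(s,r)B(r)V(r,t)A(t)k dr\<close>, and the same integral equation, written
  for the vector \<open>A(t)k\<close>, collects the first and the last term into \<open>W(s,t)A(t)k\<close>. The lower time is
  treated in the same way with \<open>W(s,t)k = V(s,t)k + \<integral>\<^sub>s\<^sup>t V(s,r)B(r)W(r,t)k dr\<close>, where the operator
  \<open>A(s)\<close> is taken out of the integral.

  Every integral in this computation is supplied by an integral equation, so what has to be proved
  is a comparison of three given integrals: those at two neighbouring times and the one of the
  differentiated integrand. Lemma \<open>integral_into_increment_le\<close> makes this comparison on the level of
  Riemann sums, for a pointwise bound of the integrands. The pointwise bound must be uniform in the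
  integration variable. It is obtained from the scale itself (\<open>V_right_derivative_uniform\<close>,
  \<open>V_left_derivative_uniform\<close>): an increment of \<open>V\<close> is an integral of \<open>A\<close> composed with \<open>V\<close>, where \<open>V\<close> is
  bounded by \<open>K\<close> and \<open>A\<close> is locally bounded in operator norm, at the price of one step down in the
  scale.

  The differentiated integrand is integrable over the shorter of the two intervals by the integral
  equation at that interval. Hence the argument gives the right derivative in \<open>t\<close> and the left
  derivative in \<open>s\<close>. Since the candidate derivative is continuous, a one-sided derivative suffices
  (\<open>C1_into_of_right_derivative\<close>, \<open>C1_into_of_left_derivative\<close>).

  For uniqueness, let \<open>v\<close> be a solution. The function \<open>r \<mapsto> W(p,r)v(r)\<close> has derivative
  \<open>W(p,r)(A(r) + B(r))v(r) - W(p,r)(A(r) + B(r))v(r) = 0\<close>, so that \<open>v(p) = W(p,q)v(q)\<close> for \<open>p \<le> q\<close>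
  (\<open>W_propagates_solution\<close>). Here \<open>W\<close> acts on \<open>E \<alpha>'\<close>, where its lifespan may be shorter than
  \<open>T \<alpha>' \<alpha>\<close>, so the identity is available only for small \<open>q - p\<close>. As \<open>r \<mapsto> W(r,t)k\<close> is itself a solution,
  both \<open>v\<close> and \<open>W(\<cdot>,t)k\<close> are propagated by the same operators, and their equality travels from \<open>t\<close> down
  to \<open>s\<close> in finitely many steps.
\<close>

section \<open>Limits and continuity in a normed carrier\<close>

lemma normed_onD:
  assumes "normed_on X n"
  shows "subspace X" "x \<in> X \<Longrightarrow> 0 \<le> n x" "n 0 = 0" "x \<in> X \<Longrightarrow> n x = 0 \<Longrightarrow> x = 0"
    "x \<in> X \<Longrightarrow> n (c *\<^sub>R x) = \<bar>c\<bar> * n x" "x \<in> X \<Longrightarrow> y \<in> X \<Longrightarrow> n (x + y) \<le> n x + n y"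
    "x \<in> X \<Longrightarrow> n (- x) = n x" "x \<in> X \<Longrightarrow> y \<in> X \<Longrightarrow> n (x - y) \<le> n x + n y"
    "x \<in> X \<Longrightarrow> y \<in> X \<Longrightarrow> n (x - y) = n (y - x)"
proof -
  have X: "subspace X"
    and nonneg: "\<And>x. x \<in> X \<Longrightarrow> 0 \<le> n x"
    and zero: "\<And>x. x \<in> X \<Longrightarrow> n x = 0 \<longleftrightarrow> x = 0"
    and scale: "\<And>x c. x \<in> X \<Longrightarrow> n (c *\<^sub>R x) = \<bar>c\<bar> * n x"
    and tri: "\<And>x y. x \<in> X \<Longrightarrow> y \<in> X \<Longrightarrow> n (x + y) \<le> n x + n y"
    using assms unfolding normed_on_def by blast+
  have minus: "n (- x) = n x" if "x \<in> X" for x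
    using scale[OF that, of "-1"] by simp
  show "subspace X" "x \<in> X \<Longrightarrow> 0 \<le> n x" "x \<in> X \<Longrightarrow> n x = 0 \<Longrightarrow> x = 0"
    "x \<in> X \<Longrightarrow> n (c *\<^sub>R x) = \<bar>c\<bar> * n x" "x \<in> X \<Longrightarrow> y \<in> X \<Longrightarrow> n (x + y) \<le> n x + n y"
    "x \<in> X \<Longrightarrow> n (- x) = n x"
    using X nonneg zero scale tri minus by blast+
  show "n 0 = 0"
    using zero subspace_0[OF X] by blast
  show "n (x - y) \<le> n x + n y" if "x \<in> X" "y \<in> X"
    using tri[of x "- y"] minus[of y] subspace_neg[OF X] that by simp
  show "n (x - y) = n (y - x)" if "x \<in> X" "y \<in> X"
    using minus[of "x - y"] subspace_diff[OF X] that by simp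
qed

lemma normed_on_sum_le:
  assumes nn: "normed_on X n" and "\<And>i. i \<in> I \<Longrightarrow> f i \<in> X" and "\<And>i. i \<in> I \<Longrightarrow> n (f i) \<le> g i"
  shows "n (\<Sum>i\<in>I. f i) \<le> (\<Sum>i\<in>I. g i)"
  using assms(2,3)
proof (induction I rule: infinite_finite_induct)
  case (insert i I)
  have "(\<Sum>i\<in>I. f i) \<in> X"
    using insert by (intro subspace_sum[OF normed_onD(1)[OF nn]]) auto
  then have "n (f i + (\<Sum>i\<in>I. f i)) \<le> n (f i) + n (\<Sum>i\<in>I. f i)"
    using insert by (intro normed_onD(6)[OF nn]) auto
  also have "\<dots> \<le> g i + (\<Sum>i\<in>I. g i)"
    using insert by (intro add_mono) auto
  finally show ?case using insert by simp
qed (simp_all add: normed_onD(3)[OF nn])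

lemma limitin_ntop_iff:
  assumes nn: "normed_on X n"
  shows "limitin (ntop X n) f l F \<longleftrightarrow>
    l \<in> X \<and> (\<forall>\<^sub>F x in F. f x \<in> X) \<and> ((\<lambda>x. n (f x - l)) \<longlongrightarrow> 0) F"
proof -
  interpret Metric_space X "ndist X n" by (rule Metric_space_ndist[OF nn])
  have *: "f x \<in> X \<and> ndist X n (f x) l < e \<longleftrightarrow> f x \<in> X \<and> dist (n (f x - l)) 0 < e"
    if "l \<in> X" for x and e :: real
    using that normed_onD(2)[OF nn, of "f x - l"] subspace_diff[OF normed_onD(1)[OF nn]]
    by (auto simp: ndist_def)
  have "limitin (ntop X n) f l F \<longleftrightarrow>
      l \<in> X \<and> (\<forall>e>0. \<forall>\<^sub>F x in F. f x \<in> X \<and> dist (n (f x - l)) 0 < e)"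
    unfolding ntop_def limitin_metric using * by (auto cong: conj_cong)
  then show ?thesis
    unfolding tendsto_iff eventually_conj_iff using zero_less_one by blast
qed

lemma atin_within_euclidean: "atin_within euclidean x S = at x within S"
  unfolding filter_eq_iff eventually_atin_within eventually_at_topological
  by (auto simp flip: open_openin)

lemma cont_into_iff:
  "cont_into S X n f \<longleftrightarrow> (\<forall>x\<in>S. limitin (ntop X n) f (f x) (at x within S))"
  by (auto simp: cont_into_def continuous_map_atin atin_subtopology_within atin_within_euclidean)

lemma cont_into_subset: "cont_into S X n f \<Longrightarrow> S' \<subseteq> S \<Longrightarrow> cont_into S' X n f"
  unfolding cont_into_def by (rule continuous_map_from_subtopology_mono)

lemma cont_into_compose:
  assumes "cont_into S X n f" "continuous_on S' g" "g ` S' \<subseteq> S"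
  shows "cont_into S' X n (\<lambda>x. f (g x))"
proof -
  have "continuous_map (top_of_set S') (top_of_set S) g"
    using assms(2,3) by (simp add: continuous_map_into_subtopology image_subset_iff_funcset)
  from continuous_map_compose[OF this assms(1)[unfolded cont_into_def]] show ?thesis
    by (simp add: cont_into_def o_def)
qed

lemma limitin_ntop_add:
  assumes nn: "normed_on X n" and "limitin (ntop X n) f k F" "limitin (ntop X n) g l F"
  shows "limitin (ntop X n) (\<lambda>x. f x + g x) (k + l) F"
proof -
  note X = normed_onD(1)[OF nn]
  have f: "k \<in> X" "\<forall>\<^sub>F x in F. f x \<in> X" "((\<lambda>x. n (f x - k)) \<longlongrightarrow> 0) F"
    and g: "l \<in> X" "\<forall>\<^sub>F x in F. g x \<in> X" "((\<lambda>x. n (g x - l)) \<longlongrightarrow> 0) F"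
    using assms(2,3) by (simp_all add: limitin_ntop_iff[OF nn])
  have ev: "\<forall>\<^sub>F x in F. f x + g x \<in> X"
    using f(2) g(2) by eventually_elim (rule subspace_add[OF X])
  have "\<forall>\<^sub>F x in F. norm (n (f x + g x - (k + l))) \<le> n (f x - k) + n (g x - l)"
    using f(2) g(2)
  proof eventually_elim
    case (elim x)
    have "f x - k \<in> X" "g x - l \<in> X"
      using elim f g by (auto intro: subspace_diff[OF X])
    then have "n ((f x - k) + (g x - l)) \<le> n (f x - k) + n (g x - l)"
      "0 \<le> n ((f x - k) + (g x - l))"
      by (auto intro: normed_onD[OF nn] subspace_add[OF X])
    then show ?case by (simp add: algebra_simps)
  qed
  moreover have "((\<lambda>x. n (f x - k) + n (g x - l)) \<longlongrightarrow> 0) F"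
    using tendsto_add[OF f(3) g(3)] by simp
  ultimately have "((\<lambda>x. n (f x + g x - (k + l))) \<longlongrightarrow> 0) F"
    by (rule Lim_null_comparison)
  then show ?thesis
    using ev f g subspace_add[OF X] by (simp add: limitin_ntop_iff[OF nn])
qed

lemma limitin_ntop_minus:
  assumes nn: "normed_on X n" and "limitin (ntop X n) f k F"
  shows "limitin (ntop X n) (\<lambda>x. - f x) (- k) F"
proof -
  note X = normed_onD(1)[OF nn]
  have f: "k \<in> X" "\<forall>\<^sub>F x in F. f x \<in> X" "((\<lambda>x. n (f x - k)) \<longlongrightarrow> 0) F"
    using assms(2) by (simp_all add: limitin_ntop_iff[OF nn])
  have "\<forall>\<^sub>F x in F. n (f x - k) = n (- f x - - k)"
    using f(2) 
  proof eventually_elim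
    case (elim x)
    have "- f x - - k = k - f x" by simp
    then show ?case using normed_onD(9)[OF nn elim f(1)] by (simp only:)
  qed
  then have "((\<lambda>x. n (- f x - - k)) \<longlongrightarrow> 0) F"
    by (rule Lim_transform_eventually[OF f(3)])
  moreover have "\<forall>\<^sub>F x in F. - f x \<in> X"
    using f(2) by eventually_elim (rule subspace_neg[OF X])
  ultimately show ?thesis
    using f subspace_neg[OF X] by (simp add: limitin_ntop_iff[OF nn])
qed

lemma limitin_eventually_cong:
  assumes "limitin Y f l F" "\<forall>\<^sub>F x in F. f x = g x"
  shows "limitin Y g l F"
  by (rule limitin_transform_eventually[OF assms(2,1)])

lemma limitin_ntop_self:
  assumes "normed_on X n" "x \<in> X"
  shows "limitin (ntop X n) (\<lambda>_. x) x F"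
  unfolding limitin_ntop_iff[OF assms(1)] using assms(2) normed_onD(3)[OF assms(1)] by simp

lemma cont_into_add:
  assumes nn: "normed_on X n" and "cont_into S X n f" "cont_into S X n g"
  shows "cont_into S X n (\<lambda>x. f x + g x)"
  using assms(2,3) unfolding cont_into_iff by (blast intro: limitin_ntop_add[OF nn])

lemma cont_into_minus:
  assumes nn: "normed_on X n" and "cont_into S X n f"
  shows "cont_into S X n (\<lambda>x. - f x)"
  using assms(2) unfolding cont_into_iff by (blast intro: limitin_ntop_minus[OF nn])

lemma cont_into_const: "normed_on X n \<Longrightarrow> x \<in> X \<Longrightarrow> cont_into S X n (\<lambda>_. x)"
  unfolding cont_into_iff by (blast intro: limitin_ntop_self)

section \<open>Bounded operators\<close>

text \<open>
  An explicit bound in place of \<open>op_norm\<close>: it composes, and the same \<open>C\<close> can serve for a whole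
  family of operators.
\<close>

definition op_bound ::
  "'a::real_vector set \<Rightarrow> ('a \<Rightarrow> real) \<Rightarrow> 'a set \<Rightarrow> ('a \<Rightarrow> real) \<Rightarrow> real \<Rightarrow> ('a \<Rightarrow> 'a) \<Rightarrow> bool" where
  "op_bound X n Y m C f \<longleftrightarrow> bounded_op X n Y m f \<and> 0 \<le> C \<and> (\<forall>x\<in>X. m (f x) \<le> C * n x)"

lemma bounded_opD:
  assumes "bounded_op X n Y m f" and X: "subspace X"
  shows "x \<in> X \<Longrightarrow> f x \<in> Y" "x \<in> X \<Longrightarrow> y \<in> X \<Longrightarrow> f (x + y) = f x + f y"
    "x \<in> X \<Longrightarrow> f (c *\<^sub>R x) = c *\<^sub>R f x" "x \<in> X \<Longrightarrow> y \<in> X \<Longrightarrow> f (x - y) = f x - f y"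
    "f 0 = 0" "x \<in> X \<Longrightarrow> f (- x) = - f x"
proof -
  have 1: "x \<in> X \<Longrightarrow> f x \<in> Y" "x \<in> X \<Longrightarrow> y \<in> X \<Longrightarrow> f (x + y) = f x + f y"
    "x \<in> X \<Longrightarrow> f (c *\<^sub>R x) = c *\<^sub>R f x" for x y c
    using assms unfolding bounded_op_def by blast+
  show "x \<in> X \<Longrightarrow> f x \<in> Y" "x \<in> X \<Longrightarrow> y \<in> X \<Longrightarrow> f (x + y) = f x + f y"
    "x \<in> X \<Longrightarrow> f (c *\<^sub>R x) = c *\<^sub>R f x"
    using 1 by blast+
  show "f 0 = 0" using 1(3)[OF subspace_0[OF X], of 0] by simp
  show minus: "f (- x) = - f x" if "x \<in> X" for x using 1(3)[OF that, of "-1"] by simp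
  show "x \<in> X \<Longrightarrow> y \<in> X \<Longrightarrow> f (x - y) = f x - f y"
    using 1(2)[of x "- y"] subspace_neg[OF X, of y] minus[of y] by simp
qed

text \<open>
  The supremum in \<open>op_norm\<close> is over a set that is bounded because the operator is bounded; without
  that it would say nothing. The estimate for all vectors follows by scaling to the unit ball.
\<close>

lemma op_norm_bound:
  assumes nn: "normed_on X n" and nm: "normed_on Y m"
    and f: "bounded_op X n Y m f" and le: "op_norm X n m f \<le> C"
  shows "op_bound X n Y m C f"
proof -
  note X = normed_onD(1)[OF nn]
  obtain D where D: "\<And>x. x \<in> X \<Longrightarrow> m (f x) \<le> D * n x"
    using f unfolding bounded_op_def by blast
  have bdd: "bdd_above ((\<lambda>x. m (f x)) ` {x \<in> X. n x \<le> 1})"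
  proof (rule bdd_aboveI2)
    fix x assume x: "x \<in> {x \<in> X. n x \<le> 1}"
    have "m (f x) \<le> D * n x" using D x by auto
    also have "\<dots> \<le> \<bar>D\<bar> * 1"
      using x normed_onD(2)[OF nn, of x] by (intro mult_mono) auto
    finally show "m (f x) \<le> \<bar>D\<bar>" by simp
  qed
  have unit: "m (f x) \<le> C" if "x \<in> X" "n x \<le> 1" for x
  proof -
    have "m (f x) \<le> op_norm X n m f"
      unfolding op_norm_def using that by (intro cSUP_upper[OF _ bdd]) auto
    then show ?thesis using le by linarith
  qed
  have "m (f x) \<le> C * n x" if x: "x \<in> X" for x
  proof (cases "x = 0")
    case True
    then show ?thesis
      using bounded_opD(5)[OF f X] normed_onD(3)[OF nn] normed_onD(3)[OF nm] by simp
  next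
    case False
    then have pos: "0 < n x" using normed_onD(2,4)[OF nn x] by force
    let ?y = "inverse (n x) *\<^sub>R x"
    have "?y \<in> X" "n ?y \<le> 1"
      using x pos normed_onD(5)[OF nn x] subspace_scale[OF X] by auto
    then have "m (f ?y) \<le> C" by (rule unit)
    moreover have "m (f ?y) = inverse (n x) * m (f x)"
      using bounded_opD(1,3)[OF f X x] normed_onD(5)[OF nm] pos by simp
    ultimately have "inverse (n x) * m (f x) \<le> C" by simp
    then show ?thesis using pos by (simp add: field_simps)
  qed
  moreover have "0 \<le> C"
    using unit[OF subspace_0[OF X]] bounded_opD(5)[OF f X] normed_onD(3)[OF nn] normed_onD(3)[OF nm]
    by simp
  ultimately show ?thesis using f unfolding op_bound_def by blast
qed

text \<open>
  Strong convergence of uniformly bounded operators may be combined with convergence of the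
  arguments: \<open>L r (x r) - y0 = L r (x r - x0) + (L r x0 - y0)\<close>.
\<close>

lemma limitin_op_apply:
  assumes nn: "normed_on X n" and nm: "normed_on Y m"
    and L: "\<forall>\<^sub>F r in F. op_bound X n Y m C (L r)"
    and x: "limitin (ntop X n) x x0 F" and y: "limitin (ntop Y m) (\<lambda>r. L r x0) y0 F"
  shows "limitin (ntop Y m) (\<lambda>r. L r (x r)) y0 F"
proof -
  note X = normed_onD(1)[OF nn] and Y = normed_onD(1)[OF nm]
  have x': "x0 \<in> X" "\<forall>\<^sub>F r in F. x r \<in> X" "((\<lambda>r. n (x r - x0)) \<longlongrightarrow> 0) F"
    using x by (simp_all add: limitin_ntop_iff[OF nn])
  have ev: "\<forall>\<^sub>F r in F. L r (x r - x0) \<in> Y \<and> L r (x r) = L r (x r - x0) + L r x0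
      \<and> norm (m (L r (x r - x0) - 0)) \<le> C * n (x r - x0)"
    using L x'(2)
  proof eventually_elim
    case (elim r)
    have d: "x r - x0 \<in> X" using elim x' subspace_diff[OF X] by blast
    have b: "bounded_op X n Y m (L r)" using elim by (simp add: op_bound_def)
    have LY: "L r (x r - x0) \<in> Y" by (rule bounded_opD(1)[OF b X d])
    have "m (L r (x r - x0)) \<le> C * n (x r - x0)" using elim d by (auto simp: op_bound_def)
    then show ?case
      using LY bounded_opD(4)[OF b X, of "x r" x0] elim x'(1) normed_onD(2)[OF nm LY] by simp
  qed
  have "((\<lambda>r. C * n (x r - x0)) \<longlongrightarrow> 0) F"
    by (rule tendsto_mult_right_zero[OF x'(3)])
  then have "((\<lambda>r. m (L r (x r - x0) - 0)) \<longlongrightarrow> 0) F"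
    by (rule Lim_null_comparison[OF eventually_mono[OF ev], rotated]) blast
  then have "limitin (ntop Y m) (\<lambda>r. L r (x r - x0)) 0 F"
    using subspace_0[OF Y] eventually_mono[OF ev] by (simp add: limitin_ntop_iff[OF nm])
  from limitin_ntop_add[OF nm this y]
  have lim: "limitin (ntop Y m) (\<lambda>r. L r (x r - x0) + L r x0) y0 F" by simp
  show ?thesis
    by (rule limitin_eventually_cong[OF lim]) (rule eventually_mono[OF ev], simp)
qed

lemma cont_into_op_apply:
  assumes nn: "normed_on X n" and nm: "normed_on Y m" and y: "cont_into S X n y"
    and L: "\<And>t. t \<in> S \<Longrightarrow> \<exists>C. \<forall>\<^sub>F r in at t within S. op_bound X n Y m C (L r)"
    and cont: "\<And>x. x \<in> X \<Longrightarrow> cont_into S Y m (\<lambda>r. L r x)"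
  shows "cont_into S Y m (\<lambda>r. L r (y r))"
  unfolding cont_into_iff
proof
  fix t assume t: "t \<in> S"
  obtain C where C: "\<forall>\<^sub>F r in at t within S. op_bound X n Y m C (L r)" using L[OF t] ..
  have lim: "limitin (ntop X n) y (y t) (at t within S)" using y t by (simp add: cont_into_iff)
  then have "y t \<in> X" by (simp add: limitin_ntop_iff[OF nn])
  then have "limitin (ntop Y m) (\<lambda>r. L r (y t)) (L t (y t)) (at t within S)"
    using cont t by (simp add: cont_into_iff)
  then show "limitin (ntop Y m) (\<lambda>r. L r (y r)) (L t (y t)) (at t within S)"
    by (rule limitin_op_apply[OF nn nm C lim])
qed

lemma op_bound_compose:
  assumes X: "subspace X" and Y: "subspace Y" and g: "op_bound X n Y m C g" and f: "op_bound Y m Z l D f"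
  shows "op_bound X n Z l (D * C) (\<lambda>x. f (g x))"
proof -
  have bg: "bounded_op X n Y m g" and bf: "bounded_op Y m Z l f"
    and C: "0 \<le> C" "\<And>x. x \<in> X \<Longrightarrow> m (g x) \<le> C * n x"
    and D: "0 \<le> D" "\<And>y. y \<in> Y \<Longrightarrow> l (f y) \<le> D * m y"
    using f g by (simp_all add: op_bound_def)
  note g' = bounded_opD(1-3)[OF bg X] and f' = bounded_opD(1-3)[OF bf Y]
  have le: "l (f (g x)) \<le> D * C * n x" if "x \<in> X" for x
    using D(2)[OF g'(1)[OF that]] mult_left_mono[OF C(2)[OF that] D(1)] by (simp add: mult.assoc)
  then have "bounded_op X n Z l (\<lambda>x. f (g x))"
    unfolding bounded_op_def using g' f' by auto
  then show ?thesis using le C(1) D(1) by (simp add: op_bound_def)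
qed

section \<open>Comparing gauge integrals\<close>

lemma integral_intoD:
  assumes nn: "normed_on X n" and f: "integral_into X n f s t I" and "e > 0"
  shows "\<exists>g. gauge g \<and> (\<forall>p. p tagged_division_of {s..t} \<and> g fine p \<longrightarrow>
       n ((\<Sum>(x, k)\<in>p. measure lborel k *\<^sub>R f x) - I) < e)"
proof -
  have "((\<lambda>p. n ((\<Sum>(x, k)\<in>p. measure lborel k *\<^sub>R f x) - I)) \<longlongrightarrow> 0) (division_filter {s..t})"
    using f by (simp add: integral_into_def limitin_ntop_iff[OF nn])
  from order_tendstoD(2)[OF this \<open>e > 0\<close>] show ?thesis
    unfolding eventually_division_filter .
qed

lemma integral_into_mem:
  assumes "normed_on X n" "integral_into X n f s t I"
  shows "I \<in> X" "r \<in> {s..t} \<Longrightarrow> f r \<in> X"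
  using assms(2) by (simp_all add: integral_into_def limitin_ntop_iff[OF assms(1)])

lemma integral_into_op:
  assumes nn: "normed_on X n" and nm: "normed_on Y m" and L: "op_bound X n Y m C L"
    and f: "integral_into X n f s t I"
  shows "integral_into Y m (\<lambda>r. L (f r)) s t (L I)"
proof -
  note X = normed_onD(1)[OF nn]
  have b: "bounded_op X n Y m L" using L by (simp add: op_bound_def)
  let ?D = "division_filter {s..t}"
  let ?S = "\<lambda>p. \<Sum>(x, k)\<in>p. measure lborel k *\<^sub>R f x"
  have IX: "I \<in> X" and fX: "\<And>r. r \<in> {s..t} \<Longrightarrow> f r \<in> X"
    using integral_into_mem[OF nn f] by blast+
  have lim: "limitin (ntop X n) ?S I ?D" using f by (simp add: integral_into_def)
  have "limitin (ntop Y m) (\<lambda>p. L (?S p)) (L I) ?D"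
  proof (rule limitin_op_apply[where C=C, OF nn nm _ lim])
    show "limitin (ntop Y m) (\<lambda>_. L I) (L I) ?D"
      unfolding limitin_ntop_iff[OF nm]
      using bounded_opD(1)[OF b X IX] normed_onD(3)[OF nm] by simp
  qed (use L in simp)
  moreover have "\<forall>\<^sub>F p in ?D. L (?S p) = (\<Sum>(x, k)\<in>p. measure lborel k *\<^sub>R L (f x))"
    using eventually_division_filter_tagged_division
  proof eventually_elim
    case (elim p)
    have pt: "\<And>x k. (x, k) \<in> p \<Longrightarrow> f x \<in> X"
      using tag_in_interval[OF elim] fX by blast
    have "q \<subseteq> p \<Longrightarrow> finite q \<Longrightarrow> L (\<Sum>(x, k)\<in>q. measure lborel k *\<^sub>R f x)
       = (\<Sum>(x, k)\<in>q. measure lborel k *\<^sub>R L (f x))" for q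
    proof (induction q rule: infinite_finite_induct)
      case (insert z q)
      obtain x k where z: "z = (x, k)" by (cases z)
      have fx: "f x \<in> X" using insert z pt by auto
      have "(\<Sum>(x, k)\<in>q. measure lborel k *\<^sub>R f x) \<in> X"
        using insert.prems pt by (intro subspace_sum[OF X]) (auto intro!: subspace_scale[OF X])
      then show ?case
        using insert z fx bounded_opD(2,3)[OF b X] subspace_scale[OF X] by auto
    qed (auto simp: bounded_opD(5)[OF b X])
    from this[OF order_refl tagged_division_of_finite[OF elim]] show ?case .
  qed
  ultimately have "limitin (ntop Y m) (\<lambda>p. \<Sum>(x, k)\<in>p. measure lborel k *\<^sub>R L (f x)) (L I) ?D"
    by (rule limitin_eventually_cong)
  then show ?thesis
    using fX bounded_opD(1)[OF b X] by (simp add: integral_into_def)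
qed

lemma sum_tagged_division_Un:
  fixes f :: "real \<Rightarrow> 'a::real_vector"
  assumes p: "p tagged_division_of S" and q: "q tagged_division_of R"
    and disj: "interior S \<inter> interior R = {}"
  shows "(\<Sum>(x, k)\<in>p \<union> q. measure lborel k *\<^sub>R f x) =
    (\<Sum>(x, k)\<in>p. measure lborel k *\<^sub>R f x) + (\<Sum>(x, k)\<in>q. measure lborel k *\<^sub>R f x)"
proof (rule sum.union_inter_neutral)
  show "\<forall>z\<in>p \<inter> q. (case z of (x, k) \<Rightarrow> measure lborel k *\<^sub>R f x) = 0"
  proof clarify
    fix x k assume xk: "(x, k) \<in> p" "(x, k) \<in> q"
    obtain a b where k: "k = cbox a b" using tagged_division_ofD(4)[OF p xk(1)] by blast
    have "interior k \<subseteq> interior S \<inter> interior R"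
      using tagged_division_ofD(3)[OF p xk(1)] tagged_division_ofD(3)[OF q xk(2)]
      by (simp add: interior_mono)
    then have "interior k = {}" using disj by blast
    then have "Henstock_Kurzweil_Integration.content k = 0" unfolding k content_eq_0_interior .
    then show "measure lborel k *\<^sub>R f x = 0" by simp
  qed
qed (use p q in \<open>auto intro: tagged_division_of_finite\<close>)

lemma Riemann_sum_mem:
  assumes nn: "normed_on X n" and p: "p tagged_division_of {s..t}"
    and f: "\<And>r. r \<in> {s..t} \<Longrightarrow> f r \<in> X"
  shows "(\<Sum>(x, k)\<in>p. measure lborel k *\<^sub>R f x) \<in> X"
proof (rule subspace_sum[OF normed_onD(1)[OF nn]])
  fix z assume "z \<in> p"
  moreover obtain x k where z: "z = (x, k)" by (cases z)
  ultimately have "x \<in> {s..t}" using tag_in_interval[OF p, of x k] by simp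
  then show "(case z of (x, k) \<Rightarrow> measure lborel k *\<^sub>R f x) \<in> X"
    using f subspace_scale[OF normed_onD(1)[OF nn]] by (simp add: z)
qed

lemma Riemann_sum_le:
  assumes nn: "normed_on X n" and p: "p tagged_division_of {s..t}" and "s \<le> t"
    and f: "\<And>r. r \<in> {s..t} \<Longrightarrow> f r \<in> X" "\<And>r. r \<in> {s..t} \<Longrightarrow> n (f r) \<le> e"
  shows "n (\<Sum>(x, k)\<in>p. measure lborel k *\<^sub>R f x) \<le> (t - s) * e"
proof -
  have "n (\<Sum>(x, k)\<in>p. measure lborel k *\<^sub>R f x) \<le> (\<Sum>(x, k)\<in>p. measure lborel k * e)"
  proof (rule normed_on_sum_le[OF nn])
    fix z assume "z \<in> p"
    moreover obtain x k where z: "z = (x, k)" by (cases z)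
    ultimately have x: "x \<in> {s..t}" using tag_in_interval[OF p, of x k] by simp
    show "(case z of (x, k) \<Rightarrow> measure lborel k *\<^sub>R f x) \<in> X"
      using f(1)[OF x] subspace_scale[OF normed_onD(1)[OF nn]] by (simp add: z)
    show "n (case z of (x, k) \<Rightarrow> measure lborel k *\<^sub>R f x) \<le> (case z of (x, k) \<Rightarrow> measure lborel k * e)"
      using f(2)[OF x] normed_onD(5)[OF nn f(1)[OF x]]
      by (simp add: z mult_left_mono)
  qed
  also have "\<dots> = (\<Sum>(x, k)\<in>p. measure lborel k) * e"
    by (simp add: sum_distrib_right case_prod_unfold)
  also have "(\<Sum>(x, k)\<in>p. measure lborel k) = t - s"
    using additive_content_tagged_division[of p s t] p \<open>s \<le> t\<close> by simp
  finally show ?thesis .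
qed

text \<open>
  The quantitative form of differentiating a parameter integral whose domain also grows. Here \<open>f1\<close>
  and \<open>f2\<close> are the integrands at the old and the new parameter, \<open>G\<close> is the derivative of the
  integrand, \<open>{s2..t2}\<close> is the part added to the domain and \<open>c\<close> approximates \<open>f2\<close> there. A division of
  the old part that is fine for all three integrals, joined to a fine division of the new part, is a
  fine division of the whole interval; so the estimate may be read off from Riemann sums, which are
  linear in the integrand. The new part may lie on either side.
\<close>

lemma integral_into_increment_le:
  assumes nn: "normed_on X n"
    and len: "s1 \<le> t1" "s2 \<le> t2" and Un: "{s1..t1} \<union> {s2..t2} = {s..t}"
    and disj: "interior {s1..t1} \<inter> interior {s2..t2} = {}"
    and f2: "integral_into X n f2 s t I2" and f1: "integral_into X n f1 s1 t1 I1"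
    and G: "integral_into X n G s1 t1 J" and c: "c \<in> X"
    and e1: "\<And>r. r \<in> {s1..t1} \<Longrightarrow> n (f2 r - f1 r - h *\<^sub>R G r) \<le> e1"
    and e2: "\<And>r. r \<in> {s2..t2} \<Longrightarrow> n (f2 r - c) \<le> e2"
  shows "n (I2 - I1 - h *\<^sub>R J - (t2 - s2) *\<^sub>R c) \<le> (t1 - s1) * e1 + (t2 - s2) * e2"
proof (rule field_le_epsilon)
  note X = normed_onD(1)[OF nn]
  note mem = integral_into_mem[OF nn f2] integral_into_mem[OF nn f1] integral_into_mem[OF nn G]
  fix e :: real assume "e > 0"
  \<comment> \<open>The sums for \<open>f2\<close>, \<open>f1\<close> and \<open>G\<close> contribute the errors \<open>d\<close>, \<open>d\<close> and \<open>\<bar>h\<bar> * d\<close>.\<close>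
  define d where "d = e / (2 + \<bar>h\<bar>)"
  have "d * (2 + \<bar>h\<bar>) = e" by (simp add: d_def)
  then have d: "d > 0" "d + d + \<bar>h\<bar> * d = e"
    using \<open>e > 0\<close> by (simp add: d_def add_pos_nonneg, simp add: algebra_simps)
  obtain g2 where g2: "gauge g2 \<and> (\<forall>p. p tagged_division_of {s..t} \<and> g2 fine p \<longrightarrow>
       n ((\<Sum>(x, k)\<in>p. measure lborel k *\<^sub>R f2 x) - I2) < d)"
    using integral_intoD[OF nn f2 d(1)] ..
  obtain g1 where g1: "gauge g1 \<and> (\<forall>p. p tagged_division_of {s1..t1} \<and> g1 fine p \<longrightarrow>
       n ((\<Sum>(x, k)\<in>p. measure lborel k *\<^sub>R f1 x) - I1) < d)"
    using integral_intoD[OF nn f1 d(1)] ..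
  obtain g where g: "gauge g \<and> (\<forall>p. p tagged_division_of {s1..t1} \<and> g fine p \<longrightarrow>
       n ((\<Sum>(x, k)\<in>p. measure lborel k *\<^sub>R G x) - J) < d)"
    using integral_intoD[OF nn G d(1)] ..
  obtain p where p: "p tagged_division_of {s1..t1}" "(\<lambda>x. g2 x \<inter> (g1 x \<inter> g x)) fine p"
    by (rule fine_division_exists_real[OF gauge_Int[OF conjunct1[OF g2] gauge_Int[OF conjunct1[OF g1] conjunct1[OF g]]]])
  then have pf: "g2 fine p" "g1 fine p" "g fine p" by (auto simp: fine_Int)
  obtain q where q: "q tagged_division_of {s2..t2}" "g2 fine q"
    by (rule fine_division_exists_real[OF conjunct1[OF g2]])
  let ?S = "\<lambda>p f. \<Sum>(x, k)\<in>p. measure lborel k *\<^sub>R f x"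
  have S: "?S (p \<union> q) f2 = ?S p f2 + ?S q f2"
    by (rule sum_tagged_division_Un[OF p(1) q(1) disj])
  have "(p \<union> q) tagged_division_of {s..t}"
    using tagged_division_Un[OF p(1) q(1) disj] Un by simp
  then have n2: "n (?S p f2 + ?S q f2 - I2) < d"
    using g2 fine_Un[OF pf(1) q(2)] by (simp flip: S)
  have n1: "n (?S p f1 - I1) < d" and nG: "n (?S p G - J) < d"
    using g1 g p(1) pf by simp_all
  have sub: "{s1..t1} \<subseteq> {s..t}" "{s2..t2} \<subseteq> {s..t}" using Un by blast+
  have dX1: "f2 r - f1 r - h *\<^sub>R G r \<in> X" if "r \<in> {s1..t1}" for r
    using mem that sub(1) by (intro subspace_diff[OF X] subspace_scale[OF X]) blast+
  have dX2: "f2 r - c \<in> X" if "r \<in> {s2..t2}" for r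
    using mem that sub(2) c by (intro subspace_diff[OF X]) blast+
  have m1: "n (?S p (\<lambda>r. f2 r - f1 r - h *\<^sub>R G r)) \<le> (t1 - s1) * e1"
    by (rule Riemann_sum_le[OF nn p(1) len(1) dX1 e1])
  have m2: "n (?S q (\<lambda>r. f2 r - c)) \<le> (t2 - s2) * e2"
    by (rule Riemann_sum_le[OF nn q(1) len(2) dX2 e2])
  have "(\<Sum>(x, k)\<in>q. measure lborel k) = t2 - s2"
    using additive_content_tagged_division[of q s2 t2] q(1) len(2) by simp
  then have Sc: "?S q (\<lambda>r. c) = (t2 - s2) *\<^sub>R c"
    by (simp add: case_prod_unfold scaleR_sum_left[symmetric])
  have "f1 r \<in> X \<and> f2 r \<in> X \<and> G r \<in> X" if "r \<in> {s1..t1}" for r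
    using mem(4)[OF that] mem(6)[OF that] mem(2)[of r] sub(1) that by auto
  then have SX: "?S p f1 \<in> X" "?S p f2 \<in> X" "?S p G \<in> X"
    by (auto intro!: Riemann_sum_mem[OF nn p(1)])
  have SX2: "?S q f2 \<in> X"
    using mem(2) sub(2) by (auto intro!: Riemann_sum_mem[OF nn q(1)])
  let ?u1 = "?S p f2 + ?S q f2 - I2" and ?u2 = "?S p f1 - I1" and ?u3 = "?S p G - J"
    and ?u4 = "?S p (\<lambda>r. f2 r - f1 r - h *\<^sub>R G r)" and ?u5 = "?S q (\<lambda>r. f2 r - c)"
  have tri: "n (v4 + v5 - v1 + v2 + v3) \<le> n v4 + n v5 + n v1 + n v2 + n v3"
    if "v1 \<in> X" "v2 \<in> X" "v3 \<in> X" "v4 \<in> X" "v5 \<in> X" for v1 v2 v3 v4 v5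
    using that normed_onD(6)[OF nn, of v4 v5] normed_onD(8)[OF nn, of "v4 + v5" v1]
      normed_onD(6)[OF nn, of "v4 + v5 - v1" v2] normed_onD(6)[OF nn, of "v4 + v5 - v1 + v2" v3]
    by (simp add: subspace_add[OF X] subspace_diff[OF X])
  have u3: "?u3 \<in> X" by (rule subspace_diff[OF X SX(3) mem(5)])
  have uX: "?u1 \<in> X" "?u2 \<in> X" "h *\<^sub>R ?u3 \<in> X" "?u4 \<in> X" "?u5 \<in> X"
    using subspace_diff[OF X subspace_add[OF X SX(2) SX2] mem(1)] subspace_diff[OF X SX(1) mem(3)]
      subspace_scale[OF X u3] Riemann_sum_mem[OF nn p(1) dX1] Riemann_sum_mem[OF nn q(1) dX2]
    by simp_all
  have e4: "?u4 = ?S p f2 - ?S p f1 - h *\<^sub>R ?S p G"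
    by (simp add: case_prod_unfold scaleR_diff_right sum_subtractf scaleR_sum_right mult.commute)
  have e5: "?u5 = ?S q f2 - (t2 - s2) *\<^sub>R c"
    unfolding Sc[symmetric] by (simp add: case_prod_unfold scaleR_diff_right sum_subtractf)
  have dec: "I2 - I1 - h *\<^sub>R J - (t2 - s2) *\<^sub>R c = ?u4 + ?u5 - ?u1 + ?u2 + h *\<^sub>R ?u3"
    unfolding e4 e5 by (simp add: algebra_simps)
  have "n (I2 - I1 - h *\<^sub>R J - (t2 - s2) *\<^sub>R c)
      \<le> n ?u4 + n ?u5 + n ?u1 + n ?u2 + n (h *\<^sub>R ?u3)"
    unfolding dec by (rule tri[OF uX])
  moreover have "n (h *\<^sub>R ?u3) \<le> \<bar>h\<bar> * d"
    unfolding normed_onD(5)[OF nn u3] using nG by (intro mult_left_mono) simp_all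
  ultimately show "n (I2 - I1 - h *\<^sub>R J - (t2 - s2) *\<^sub>R c)
      \<le> (t1 - s1) * e1 + (t2 - s2) * e2 + e"
    using m1 m2 n1 n2 d(2) by linarith
qed

text \<open>
  The case of a fixed integrand: the increment of the integral is close to the length of the added
  interval times any approximate value of the integrand.
\<close>

lemma integral_into_additive_le:
  assumes nn: "normed_on X n"
    and len: "s1 \<le> t1" "s2 \<le> t2" and Un: "{s1..t1} \<union> {s2..t2} = {s..t}"
    and disj: "interior {s1..t1} \<inter> interior {s2..t2} = {}"
    and f: "integral_into X n f s t I2" "integral_into X n f s1 t1 I1" and c: "c \<in> X"
    and e: "\<And>r. r \<in> {s2..t2} \<Longrightarrow> n (f r - c) \<le> e"
  shows "n (I2 - I1 - (t2 - s2) *\<^sub>R c) \<le> (t2 - s2) * e"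
  using integral_into_increment_le[OF nn len Un disj f(1,2,2) c _ e, of 0 0] normed_onD(3)[OF nn]
  by simp

lemma subspace_increment:
  assumes "subspace X" "x \<in> X" "y \<in> X" "z \<in> X" "c \<in> X"
  shows "x - y - h *\<^sub>R z - l *\<^sub>R c \<in> X"
  using assms by (intro subspace_diff subspace_scale)

section \<open>One-sided derivatives and continuous differentiability\<close>

text \<open>
  The largest point at which \<open>\<phi> x \<le> \<phi> a + (C + e) * (x - a)\<close> holds exists by continuity, and the
  growth condition moves it further to the right unless it is \<open>b\<close>.
\<close>

lemma increment_le_of_right_growth:
  fixes \<phi> :: "real \<Rightarrow> real"
  assumes "a \<le> b" and cont: "continuous_on {a..b} \<phi>"
    and growth: "\<And>x e. x \<in> {a..<b} \<Longrightarrow> e > 0 \<Longrightarrow>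
      \<exists>d>0. \<forall>y. x < y \<and> y < x + d \<and> y \<le> b \<longrightarrow> \<phi> y - \<phi> x \<le> (C + e) * (y - x)"
  shows "\<phi> b - \<phi> a \<le> C * (b - a)"
proof -
  have le: "\<phi> b - \<phi> a \<le> (C + e) * (b - a)" if "e > 0" for e
  proof -
    define S where "S = {x \<in> {a..b}. \<phi> x - (C + e) * (x - a) \<le> \<phi> a}"
    have "closed S"
      unfolding S_def
      by (intro continuous_closed_preimage_constant[where f="\<lambda>x. x"] continuous_on_closed_Collect_le
          continuous_intros cont)
    moreover have "a \<in> S" "bdd_above S"
      using \<open>a \<le> b\<close> by (auto simp: S_def intro!: bdd_aboveI[of _ b])
    ultimately have c: "Sup S \<in> S"
      by (intro closed_contains_Sup) auto
    define c where "c = Sup S"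
    have cS: "c \<in> {a..b}" "\<phi> c - (C + e) * (c - a) \<le> \<phi> a"
      using c by (auto simp: S_def c_def)
    have "c = b"
    proof (rule ccontr)
      assume "c \<noteq> b"
      then have "c \<in> {a..<b}" using cS by auto
      from growth[OF this \<open>e > 0\<close>] obtain d where d: "d > 0"
        "\<And>y. c < y \<Longrightarrow> y < c + d \<Longrightarrow> y \<le> b \<Longrightarrow> \<phi> y - \<phi> c \<le> (C + e) * (y - c)"
        by blast
      define y where "y = min b (c + d / 2)"
      have y: "c < y" "y < c + d" "y \<le> b"
        using \<open>d > 0\<close> \<open>c \<in> {a..<b}\<close> by (auto simp: y_def)
      have "y \<in> S"
        using d(2)[OF y] cS y by (auto simp: S_def algebra_simps)
      then have "y \<le> c"
        unfolding c_def using \<open>bdd_above S\<close> by (rule cSup_upper)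
      then show False using y by simp
    qed
    then show ?thesis using cS by simp
  qed
  show ?thesis
  proof (cases "a = b")
    case False
    then have "b - a > 0" using \<open>a \<le> b\<close> by simp
    show ?thesis
    proof (rule field_le_epsilon)
      fix e :: real assume "e > 0"
      then show "\<phi> b - \<phi> a \<le> C * (b - a) + e"
        using le[of "e / (b - a)"] \<open>b - a > 0\<close> by (simp add: distrib_right)
    qed
  qed simp
qed

lemma cont_intoD:
  fixes S :: "real set"
  assumes nn: "normed_on X n" and f: "cont_into S X n f" and t: "t \<in> S"
  shows "f t \<in> X" and "e > 0 \<Longrightarrow> \<exists>d>0. \<forall>x\<in>S. \<bar>x - t\<bar> < d \<longrightarrow> n (f x - f t) < e"
proof -
  have lim: "f t \<in> X" "((\<lambda>x. n (f x - f t)) \<longlongrightarrow> 0) (at t within S)"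
    using f t by (simp_all add: cont_into_iff limitin_ntop_iff[OF nn])
  show "f t \<in> X" by (rule lim(1))
  show "\<exists>d>0. \<forall>x\<in>S. \<bar>x - t\<bar> < d \<longrightarrow> n (f x - f t) < e" if "e > 0"
  proof -
    obtain d where "d > 0" "\<forall>x\<in>S. x \<noteq> t \<and> dist x t < d \<longrightarrow> n (f x - f t) < e"
      using order_tendstoD(2)[OF lim(2) \<open>e > 0\<close>] unfolding eventually_at by blast
    moreover have "n (f t - f t) < e" using normed_onD(3)[OF nn] \<open>e > 0\<close> by simp
    ultimately show ?thesis by (metis dist_real_def)
  qed
qed

lemma cont_into_norm_diff:
  assumes nn: "normed_on X n" and f: "cont_into S X n f"
    and g: "\<And>x. x \<in> S \<Longrightarrow> g x \<in> X" "\<And>x y. x \<in> S \<Longrightarrow> y \<in> S \<Longrightarrow> n (g y - g x) \<le> L * \<bar>y - x\<bar>"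
  shows "continuous_on S (\<lambda>x. n (f x - g x))"
  unfolding continuous_on_def
proof
  note X = normed_onD(1)[OF nn]
  fix t assume t: "t \<in> S"
  have fX: "f x \<in> X" if "x \<in> S" for x using cont_intoD(1)[OF nn f that] .
  have lim: "((\<lambda>x. n (f x - f t)) \<longlongrightarrow> 0) (at t within S)"
    using f t by (simp add: cont_into_iff limitin_ntop_iff[OF nn])
  have "((\<lambda>x. n (f x - f t) + L * \<bar>x - t\<bar>) \<longlongrightarrow> 0 + L * \<bar>t - t\<bar>) (at t within S)"
    by (intro tendsto_intros lim)
  then have lim: "((\<lambda>x. n (f x - f t) + L * \<bar>x - t\<bar>) \<longlongrightarrow> 0) (at t within S)" by simp
  have "\<forall>\<^sub>F x in at t within S. x \<in> S" by (simp add: eventually_at_filter)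
  then have "\<forall>\<^sub>F x in at t within S. norm (n (f x - g x) - n (f t - g t)) \<le> n (f x - f t) + L * \<bar>x - t\<bar>"
  proof eventually_elim
    case (elim x)
    have mem: "f x - g x \<in> X" "f t - g t \<in> X" "f x - f t \<in> X" "g x - g t \<in> X" "f t - f x \<in> X" "g t - g x \<in> X"
      using fX g(1) elim t by (auto intro: subspace_diff[OF X])
    have "n (f x - g x) \<le> n (f t - g t) + (n (f x - f t) + n (g x - g t))"
      using normed_onD(6)[OF nn mem(2) subspace_diff[OF X mem(3,4)]] normed_onD(8)[OF nn mem(3,4)]
      by simp
    moreover have "n (f t - g t) \<le> n (f x - g x) + (n (f t - f x) + n (g t - g x))"
      using normed_onD(6)[OF nn mem(1) subspace_diff[OF X mem(5,6)]] normed_onD(8)[OF nn mem(5,6)]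
      by simp
    moreover have "n (f t - f x) = n (f x - f t)" "n (g t - g x) = n (g x - g t)"
      using normed_onD(9)[OF nn] fX g(1) elim t by blast+
    ultimately show ?case using g(2)[OF t elim] by simp
  qed
  from Lim_null_comparison[OF this lim]
  show "((\<lambda>x. n (f x - g x)) \<longlongrightarrow> n (f t - g t)) (at t within S)"
    by (simp add: LIM_zero_iff)
qed

text \<open>
  Near \<open>t\<close> the function \<open>z \<mapsto> n (f z - f x - (z - x) *\<^sub>R f' t)\<close> grows to the right at rate at most
  \<open>n (f' z - f' t)\<close>, which is small by continuity of \<open>f'\<close>. The resulting estimate no longer
  distinguishes a base point on the left from one on the right.
\<close>

lemma right_increment_estimate:
  assumes nn: "normed_on X n" and S: "is_interval S"
    and f: "cont_into S X n f" and f': "cont_into S X n f'"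
    and right: "\<And>t e. t \<in> S \<Longrightarrow> e > 0 \<Longrightarrow>
      \<exists>d>0. \<forall>x\<in>S. t < x \<and> x < t + d \<longrightarrow> n (f x - f t - (x - t) *\<^sub>R f' t) \<le> e * (x - t)"
    and t: "t \<in> S" and "e > 0"
  shows "\<exists>d>0. \<forall>x\<in>S. \<forall>y\<in>S. \<bar>x - t\<bar> < d \<and> \<bar>y - t\<bar> < d \<and> x \<le> y \<longrightarrow>
      n (f y - f x - (y - x) *\<^sub>R f' t) \<le> e * (y - x)"
proof -
  note X = normed_onD(1)[OF nn]
  have fX: "f x \<in> X" "f' x \<in> X" if "x \<in> S" for x
    using cont_intoD(1)[OF nn f that] cont_intoD(1)[OF nn f' that] .
  obtain d where d: "d > 0" "\<And>x. x \<in> S \<Longrightarrow> \<bar>x - t\<bar> < d \<Longrightarrow> n (f' x - f' t) < e"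
    using cont_intoD(2)[OF nn f' t \<open>e > 0\<close>] by blast
  have "n (f y - f x - (y - x) *\<^sub>R f' t) \<le> e * (y - x)"
    if x: "x \<in> S" "\<bar>x - t\<bar> < d" and y: "y \<in> S" "\<bar>y - t\<bar> < d" and "x \<le> y" for x y
  proof -
    define g where "g z = f x + (z - x) *\<^sub>R f' t" for z
    have gX: "g z \<in> X" for z
      unfolding g_def by (rule subspace_add[OF X fX(1)[OF x(1)] subspace_scale[OF X fX(2)[OF t]]])
    have sub: "{x..y} \<subseteq> S"
      using interval_subset_is_interval[OF S, of x y] x(1) y(1) by simp
    have dg: "g z' - g z = (z' - z) *\<^sub>R f' t" for z z'
      by (simp add: g_def algebra_simps)
    have "n (f y - g y) - n (f x - g x) \<le> e * (y - x)"
    proof (rule increment_le_of_right_growth[OF \<open>x \<le> y\<close>])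
      show "continuous_on {x..y} (\<lambda>z. n (f z - g z))"
        using gX fX(2)[OF t] normed_onD(5)[OF nn]
        by (intro cont_into_norm_diff[OF nn cont_into_subset[OF f sub], where L="n (f' t)"])
           (auto simp: dg)
    next
      fix z and e' :: real assume z: "z \<in> {x..<y}" and "e' > 0"
      then have zS: "z \<in> S" "\<bar>z - t\<bar> < d" using sub x y by auto
      obtain d' where d': "d' > 0"
        "\<And>w. w \<in> S \<Longrightarrow> z < w \<Longrightarrow> w < z + d' \<Longrightarrow> n (f w - f z - (w - z) *\<^sub>R f' z) \<le> e' * (w - z)"
        using right[OF zS(1) \<open>e' > 0\<close>] by blast
      have "n (f w - g w) - n (f z - g z) \<le> (e + e') * (w - z)"
        if w: "z < w" "w < z + d'" "w \<le> y" for w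
      proof -
        have wS: "w \<in> S" using sub z w by auto
        let ?r = "f w - f z - (w - z) *\<^sub>R f' z" and ?q = "(w - z) *\<^sub>R (f' z - f' t)"
        have mem: "f z - g z \<in> X" "?r \<in> X" "f' z - f' t \<in> X" "?q \<in> X"
          using fX gX wS zS t by (auto intro!: subspace_diff[OF X] subspace_scale[OF X])
        have "f w - g w = (f z - g z) + (?r + ?q)"
          using dg[of w z] by (simp add: algebra_simps)
        then have "n (f w - g w) \<le> n (f z - g z) + (n ?r + n ?q)"
          using normed_onD(6)[OF nn mem(1) subspace_add[OF X mem(2,4)]] normed_onD(6)[OF nn mem(2,4)]
          by (simp only:)
        moreover have "n ?r \<le> e' * (w - z)" by (rule d'(2)[OF wS w(1,2)])
        moreover have "n ?q \<le> (w - z) * e"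
          using d(2)[OF zS] w(1) normed_onD(5)[OF nn mem(3)] by simp
        ultimately show ?thesis by (simp add: algebra_simps)
      qed
      then show "\<exists>d>0. \<forall>w. z < w \<and> w < z + d \<and> w \<le> y \<longrightarrow>
          n (f w - g w) - n (f z - g z) \<le> (e + e') * (w - z)"
        using d'(1) by blast
    qed
    then show ?thesis
      using normed_onD(3)[OF nn] by (simp add: g_def diff_diff_eq)
  qed
  then show ?thesis using d(1) by blast
qed

lemma C1_into_of_estimate:
  assumes nn: "normed_on X n" and f: "\<And>t. t \<in> S \<Longrightarrow> f t \<in> X" and f': "cont_into S X n f'"
    and est: "\<And>t e. t \<in> S \<Longrightarrow> e > 0 \<Longrightarrow> \<exists>d>0. \<forall>x\<in>S. \<forall>y\<in>S.
      \<bar>x - t\<bar> < d \<and> \<bar>y - t\<bar> < d \<and> x \<le> y \<longrightarrow> n (f y - f x - (y - x) *\<^sub>R f' t) \<le> e * (y - x)"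
  shows "C1_into S X n f f'"
proof -
  note X = normed_onD(1)[OF nn]
  have "deriv_into X n f (f' t) t S" if t: "t \<in> S" for t
  proof -
    let ?q = "\<lambda>x. inverse (x - t) *\<^sub>R (f x - f t)"
    have f't: "f' t \<in> X" by (rule cont_intoD(1)[OF nn f' t])
    have qX: "?q x \<in> X" if "x \<in> S" for x
      using f t that by (intro subspace_scale[OF X] subspace_diff[OF X])
    have "\<exists>d>0. \<forall>x\<in>S. x \<noteq> t \<and> dist x t < d \<longrightarrow> dist (n (?q x - f' t)) 0 < e" if "e > 0" for e
    proof -
      obtain d where d: "d > 0" "\<And>x y. x \<in> S \<Longrightarrow> y \<in> S \<Longrightarrow> \<bar>x - t\<bar> < d \<Longrightarrow> \<bar>y - t\<bar> < d \<Longrightarrow> x \<le> y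
          \<Longrightarrow> n (f y - f x - (y - x) *\<^sub>R f' t) \<le> (e / 2) * (y - x)"
        using est[OF t, of "e / 2"] \<open>e > 0\<close> by (metis half_gt_zero)
      have "dist (n (?q x - f' t)) 0 < e" if x: "x \<in> S" "x \<noteq> t" "dist x t < d" for x
      proof -
        let ?u = "f x - f t - (x - t) *\<^sub>R f' t"
        have uX: "?u \<in> X"
          using f t x f't by (intro subspace_scale[OF X] subspace_diff[OF X])
        have "f t - f x - (t - x) *\<^sub>R f' t = - ?u" by (simp add: algebra_simps)
        then have "n (f t - f x - (t - x) *\<^sub>R f' t) = n ?u"
          by (simp only: normed_onD(7)[OF nn uX])
        then have "n ?u \<le> (e / 2) * \<bar>x - t\<bar>"
          using d(2)[OF t x(1)] d(2)[OF x(1) t] x d(1)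
          by (cases "t \<le> x") (auto simp: dist_real_def)
        moreover have "?q x - f' t = inverse (x - t) *\<^sub>R ?u"
          using x(2) by (simp add: scaleR_diff_right)
        then have "n (?q x - f' t) = inverse \<bar>x - t\<bar> * n ?u"
          using normed_onD(5)[OF nn uX] by (simp add: abs_inverse)
        ultimately have "n (?q x - f' t) \<le> inverse \<bar>x - t\<bar> * ((e / 2) * \<bar>x - t\<bar>)"
          by (simp only:, intro mult_left_mono) simp_all
        also have "\<dots> = e / 2" using x(2) by simp
        finally have "n (?q x - f' t) \<le> e / 2" .
        then show ?thesis
          using \<open>e > 0\<close> normed_onD(2)[OF nn subspace_diff[OF X qX[OF x(1)] f't]] by simp
      qed
      then show ?thesis using d(1) by blast
    qed
    then have "((\<lambda>x. n (?q x - f' t)) \<longlongrightarrow> 0) (at t within S)"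
      unfolding tendsto_iff eventually_at by blast
    then show ?thesis
      unfolding deriv_into_def limitin_ntop_iff[OF nn]
      using f't qX by (auto simp: eventually_at_filter)
  qed
  then show ?thesis using f f' by (simp add: C1_into_def)
qed

lemma C1_into_of_right_derivative:
  assumes nn: "normed_on X n" and S: "is_interval S"
    and f: "cont_into S X n f" and f': "cont_into S X n f'"
    and right: "\<And>t e. t \<in> S \<Longrightarrow> e > 0 \<Longrightarrow>
      \<exists>d>0. \<forall>x\<in>S. t < x \<and> x < t + d \<longrightarrow> n (f x - f t - (x - t) *\<^sub>R f' t) \<le> e * (x - t)"
  shows "C1_into S X n f f'"
  by (rule C1_into_of_estimate[OF nn cont_intoD(1)[OF nn f] f'
        right_increment_estimate[OF nn S f f' right]])

text \<open>
  Reflection of the time axis turns left derivatives into right ones.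
\<close>

lemma C1_into_of_left_derivative:
  assumes nn: "normed_on X n" and S: "is_interval S"
    and f: "cont_into S X n f" and f': "cont_into S X n f'"
    and left: "\<And>t e. t \<in> S \<Longrightarrow> e > 0 \<Longrightarrow>
      \<exists>d>0. \<forall>x\<in>S. t - d < x \<and> x < t \<longrightarrow> n (f x - f t - (x - t) *\<^sub>R f' t) \<le> e * (t - x)"
  shows "C1_into S X n f f'"
proof (rule C1_into_of_estimate[OF nn cont_intoD(1)[OF nn f] f'])
  note X = normed_onD(1)[OF nn]
  let ?S = "uminus ` S" and ?f = "\<lambda>x. f (- x)" and ?f' = "\<lambda>x. - f' (- x)"
  have mem: "x \<in> ?S \<longleftrightarrow> - x \<in> S" for x by (metis image_iff minus_minus)
  have rS: "is_interval ?S" using S by simp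
  have rf: "cont_into ?S X n ?f"
    by (rule cont_into_compose[OF f]) (auto intro!: continuous_intros)
  have "cont_into ?S X n (\<lambda>x. f' (- x))"
    by (rule cont_into_compose[OF f']) (auto intro!: continuous_intros)
  then have rf': "cont_into ?S X n ?f'"
    unfolding cont_into_iff by (intro ballI limitin_ntop_minus[OF nn]) (rule bspec)
  have right: "\<exists>d>0. \<forall>x\<in>?S. t < x \<and> x < t + d \<longrightarrow> n (?f x - ?f t - (x - t) *\<^sub>R ?f' t) \<le> e * (x - t)"
    if t: "t \<in> ?S" and "e > 0" for t e
  proof -
    obtain d where d: "d > 0" "\<And>x. x \<in> S \<Longrightarrow> - t - d < x \<Longrightarrow> x < - t \<Longrightarrow>
        n (f x - f (- t) - (x - - t) *\<^sub>R f' (- t)) \<le> e * (- t - x)"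
      using left[of "- t" e] t \<open>e > 0\<close> mem by blast
    have "n (?f x - ?f t - (x - t) *\<^sub>R ?f' t) \<le> e * (x - t)"
      if "x \<in> ?S" "t < x" "x < t + d" for x
    proof -
      have "n (f (- x) - f (- t) - (- x - - t) *\<^sub>R f' (- t)) \<le> e * (- t - - x)"
        using that mem by (intro d(2)) auto
      moreover have "(- x - - t) *\<^sub>R f' (- t) = (x - t) *\<^sub>R - f' (- t)"
        by (simp add: algebra_simps)
      ultimately show ?thesis by simp
    qed
    then show ?thesis using d(1) by blast
  qed
  fix t e :: real assume t: "t \<in> S" and "e > 0"
  then have "- t \<in> ?S" by simp
  from right_increment_estimate[OF nn rS rf rf' right this \<open>e > 0\<close>]
  obtain d where d: "d > 0" "\<And>x y. x \<in> ?S \<Longrightarrow> y \<in> ?S \<Longrightarrow> \<bar>x - - t\<bar> < d \<Longrightarrow> \<bar>y - - t\<bar> < d \<Longrightarrow> x \<le> y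
      \<Longrightarrow> n (?f y - ?f x - (y - x) *\<^sub>R ?f' (- t)) \<le> e * (y - x)"
    by blast
  have "n (f y - f x - (y - x) *\<^sub>R f' t) \<le> e * (y - x)"
    if x: "x \<in> S" "\<bar>x - t\<bar> < d" and y: "y \<in> S" "\<bar>y - t\<bar> < d" and "x \<le> y" for x y
  proof -
    have u: "f y - f x - (y - x) *\<^sub>R f' t \<in> X"
      using cont_intoD(1)[OF nn f] cont_intoD(1)[OF nn f'] x y t
      by (intro subspace_scale[OF X] subspace_diff[OF X]) auto
    have "n (f x - f y - (y - x) *\<^sub>R - f' t) \<le> e * (y - x)"
      using d(2)[of "- y" "- x"] that by (simp add: mem)
    moreover have "f x - f y - (y - x) *\<^sub>R - f' t = - (f y - f x - (y - x) *\<^sub>R f' t)"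
      by (simp add: algebra_simps)
    ultimately show ?thesis using normed_onD(7)[OF nn u] by (simp only:)
  qed
  then show "\<exists>d>0. \<forall>x\<in>S. \<forall>y\<in>S. \<bar>x - t\<bar> < d \<and> \<bar>y - t\<bar> < d \<and> x \<le> y \<longrightarrow>
      n (f y - f x - (y - x) *\<^sub>R f' t) \<le> e * (y - x)"
    using d(1) by blast
qed

lemma deriv_into_cong:
  assumes nn: "normed_on X n" and f: "deriv_into X n f D t S" and S: "S' \<subseteq> S" "t \<in> S'"
    and eq: "\<And>x. x \<in> S' \<Longrightarrow> f x = g x"
  shows "deriv_into X n g D t S'"
proof -
  let ?q = "\<lambda>f r. inverse (r - t) *\<^sub>R (f r - f t)"
  have D: "D \<in> X" "\<forall>\<^sub>F r in at t within S. ?q f r \<in> X" "((\<lambda>r. n (?q f r - D)) \<longlongrightarrow> 0) (at t within S)"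
    using f by (simp_all add: deriv_into_def limitin_ntop_iff[OF nn])
  have le: "at t within S' \<le> at t within S" using S(1) by (rule at_le)
  have "limitin (ntop X n) (?q f) D (at t within S')"
    unfolding limitin_ntop_iff[OF nn] using D filter_leD[OF le] tendsto_mono[OF le] by blast
  moreover have "\<forall>\<^sub>F r in at t within S'. ?q f r = ?q g r"
    using eq S(2) by (auto simp: eventually_at_filter)
  ultimately show ?thesis
    unfolding deriv_into_def by (rule limitin_eventually_cong)
qed

text \<open>
  The real function \<open>r \<mapsto> n (f r - f p)\<close> has derivative zero by the reverse triangle inequality, so the
  mean value theorem for real functions applies.
\<close>

lemma deriv_into_zero_constant:
  assumes nn: "normed_on X n" and f: "\<And>t. t \<in> {p..q} \<Longrightarrow> f t \<in> X"
    and deriv: "\<And>t. t \<in> {p..q} \<Longrightarrow> deriv_into X n f 0 t {p..q}" and "p \<le> q"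
  shows "f q = f p"
proof -
  note X = normed_onD(1)[OF nn]
  have pX: "f p \<in> X" using f \<open>p \<le> q\<close> by simp
  let ?\<phi> = "\<lambda>r. n (f r - f p)"
  have "(?\<phi> has_field_derivative 0) (at t within {p..q})" if t: "t \<in> {p..q}" for t
    unfolding has_field_derivative_iff
  proof (rule Lim_null_comparison)
    show "((\<lambda>r. n (inverse (r - t) *\<^sub>R (f r - f t) - 0)) \<longlongrightarrow> 0) (at t within {p..q})"
      using deriv[OF t] by (simp add: deriv_into_def limitin_ntop_iff[OF nn])
    have "norm ((?\<phi> r - ?\<phi> t) / (r - t)) \<le> n (inverse (r - t) *\<^sub>R (f r - f t) - 0)"
      if r: "r \<in> {p..q}" for r
    proof -
      have mem: "f r - f p \<in> X" "f t - f p \<in> X" "f r - f t \<in> X" "f t - f r \<in> X"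
        using f[OF r] f[OF t] pX by (auto intro: subspace_diff[OF X])
      have "?\<phi> r \<le> n (f t - f p) + n (f r - f t)" "?\<phi> t \<le> n (f r - f p) + n (f t - f r)"
        using normed_onD(6)[OF nn mem(2,3)] normed_onD(6)[OF nn mem(1,4)] by simp_all
      then have "\<bar>?\<phi> r - ?\<phi> t\<bar> \<le> n (f r - f t)"
        using normed_onD(9)[OF nn f[OF r] f[OF t]] by simp
      then have "\<bar>inverse (r - t)\<bar> * \<bar>?\<phi> r - ?\<phi> t\<bar> \<le> \<bar>inverse (r - t)\<bar> * n (f r - f t)"
        by (rule mult_left_mono) simp
      also have "\<dots> = n (inverse (r - t) *\<^sub>R (f r - f t) - 0)"
        using normed_onD(5)[OF nn mem(3)] by simp
      finally show ?thesis by (simp add: abs_mult divide_inverse mult.commute)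
    qed
    then show "\<forall>\<^sub>F r in at t within {p..q}. norm ((?\<phi> r - ?\<phi> t) / (r - t))
        \<le> n (inverse (r - t) *\<^sub>R (f r - f t) - 0)"
      by (simp add: eventually_at_filter)
  qed
  then obtain c where c: "\<And>r. r \<in> {p..q} \<Longrightarrow> ?\<phi> r = c"
    using has_field_derivative_zero_constant[of "{p..q}" ?\<phi>] by auto
  have "n (f q - f p) = 0" using c[of q] c[of p] \<open>p \<le> q\<close> normed_onD(3)[OF nn] by simp
  moreover have "f q - f p \<in> X" using f[of q] pX \<open>p \<le> q\<close> by (intro subspace_diff[OF X]) auto
  ultimately show ?thesis using normed_onD(4)[OF nn] by fastforce
qed

section \<open>Time increments of the unperturbed family\<close>

text \<open>
  Makes the bound on \<open>W\<close> uniform over all time spans up to \<open>u0\<close>.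
\<close>

lemma lifespan_factor_mono:
  assumes "0 \<le> u" "u \<le> u0" "ereal u0 < \<tau>"
  shows "lifespan_factor \<tau> u \<le> lifespan_factor \<tau> u0"
proof (cases \<tau>)
  case (real c)
  then show ?thesis
    using assms by (auto simp: lifespan_factor_def intro!: divide_left_mono)
qed (use assms in \<open>auto simp: lifespan_factor_def\<close>)

locale perturbed_scale =
  fixes a K :: real and M :: "real \<Rightarrow> real"
    and E :: "real \<Rightarrow> 'a::real_vector set" and N :: "real \<Rightarrow> 'a \<Rightarrow> real"
    and A B :: "real \<Rightarrow> 'a collection" and V W :: "real \<Rightarrow> real \<Rightarrow> 'a collection"
  assumes scale: "banach_scale a E N"
    and A: "\<forall>t\<ge>0. scale_op a E N (A t)" and A1: "cond_A1 a E N A"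
    and A2: "cond_A2 a E N V" and A3: "cond_A3 a E N A V" and A4: "cond_A4 a E N K V"
    and B: "\<forall>t\<ge>0. scale_op a E N (B t)" and B1: "cond_B1 a E N B" and B2: "cond_B2 a E N M B"
    and W: "perturbed_backward_family a E N K M V B W"
begin

abbreviation bdd_op :: "real \<Rightarrow> real \<Rightarrow> real \<Rightarrow> ('a \<Rightarrow> 'a) \<Rightarrow> bool" where
  "bdd_op \<alpha> \<alpha>' C f \<equiv> op_bound (E \<alpha>) (N \<alpha>) (E \<alpha>') (N \<alpha>') C f"

abbreviation cont_in :: "('b::topological_space) set \<Rightarrow> real \<Rightarrow> ('b \<Rightarrow> 'a) \<Rightarrow> bool" where
  "cont_in S \<alpha> f \<equiv> cont_into S (E \<alpha>) (N \<alpha>) f"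

abbreviation T :: "real \<Rightarrow> real \<Rightarrow> ereal" where
  "T \<equiv> lifespan K M"

lemma normed: "a < \<alpha> \<Longrightarrow> normed_on (E \<alpha>) (N \<alpha>)"
  using scale by (simp add: banach_scale_def banach_on_def)

lemmas sub = normed_onD(1)[OF normed]

lemma incl:
  assumes "a < \<alpha>'" "\<alpha>' < \<alpha>" "x \<in> E \<alpha>"
  shows "x \<in> E \<alpha>'" "N \<alpha>' x \<le> N \<alpha> x"
  using assms scale unfolding banach_scale_def by blast+

lemma bdd_opD:
  assumes "bdd_op \<alpha> \<alpha>' C f" "a < \<alpha>"
  shows "x \<in> E \<alpha> \<Longrightarrow> f x \<in> E \<alpha>'" "x \<in> E \<alpha> \<Longrightarrow> y \<in> E \<alpha> \<Longrightarrow> f (x + y) = f x + f y"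
    "x \<in> E \<alpha> \<Longrightarrow> f (c *\<^sub>R x) = c *\<^sub>R f x" "x \<in> E \<alpha> \<Longrightarrow> y \<in> E \<alpha> \<Longrightarrow> f (x - y) = f x - f y"
    "x \<in> E \<alpha> \<Longrightarrow> N \<alpha>' (f x) \<le> C * N \<alpha> x" "0 \<le> C"
    "x \<in> E \<alpha> \<Longrightarrow> N \<alpha> x \<le> d \<Longrightarrow> N \<alpha>' (f x) \<le> C * d"
proof -
  have f: "bounded_op (E \<alpha>) (N \<alpha>) (E \<alpha>') (N \<alpha>') f" "0 \<le> C"
    and le: "\<And>x. x \<in> E \<alpha> \<Longrightarrow> N \<alpha>' (f x) \<le> C * N \<alpha> x"
    using assms(1) by (simp_all add: op_bound_def)
  show "x \<in> E \<alpha> \<Longrightarrow> f x \<in> E \<alpha>'" "x \<in> E \<alpha> \<Longrightarrow> y \<in> E \<alpha> \<Longrightarrow> f (x + y) = f x + f y"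
    "x \<in> E \<alpha> \<Longrightarrow> f (c *\<^sub>R x) = c *\<^sub>R f x" "x \<in> E \<alpha> \<Longrightarrow> y \<in> E \<alpha> \<Longrightarrow> f (x - y) = f x - f y"
    by (rule bounded_opD[OF f(1) sub[OF assms(2)]]; assumption)+
  show "x \<in> E \<alpha> \<Longrightarrow> N \<alpha>' (f x) \<le> C * N \<alpha> x" by (rule le)
  show "0 \<le> C" by (rule f(2))
  show "x \<in> E \<alpha> \<Longrightarrow> N \<alpha> x \<le> d \<Longrightarrow> N \<alpha>' (f x) \<le> C * d"
    using le mult_left_mono[OF _ f(2)] order_trans by blast
qed

lemma K: "1 \<le> K" "0 < K"
  using A4 by (auto simp: cond_A4_def)

lemma V_scale: "0 \<le> s \<Longrightarrow> s \<le> t \<Longrightarrow> scale_op a E N (V s t)"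
  using A2 by (simp add: cond_A2_def)

lemma scale_op_bounded:
  "scale_op a E N L \<Longrightarrow> a < \<alpha>' \<Longrightarrow> \<alpha>' < \<alpha> \<Longrightarrow> bounded_op (E \<alpha>) (N \<alpha>) (E \<alpha>') (N \<alpha>') (L \<alpha> \<alpha>')"
  by (simp add: scale_op_def)

lemma V_bdd_op:
  assumes "a < \<alpha>'" "\<alpha>' < \<alpha>" "0 \<le> s" "s \<le> t"
  shows "bdd_op \<alpha> \<alpha>' K (V s t \<alpha> \<alpha>')"
proof (rule op_norm_bound[OF normed normed scale_op_bounded[OF V_scale]])
  show "op_norm (E \<alpha>) (N \<alpha>) (N \<alpha>') (V s t \<alpha> \<alpha>') \<le> K"
    using A4 assms by (simp add: cond_A4_def)
qed (use assms in simp_all)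

lemma V_refl: "a < \<alpha>' \<Longrightarrow> \<alpha>' < \<alpha> \<Longrightarrow> 0 \<le> t \<Longrightarrow> k \<in> E \<alpha> \<Longrightarrow> V t t \<alpha> \<alpha>' k = k"
  using A2 by (simp add: cond_A2_def)

lemma B_bdd_op:
  assumes "a < \<alpha>'" "\<alpha>' < \<alpha>" "0 \<le> t"
  shows "bdd_op \<alpha> \<alpha>' (M \<alpha> / (\<alpha> - \<alpha>')) (B t \<alpha> \<alpha>')"
proof (rule op_norm_bound[OF normed normed scale_op_bounded])
  show "op_norm (E \<alpha>) (N \<alpha>) (N \<alpha>') (B t \<alpha> \<alpha>') \<le> M \<alpha> / (\<alpha> - \<alpha>')"
    using B2 assms by (simp add: cond_B2_def)
qed (use assms B in simp_all)

text \<open>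
  Convergence of \<open>op_norm\<close> controls the vectors because the difference of two members of \<open>A\<close> is again
  a bounded operator.
\<close>

lemma A_norm_cont:
  assumes "a < \<alpha>'" "\<alpha>' < \<alpha>" "0 \<le> t" "e > 0"
  shows "\<exists>d>0. \<forall>p\<ge>0. \<bar>p - t\<bar> < d \<longrightarrow> (\<forall>x\<in>E \<alpha>. N \<alpha>' (A p \<alpha> \<alpha>' x - A t \<alpha> \<alpha>' x) \<le> e * N \<alpha> x)"
proof -
  have a\<alpha>: "a < \<alpha>" using assms by simp
  let ?D = "\<lambda>p x. A p \<alpha> \<alpha>' x - A t \<alpha> \<alpha>' x"
  have bd: "bounded_op (E \<alpha>) (N \<alpha>) (E \<alpha>') (N \<alpha>') (A p \<alpha> \<alpha>')" if "0 \<le> p" for p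
    using A that assms by (intro scale_op_bounded) simp_all
  have "((\<lambda>p. op_norm (E \<alpha>) (N \<alpha>) (N \<alpha>') (?D p)) \<longlongrightarrow> 0) (at t within {0..})"
    using A1 assms(1-3) by (simp add: cond_A1_def)
  from order_tendstoD(2)[OF this \<open>e > 0\<close>] obtain d where d: "d > 0"
    "\<And>p. 0 \<le> p \<Longrightarrow> p \<noteq> t \<Longrightarrow> dist p t < d \<Longrightarrow> op_norm (E \<alpha>) (N \<alpha>) (N \<alpha>') (?D p) < e"
    unfolding eventually_at by auto
  have "N \<alpha>' (?D p x) \<le> e * N \<alpha> x" if p: "0 \<le> p" "\<bar>p - t\<bar> < d" and x: "x \<in> E \<alpha>" for p x
  proof (cases "p = t")
    case True
    then show ?thesis
      using normed_onD(2)[OF normed[OF a\<alpha>] x] normed_onD(3)[OF normed[OF assms(1)]] \<open>e > 0\<close>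
      by simp
  next
    case False
    note S = sub[OF assms(1)]
    note bp = bounded_opD[OF bd[OF p(1)] sub[OF a\<alpha>]] and bt = bounded_opD[OF bd[OF assms(3)] sub[OF a\<alpha>]]
    have "\<exists>C. \<forall>x\<in>E \<alpha>. N \<alpha>' (A p \<alpha> \<alpha>' x) \<le> C * N \<alpha> x" if "0 \<le> p" for p
      using bd[OF that] by (simp add: bounded_op_def)
    then obtain C1 C2 where C: "\<forall>x\<in>E \<alpha>. N \<alpha>' (A p \<alpha> \<alpha>' x) \<le> C1 * N \<alpha> x"
      "\<forall>x\<in>E \<alpha>. N \<alpha>' (A t \<alpha> \<alpha>' x) \<le> C2 * N \<alpha> x"
      using p(1) assms(3) by meson
    have "N \<alpha>' (?D p x) \<le> (C1 + C2) * N \<alpha> x" if x: "x \<in> E \<alpha>" for x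
      using normed_onD(8)[OF normed[OF assms(1)] bp(1)[OF x] bt(1)[OF x]]
        bspec[OF C(1) x] bspec[OF C(2) x]
      by (simp add: distrib_right)
    then have "bounded_op (E \<alpha>) (N \<alpha>) (E \<alpha>') (N \<alpha>') (?D p)"
      unfolding bounded_op_def
      using bp(1-3) bt(1-3) subspace_diff[OF S] by (auto simp: scaleR_diff_right)
    from op_norm_bound[OF normed[OF a\<alpha>] normed[OF assms(1)] this] d(2)[OF p(1) False] p(2)
    have "bdd_op \<alpha> \<alpha>' e (?D p)" by (simp add: dist_real_def)
    from bdd_opD(5)[OF this a\<alpha> x] show ?thesis .
  qed
  then show ?thesis using d(1) by blast
qed

lemma A_bounded:
  assumes "a < \<alpha>'" "\<alpha>' < \<alpha>" "0 \<le> t"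
  shows "\<exists>C d. d > 0 \<and> (\<forall>p\<ge>0. \<bar>p - t\<bar> < d \<longrightarrow> bdd_op \<alpha> \<alpha>' C (A p \<alpha> \<alpha>'))"
proof -
  have a\<alpha>: "a < \<alpha>" using assms by simp
  have bd: "bounded_op (E \<alpha>) (N \<alpha>) (E \<alpha>') (N \<alpha>') (A p \<alpha> \<alpha>')" if "0 \<le> p" for p
    using A that assms by (intro scale_op_bounded) simp_all
  have bt: "bdd_op \<alpha> \<alpha>' (op_norm (E \<alpha>) (N \<alpha>) (N \<alpha>') (A t \<alpha> \<alpha>')) (A t \<alpha> \<alpha>')"
    by (rule op_norm_bound[OF normed[OF a\<alpha>] normed[OF assms(1)] bd[OF assms(3)] order_refl])
  define C where "C = op_norm (E \<alpha>) (N \<alpha>) (N \<alpha>') (A t \<alpha> \<alpha>')"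
  obtain d where d: "d > 0" "\<And>p x. p \<ge> 0 \<Longrightarrow> \<bar>p - t\<bar> < d \<Longrightarrow> x \<in> E \<alpha> \<Longrightarrow>
      N \<alpha>' (A p \<alpha> \<alpha>' x - A t \<alpha> \<alpha>' x) \<le> 1 * N \<alpha> x"
    using A_norm_cont[OF assms zero_less_one] by blast
  have "bdd_op \<alpha> \<alpha>' (C + 1) (A p \<alpha> \<alpha>')" if p: "p \<ge> 0" "\<bar>p - t\<bar> < d" for p
  proof -
    have "N \<alpha>' (A p \<alpha> \<alpha>' x) \<le> (C + 1) * N \<alpha> x" if x: "x \<in> E \<alpha>" for x
    proof -
      have mem: "A p \<alpha> \<alpha>' x \<in> E \<alpha>'" "A t \<alpha> \<alpha>' x \<in> E \<alpha>'"
        using bounded_opD(1)[OF bd sub[OF a\<alpha>] x] p assms by auto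
      have "N \<alpha>' (A t \<alpha> \<alpha>' x + (A p \<alpha> \<alpha>' x - A t \<alpha> \<alpha>' x))
          \<le> N \<alpha>' (A t \<alpha> \<alpha>' x) + N \<alpha>' (A p \<alpha> \<alpha>' x - A t \<alpha> \<alpha>' x)"
        by (rule normed_onD(6)[OF normed[OF assms(1)] mem(2) subspace_diff[OF sub[OF assms(1)] mem]])
      then show ?thesis
        using d(2)[OF p x] bdd_opD(5)[OF bt a\<alpha> x] by (simp add: C_def distrib_right)
    qed
    then show ?thesis
      using bd[OF p(1)] bdd_opD(6)[OF bt a\<alpha>] by (simp add: op_bound_def C_def)
  qed
  then show ?thesis using d(1) by blast
qed

lemma A_mem: "a < \<alpha>' \<Longrightarrow> \<alpha>' < \<alpha> \<Longrightarrow> 0 \<le> t \<Longrightarrow> x \<in> E \<alpha> \<Longrightarrow> A t \<alpha> \<alpha>' x \<in> E \<alpha>'"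
  using A scale_op_mem by blast

lemma A_cont:
  assumes "a < \<alpha>'" "\<alpha>' < \<alpha>" "S \<subseteq> {0..}" and y: "cont_in S \<alpha> y"
  shows "cont_in S \<alpha>' (\<lambda>r. A r \<alpha> \<alpha>' (y r))"
proof -
  have a\<alpha>: "a < \<alpha>" using assms by simp
  show ?thesis
  proof (rule cont_into_op_apply[OF normed[OF a\<alpha>] normed[OF assms(1)] y])
    fix t assume "t \<in> S"
    then have "0 \<le> t" using assms(3) by auto
    from A_bounded[OF assms(1,2) this] obtain C d where
      "d > 0" "\<forall>p\<ge>0. \<bar>p - t\<bar> < d \<longrightarrow> bdd_op \<alpha> \<alpha>' C (A p \<alpha> \<alpha>')" by blast
    then have "\<forall>\<^sub>F r in at t within S. bdd_op \<alpha> \<alpha>' C (A r \<alpha> \<alpha>')"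
      unfolding eventually_at dist_real_def using assms(3) by auto
    then show "\<exists>C. \<forall>\<^sub>F r in at t within S. bdd_op \<alpha> \<alpha>' C (A r \<alpha> \<alpha>')" ..
  next
    fix x assume x: "x \<in> E \<alpha>"
    show "cont_in S \<alpha>' (\<lambda>r. A r \<alpha> \<alpha>' x)"
      unfolding cont_into_iff limitin_ntop_iff[OF normed[OF assms(1)]]
    proof (intro ballI conjI)
      fix t assume "t \<in> S"
      then have t: "0 \<le> t" using assms(3) by auto
      show "A t \<alpha> \<alpha>' x \<in> E \<alpha>'" by (rule A_mem[OF assms(1,2) t x])
      have "\<forall>\<^sub>F r in at t within S. r \<in> S" by (simp add: eventually_at_filter)
      then show "\<forall>\<^sub>F r in at t within S. A r \<alpha> \<alpha>' x \<in> E \<alpha>'"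
        by eventually_elim (use assms(3) A_mem[OF assms(1,2) _ x] in auto)
      have nonneg: "0 \<le> N \<alpha>' (A r \<alpha> \<alpha>' x - A t \<alpha> \<alpha>' x)" if "r \<in> S" for r
        using that assms(3) A_mem[OF assms(1,2) _ x] t
        by (intro normed_onD(2)[OF normed[OF assms(1)]] subspace_diff[OF sub[OF assms(1)]]) auto
      show "((\<lambda>r. N \<alpha>' (A r \<alpha> \<alpha>' x - A t \<alpha> \<alpha>' x)) \<longlongrightarrow> 0) (at t within S)"
        unfolding tendsto_iff eventually_at
      proof (intro allI impI)
        fix e :: real assume "e > 0"
        define e' where "e' = e / (N \<alpha> x + 1)"
        have Nx: "0 \<le> N \<alpha> x" by (rule normed_onD(2)[OF normed[OF a\<alpha>] x])
        then have e': "e' > 0" "e' * N \<alpha> x < e"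
          using \<open>e > 0\<close> by (simp_all add: e'_def field_simps add_pos_nonneg)
        obtain d where d: "d > 0" "\<And>p. p \<ge> 0 \<Longrightarrow> \<bar>p - t\<bar> < d \<Longrightarrow>
            N \<alpha>' (A p \<alpha> \<alpha>' x - A t \<alpha> \<alpha>' x) \<le> e' * N \<alpha> x"
          using A_norm_cont[OF assms(1,2) t e'(1)] x by blast
        have "dist (N \<alpha>' (A r \<alpha> \<alpha>' x - A t \<alpha> \<alpha>' x)) 0 < e" if "r \<in> S" "dist r t < d" for r
          using d(2)[of r] e'(2) nonneg[OF that(1)] that assms(3) by (auto simp: dist_real_def)
        then show "\<exists>d>0. \<forall>r\<in>S. r \<noteq> t \<and> dist r t < d \<longrightarrow>
            dist (N \<alpha>' (A r \<alpha> \<alpha>' x - A t \<alpha> \<alpha>' x)) 0 < e"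
          using d(1) by blast
      qed
    qed
  qed
qed

lemma B_cont:
  assumes "a < \<alpha>'" "\<alpha>' < \<alpha>" "S \<subseteq> {0..}" and y: "cont_in S \<alpha> y"
  shows "cont_in S \<alpha>' (\<lambda>r. B r \<alpha> \<alpha>' (y r))"
proof (rule cont_into_op_apply[OF normed normed y])
  show "\<exists>C. \<forall>\<^sub>F r in at t within S. bdd_op \<alpha> \<alpha>' C (B r \<alpha> \<alpha>')" if "t \<in> S" for t
    using B_bdd_op[OF assms(1,2)] assms(3)
    by (intro exI[of _ "M \<alpha> / (\<alpha> - \<alpha>')"]) (auto simp: eventually_at intro!: exI[of _ 1])
  show "cont_in S \<alpha>' (\<lambda>r. B r \<alpha> \<alpha>' x)" if "x \<in> E \<alpha>" for x
    using B1 assms(1,2) that by (intro cont_into_subset[OF _ assms(3)]) (simp add: cond_B1_def)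
qed (use assms in simp_all)

text \<open>
  \<open>V r t2 x - V r t1 x\<close> is the integral of \<open>V r q (A q x)\<close> over \<open>{t1..t2}\<close>. The bound does not depend on
  the lower time \<open>r\<close>.
\<close>

lemma V_incr_upper:
  assumes \<gamma>: "a < \<gamma>" "\<gamma> < \<gamma>'" "\<gamma>' < \<alpha>" and r: "0 \<le> r" "r \<le> t1" "t1 \<le> t2" and x: "x \<in> E \<alpha>"
    and C: "\<And>p. p \<in> {t1..t2} \<Longrightarrow> N \<gamma>' (A p \<alpha> \<gamma>' x) \<le> C"
  shows "N \<gamma> (V r t2 \<alpha> \<gamma> x - V r t1 \<alpha> \<gamma> x) \<le> (t2 - t1) * (K * C)"
proof -
  have int: "integral_into (E \<gamma>) (N \<gamma>) (\<lambda>q. V r q \<gamma>' \<gamma> (A q \<alpha> \<gamma>' x)) r t (V r t \<alpha> \<gamma> x - x)"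
    if "r \<le> t" for t
    using A3 \<gamma> r x that by (simp add: cond_A3_def)
  have "N \<gamma> ((V r t2 \<alpha> \<gamma> x - x) - (V r t1 \<alpha> \<gamma> x - x) - (t2 - t1) *\<^sub>R 0) \<le> (t2 - t1) * (K * C)"
  proof (rule integral_into_additive_le[OF normed[OF \<gamma>(1)] r(2,3) _ _ int int])
    show "{r..t1} \<union> {t1..t2} = {r..t2}" using r by auto
    show "interior {r..t1} \<inter> interior {t1..t2} = {}" by (auto simp: interior_atLeastAtMost_real)
    show "0 \<in> E \<gamma>" by (rule subspace_0[OF sub[OF \<gamma>(1)]])
    fix q assume q: "q \<in> {t1..t2}"
    have "A q \<alpha> \<gamma>' x \<in> E \<gamma>'" using \<gamma> r q x by (intro A_mem) auto
    moreover have "bdd_op \<gamma>' \<gamma> K (V r q \<gamma>' \<gamma>)" using \<gamma> r q by (intro V_bdd_op) auto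
    ultimately show "N \<gamma> (V r q \<gamma>' \<gamma> (A q \<alpha> \<gamma>' x) - 0) \<le> K * C"
      using bdd_opD(7)[of \<gamma>' \<gamma> K "V r q \<gamma>' \<gamma>"] C[OF q] \<gamma> by simp
  qed (use r in simp_all)
  then show ?thesis by simp
qed

text \<open>
  \<open>V s1 t x - V s2 t x\<close> is the integral of \<open>A q (V q t x)\<close> over \<open>{s1..s2}\<close>. The bound does not depend on
  the upper time \<open>t\<close> and is linear in the norm of \<open>x\<close>.
\<close>

lemma V_incr_lower:
  assumes \<gamma>: "a < \<gamma>" "\<gamma> < \<gamma>'" "\<gamma>' < \<alpha>" and s: "0 \<le> s1" "s1 \<le> s2" "s2 \<le> t" and x: "x \<in> E \<alpha>"
    and C: "\<And>p. p \<in> {s1..s2} \<Longrightarrow> bdd_op \<gamma>' \<gamma> C (A p \<gamma>' \<gamma>)"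
  shows "N \<gamma> (V s1 t \<alpha> \<gamma> x - V s2 t \<alpha> \<gamma> x) \<le> (s2 - s1) * (C * (K * N \<alpha> x))"
proof -
  have int: "integral_into (E \<gamma>) (N \<gamma>) (\<lambda>q. A q \<gamma>' \<gamma> (V q t \<alpha> \<gamma>' x)) s t (V s t \<alpha> \<gamma> x - x)"
    if "0 \<le> s" "s \<le> t" for s
    using A3 \<gamma> x that by (simp add: cond_A3_def)
  have "N \<gamma> ((V s1 t \<alpha> \<gamma> x - x) - (V s2 t \<alpha> \<gamma> x - x) - (s2 - s1) *\<^sub>R 0) \<le> (s2 - s1) * (C * (K * N \<alpha> x))"
  proof (rule integral_into_additive_le[OF normed[OF \<gamma>(1)] s(3,2) _ _ int int])
    show "{s2..t} \<union> {s1..s2} = {s1..t}" using s by auto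
    show "interior {s2..t} \<inter> interior {s1..s2} = {}" by (auto simp: interior_atLeastAtMost_real)
    show "0 \<in> E \<gamma>" by (rule subspace_0[OF sub[OF \<gamma>(1)]])
    fix q assume q: "q \<in> {s1..s2}"
    have V: "bdd_op \<alpha> \<gamma>' K (V q t \<alpha> \<gamma>')" using \<gamma> s q by (intro V_bdd_op) auto
    have "V q t \<alpha> \<gamma>' x \<in> E \<gamma>'" "N \<gamma>' (V q t \<alpha> \<gamma>' x) \<le> K * N \<alpha> x"
      using bdd_opD(1,5)[OF V _ x] \<gamma> by simp_all
    then show "N \<gamma> (A q \<gamma>' \<gamma> (V q t \<alpha> \<gamma>' x) - 0) \<le> C * (K * N \<alpha> x)"
      using bdd_opD(7)[OF C[OF q]] \<gamma> by simp
  qed (use s in simp_all)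
  then show ?thesis by simp
qed

text \<open>
  The right derivative of \<open>V r t k\<close> in \<open>t\<close> is \<open>V r t (A t k)\<close>, uniformly in \<open>r\<close>. Compared with its value
  at \<open>t\<close>, the integrand \<open>V r q (A q k)\<close> changes through \<open>A q k\<close>, which is continuous in \<open>q\<close>, and through
  \<open>V r q\<close> at the fixed vector \<open>A t k\<close>, for which \<open>V_incr_upper\<close> is uniform in \<open>r\<close>.
\<close>

lemma V_right_derivative_uniform:
  assumes \<gamma>: "a < \<gamma>" "\<gamma> < \<alpha>''" "\<alpha>'' < \<alpha>" and k: "k \<in> E \<alpha>" and t: "0 \<le> t" and "e > 0"
  shows "\<exists>d>0. \<forall>t'. t < t' \<and> t' < t + d \<longrightarrow> (\<forall>r\<in>{0..t}.
    N \<gamma> (V r t' \<alpha> \<gamma> k - V r t \<alpha> \<gamma> k - (t' - t) *\<^sub>R V r t \<alpha>'' \<gamma> (A t \<alpha> \<alpha>'' k)) \<le> (t' - t) * e)"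
proof -
  have a: "a < \<alpha>''" "a < \<alpha>" using \<gamma> by simp_all
  define y where "y = A t \<alpha> \<alpha>'' k"
  have y: "y \<in> E \<alpha>''" unfolding y_def by (rule A_mem[OF a(1) \<gamma>(3) t k])
  define \<gamma>' where "\<gamma>' = (\<gamma> + \<alpha>'') / 2"
  have \<gamma>': "\<gamma> < \<gamma>'" "\<gamma>' < \<alpha>''" "a < \<gamma>'" using \<gamma> by (simp_all add: \<gamma>'_def)
  obtain C d1 where C: "d1 > 0" "\<And>p. p \<ge> 0 \<Longrightarrow> \<bar>p - t\<bar> < d1 \<Longrightarrow> bdd_op \<alpha>'' \<gamma>' C (A p \<alpha>'' \<gamma>')"
    using A_bounded[OF \<gamma>'(3,2) t] by blast
  have "0 \<le> C" using bdd_opD(6)[OF C(2)[OF t] a(1)] C(1) by simp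
  have Ny: "0 \<le> N \<alpha>'' y" by (rule normed_onD(2)[OF normed[OF a(1)] y])
  have "cont_in {0..} \<alpha>'' (\<lambda>r. A r \<alpha> \<alpha>'' k)"
    using limitin_ntop_self[OF normed[OF a(2)] k]
    by (intro A_cont[OF a(1) \<gamma>(3)]) (simp_all add: cont_into_iff)
  from cont_intoD(2)[OF normed[OF a(1)] this, of t "e / (2 * K)"] obtain d2 where d2: "d2 > 0"
    "\<And>q. 0 \<le> q \<Longrightarrow> \<bar>q - t\<bar> < d2 \<Longrightarrow> N \<alpha>'' (A q \<alpha> \<alpha>'' k - y) < e / (2 * K)"
    using t \<open>e > 0\<close> K by (auto simp: y_def)
  define D where "D = K * (C * N \<alpha>'' y)"
  have "0 \<le> D" unfolding D_def using K \<open>0 \<le> C\<close> Ny by simp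
  define d3 where "d3 = e / (2 * (D + 1))"
  have d3: "d3 > 0" "d3 * D \<le> e / 2"
    using \<open>e > 0\<close> \<open>0 \<le> D\<close> by (simp_all add: d3_def field_simps)
  define d where "d = min d1 (min d2 d3)"
  have "d > 0" using C(1) d2(1) d3(1) by (simp add: d_def)
  moreover have "N \<gamma> (V r t' \<alpha> \<gamma> k - V r t \<alpha> \<gamma> k - (t' - t) *\<^sub>R V r t \<alpha>'' \<gamma> y) \<le> (t' - t) * e"
    if t': "t < t'" "t' < t + d" and r: "0 \<le> r" "r \<le> t" for t' r
  proof -
    have int: "integral_into (E \<gamma>) (N \<gamma>) (\<lambda>q. V r q \<alpha>'' \<gamma> (A q \<alpha> \<alpha>'' k)) r u (V r u \<alpha> \<gamma> k - k)"
      if "r \<le> u" for u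
      using A3 \<gamma> r k that by (simp add: cond_A3_def)
    have Vy: "V r u \<alpha>'' \<gamma> y \<in> E \<gamma>" if "r \<le> u" for u
      using bdd_opD(1)[OF V_bdd_op[OF \<gamma>(1,2) r(1) that] a(1) y] .
    have "N \<gamma> ((V r t' \<alpha> \<gamma> k - k) - (V r t \<alpha> \<gamma> k - k) - (t' - t) *\<^sub>R V r t \<alpha>'' \<gamma> y) \<le> (t' - t) * e"
    proof (rule integral_into_additive_le[OF normed[OF \<gamma>(1)] r(2) less_imp_le[OF t'(1)] _ _ int int])
      show "{r..t} \<union> {t..t'} = {r..t'}" using r t' by auto
      show "interior {r..t} \<inter> interior {t..t'} = {}" by (auto simp: interior_atLeastAtMost_real)
      show "V r t \<alpha>'' \<gamma> y \<in> E \<gamma>" using Vy r by simp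
      fix q assume q: "q \<in> {t..t'}"
      then have q': "t \<le> q" "0 \<le> q" "r \<le> q" "q - t < d" using t t' r by auto
      have Vq: "bdd_op \<alpha>'' \<gamma> K (V r q \<alpha>'' \<gamma>)" by (rule V_bdd_op[OF \<gamma>(1,2) r(1) q'(3)])
      have Aq: "A q \<alpha> \<alpha>'' k \<in> E \<alpha>''" by (rule A_mem[OF a(1) \<gamma>(3) q'(2) k])
      have diff: "A q \<alpha> \<alpha>'' k - y \<in> E \<alpha>''" by (rule subspace_diff[OF sub[OF a(1)] Aq y])
      have "N \<gamma> (V r q \<alpha>'' \<gamma> (A q \<alpha> \<alpha>'' k - y)) \<le> K * (e / (2 * K))"
        using d2(2)[of q] q' t by (intro bdd_opD(7)[OF Vq a(1) diff]) (simp add: d_def)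
      also have "\<dots> = e / 2" using K by simp
      finally have 1: "N \<gamma> (V r q \<alpha>'' \<gamma> (A q \<alpha> \<alpha>'' k - y)) \<le> e / 2" .
      have "N \<gamma> (V r q \<alpha>'' \<gamma> y - V r t \<alpha>'' \<gamma> y) \<le> (q - t) * D"
        unfolding D_def
      proof (rule V_incr_upper[OF \<gamma>(1) \<gamma>'(1,2) r q'(1) y])
        fix p assume p: "p \<in> {t..q}"
        have "bdd_op \<alpha>'' \<gamma>' C (A p \<alpha>'' \<gamma>')"
          using p q' t by (intro C(2)) (auto simp: d_def)
        from bdd_opD(5)[OF this a(1) y] show "N \<gamma>' (A p \<alpha>'' \<gamma>' y) \<le> C * N \<alpha>'' y" .
      qed
      also have "\<dots> \<le> d3 * D" using q' \<open>0 \<le> D\<close> by (intro mult_right_mono) (simp_all add: d_def)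
      finally have 2: "N \<gamma> (V r q \<alpha>'' \<gamma> y - V r t \<alpha>'' \<gamma> y) \<le> e / 2" using d3(2) by simp
      have eq: "V r q \<alpha>'' \<gamma> (A q \<alpha> \<alpha>'' k) - V r t \<alpha>'' \<gamma> y
          = V r q \<alpha>'' \<gamma> (A q \<alpha> \<alpha>'' k - y) + (V r q \<alpha>'' \<gamma> y - V r t \<alpha>'' \<gamma> y)"
        using bdd_opD(4)[OF Vq a(1) Aq y] by simp
      have "N \<gamma> (V r q \<alpha>'' \<gamma> (A q \<alpha> \<alpha>'' k - y) + (V r q \<alpha>'' \<gamma> y - V r t \<alpha>'' \<gamma> y))
          \<le> N \<gamma> (V r q \<alpha>'' \<gamma> (A q \<alpha> \<alpha>'' k - y)) + N \<gamma> (V r q \<alpha>'' \<gamma> y - V r t \<alpha>'' \<gamma> y)"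
        using bdd_opD(1)[OF Vq a(1) diff] Vy q' r
        by (intro normed_onD(6)[OF normed[OF \<gamma>(1)]] subspace_diff[OF sub[OF \<gamma>(1)]]) simp_all
      then show "N \<gamma> (V r q \<alpha>'' \<gamma> (A q \<alpha> \<alpha>'' k) - V r t \<alpha>'' \<gamma> y) \<le> e"
        unfolding eq using 1 2 by linarith
    qed (use r t' in simp_all)
    then show ?thesis by simp
  qed
  ultimately show ?thesis unfolding y_def by auto
qed

text \<open>
  The left derivative of \<open>V s r y\<close> in \<open>s\<close> is \<open>- A s (V s r y)\<close>, uniformly in \<open>r\<close> and with an error
  proportional to the norm of \<open>y\<close>. The latter matters because in the integral equation \<open>y\<close> varies with
  the integration variable. It is here that \<open>A\<close> has to be continuous in operator norm: in \<open>A q (V q r y)\<close>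
  the argument of \<open>A q\<close> is not a fixed vector.
\<close>

lemma V_left_derivative_uniform:
  assumes \<gamma>: "a < \<alpha>'" "\<alpha>' < \<alpha>''" "\<alpha>'' < \<gamma>" and s: "0 \<le> s" and "e > 0"
  shows "\<exists>d>0. \<forall>s'. 0 \<le> s' \<and> s - d < s' \<and> s' < s \<longrightarrow> (\<forall>r\<ge>s. \<forall>y\<in>E \<gamma>.
    N \<alpha>' (V s' r \<gamma> \<alpha>' y - V s r \<gamma> \<alpha>' y - (s - s') *\<^sub>R A s \<alpha>'' \<alpha>' (V s r \<gamma> \<alpha>'' y))
      \<le> (s - s') * (e * N \<gamma> y))"
proof -
  have a: "a < \<alpha>''" "a < \<gamma>" using \<gamma> by simp_all
  define \<gamma>' where "\<gamma>' = (\<alpha>'' + \<gamma>) / 2"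
  have \<gamma>': "\<alpha>'' < \<gamma>'" "\<gamma>' < \<gamma>" "a < \<gamma>'" using \<gamma> by (simp_all add: \<gamma>'_def)
  obtain C d1 where C: "d1 > 0" "\<And>p. p \<ge> 0 \<Longrightarrow> \<bar>p - s\<bar> < d1 \<Longrightarrow> bdd_op \<gamma>' \<alpha>'' C (A p \<gamma>' \<alpha>'')"
    using A_bounded[OF a(1) \<gamma>'(1) s] by blast
  obtain C2 d0 where C2': "d0 > 0" "\<And>p. p \<ge> 0 \<Longrightarrow> \<bar>p - s\<bar> < d0 \<Longrightarrow> bdd_op \<alpha>'' \<alpha>' C2 (A p \<alpha>'' \<alpha>')"
    using A_bounded[OF \<gamma>(1,2) s] by blast
  have C2: "bdd_op \<alpha>'' \<alpha>' C2 (A s \<alpha>'' \<alpha>')" using C2'(2)[OF s] C2'(1) by simp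
  have "0 \<le> C" using bdd_opD(6)[OF C(2)[OF s] \<gamma>'(3)] C(1) by simp
  obtain d2 where d2: "d2 > 0" "\<And>p x. p \<ge> 0 \<Longrightarrow> \<bar>p - s\<bar> < d2 \<Longrightarrow> x \<in> E \<alpha>'' \<Longrightarrow>
      N \<alpha>' (A p \<alpha>'' \<alpha>' x - A s \<alpha>'' \<alpha>' x) \<le> e / (2 * K) * N \<alpha>'' x"
    using A_norm_cont[OF \<gamma>(1,2) s, of "e / (2 * K)"] \<open>e > 0\<close> K by auto
  define D where "D = C2 * (C * K)"
  have "0 \<le> D" unfolding D_def using K \<open>0 \<le> C\<close> bdd_opD(6)[OF C2 a(1)] by simp
  define d3 where "d3 = e / (2 * (D + 1))"
  have d3: "d3 > 0" "d3 * D \<le> e / 2"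
    using \<open>e > 0\<close> \<open>0 \<le> D\<close> by (simp_all add: d3_def field_simps)
  define d where "d = min d1 (min d2 d3)"
  have "d > 0" using C(1) d2(1) d3(1) by (simp add: d_def)
  moreover have "N \<alpha>' (V s' r \<gamma> \<alpha>' y - V s r \<gamma> \<alpha>' y - (s - s') *\<^sub>R A s \<alpha>'' \<alpha>' (V s r \<gamma> \<alpha>'' y))
      \<le> (s - s') * (e * N \<gamma> y)"
    if s': "0 \<le> s'" "s - d < s'" "s' < s" and r: "s \<le> r" and y: "y \<in> E \<gamma>" for s' r y
  proof -
    have Ny: "0 \<le> N \<gamma> y" by (rule normed_onD(2)[OF normed[OF a(2)] y])
    have int: "integral_into (E \<alpha>') (N \<alpha>') (\<lambda>q. A q \<alpha>'' \<alpha>' (V q r \<gamma> \<alpha>'' y)) u r (V u r \<gamma> \<alpha>' y - y)"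
      if "0 \<le> u" "u \<le> r" for u
      using A3 \<gamma> y that by (simp add: cond_A3_def)
    have Vy: "V u r \<gamma> \<alpha>'' y \<in> E \<alpha>''" "N \<alpha>'' (V u r \<gamma> \<alpha>'' y) \<le> K * N \<gamma> y" if "0 \<le> u" "u \<le> r" for u
      using bdd_opD(1,5)[OF V_bdd_op[OF a(1) \<gamma>(3) that] a(2) y] .
    have "N \<alpha>' ((V s' r \<gamma> \<alpha>' y - y) - (V s r \<gamma> \<alpha>' y - y) - (s - s') *\<^sub>R A s \<alpha>'' \<alpha>' (V s r \<gamma> \<alpha>'' y))
      \<le> (s - s') * (e * N \<gamma> y)"
    proof (rule integral_into_additive_le[OF normed[OF \<gamma>(1)] r less_imp_le[OF s'(3)] _ _ int int])
      show "{s..r} \<union> {s'..s} = {s'..r}" using r s' by auto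
      show "interior {s..r} \<inter> interior {s'..s} = {}" by (auto simp: interior_atLeastAtMost_real)
      show "A s \<alpha>'' \<alpha>' (V s r \<gamma> \<alpha>'' y) \<in> E \<alpha>'" by (rule A_mem[OF \<gamma>(1,2) s Vy(1)[OF s r]])
      fix q assume q: "q \<in> {s'..s}"
      then have q': "q \<le> s" "0 \<le> q" "q \<le> r" "s - q < d" using s s' r by auto
      note Vq = Vy[OF q'(2,3)] and Vs = Vy[OF s r]
      let ?u = "V q r \<gamma> \<alpha>'' y" and ?v = "V s r \<gamma> \<alpha>'' y"
      have uv: "?u - ?v \<in> E \<alpha>''" by (rule subspace_diff[OF sub[OF a(1)] Vq(1) Vs(1)])
      have "N \<alpha>' (A q \<alpha>'' \<alpha>' ?u - A s \<alpha>'' \<alpha>' ?u) \<le> e / (2 * K) * N \<alpha>'' ?u"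
        using q' by (intro d2(2) Vq(1)) (simp_all add: d_def)
      also have "\<dots> \<le> e / (2 * K) * (K * N \<gamma> y)"
        using Vq(2) \<open>e > 0\<close> K by (intro mult_left_mono) simp_all
      also have "\<dots> = e / 2 * N \<gamma> y" using K by simp
      finally have 1: "N \<alpha>' (A q \<alpha>'' \<alpha>' ?u - A s \<alpha>'' \<alpha>' ?u) \<le> e / 2 * N \<gamma> y" .
      have "N \<alpha>'' (?u - ?v) \<le> (s - q) * (C * (K * N \<gamma> y))"
      proof (rule V_incr_lower[OF a(1) \<gamma>'(1,2) q'(2,1) r y])
        fix p assume "p \<in> {q..s}"
        then show "bdd_op \<gamma>' \<alpha>'' C (A p \<gamma>' \<alpha>'')"
          using q' by (intro C(2)) (auto simp: d_def)
      qed
      from bdd_opD(7)[OF C2 a(1) uv this]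
      have "N \<alpha>' (A s \<alpha>'' \<alpha>' (?u - ?v)) \<le> (s - q) * (D * N \<gamma> y)"
        by (simp add: D_def mult_ac)
      also have "\<dots> \<le> d3 * (D * N \<gamma> y)"
        using q' \<open>0 \<le> D\<close> Ny by (intro mult_right_mono) (simp_all add: d_def)
      also have "\<dots> \<le> e / 2 * N \<gamma> y"
        using mult_right_mono[OF d3(2) Ny] by (simp add: mult_ac)
      finally have 2: "N \<alpha>' (A s \<alpha>'' \<alpha>' ?u - A s \<alpha>'' \<alpha>' ?v) \<le> e / 2 * N \<gamma> y"
        using bdd_opD(4)[OF C2 a(1) Vq(1) Vs(1)] by simp
      have mem: "A q \<alpha>'' \<alpha>' ?u \<in> E \<alpha>'" "A s \<alpha>'' \<alpha>' ?u \<in> E \<alpha>'" "A s \<alpha>'' \<alpha>' ?v \<in> E \<alpha>'"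
        using A_mem[OF \<gamma>(1,2)] q'(2) s Vq(1) Vs(1) by simp_all
      have "A q \<alpha>'' \<alpha>' ?u - A s \<alpha>'' \<alpha>' ?v
          = (A q \<alpha>'' \<alpha>' ?u - A s \<alpha>'' \<alpha>' ?u) + (A s \<alpha>'' \<alpha>' ?u - A s \<alpha>'' \<alpha>' ?v)" by simp
      moreover have "N \<alpha>' ((A q \<alpha>'' \<alpha>' ?u - A s \<alpha>'' \<alpha>' ?u) + (A s \<alpha>'' \<alpha>' ?u - A s \<alpha>'' \<alpha>' ?v))
          \<le> N \<alpha>' (A q \<alpha>'' \<alpha>' ?u - A s \<alpha>'' \<alpha>' ?u) + N \<alpha>' (A s \<alpha>'' \<alpha>' ?u - A s \<alpha>'' \<alpha>' ?v)"
        by (intro normed_onD(6)[OF normed[OF \<gamma>(1)]] subspace_diff[OF sub[OF \<gamma>(1)]] mem)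
      ultimately show "N \<alpha>' (A q \<alpha>'' \<alpha>' ?u - A s \<alpha>'' \<alpha>' ?v) \<le> e * N \<gamma> y"
        using 1 2 by simp
    qed (use s r s' in simp_all)
    then show ?thesis by simp
  qed
  ultimately show ?thesis by auto
qed

section \<open>Bounds, lifespans and continuity of the perturbed family\<close>

text \<open>
  The operator bound, the initial condition and the strong continuity contained in the definition of
  the perturbed family.
\<close>

lemma W_props:
  assumes "a < \<alpha>'" "\<alpha>' < \<alpha>"
  shows "0 \<le> s \<Longrightarrow> s \<le> t \<Longrightarrow> ereal (t - s) < T \<alpha>' \<alpha> \<Longrightarrow>
      bdd_op \<alpha> \<alpha>' (lifespan_factor (T \<alpha>' \<alpha>) (t - s) * K) (W s t \<alpha> \<alpha>')"
    and "0 \<le> t \<Longrightarrow> k \<in> E \<alpha> \<Longrightarrow> W t t \<alpha> \<alpha>' k = k"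
    and "k \<in> E \<alpha> \<Longrightarrow>
      cont_in {(s, t). 0 \<le> s \<and> s \<le> t \<and> ereal (t - s) < T \<alpha>' \<alpha>} \<alpha>' (\<lambda>(s, t). W s t \<alpha> \<alpha>' k)"
proof -
  note W' = W[unfolded perturbed_backward_family_def Let_def, THEN conjunct1, rule_format, OF conjI[OF assms]]
  have a\<alpha>: "a < \<alpha>" using assms by simp
  show "bdd_op \<alpha> \<alpha>' (lifespan_factor (T \<alpha>' \<alpha>) (t - s) * K) (W s t \<alpha> \<alpha>')"
    if "0 \<le> s" "s \<le> t" "ereal (t - s) < T \<alpha>' \<alpha>"
    using W' that by (intro op_norm_bound[OF normed[OF a\<alpha>] normed[OF assms(1)]]) simp_all
  show "0 \<le> t \<Longrightarrow> k \<in> E \<alpha> \<Longrightarrow> W t t \<alpha> \<alpha>' k = k"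
    and "k \<in> E \<alpha> \<Longrightarrow>
      cont_in {(s, t). 0 \<le> s \<and> s \<le> t \<and> ereal (t - s) < T \<alpha>' \<alpha>} \<alpha>' (\<lambda>(s, t). W s t \<alpha> \<alpha>' k)"
    using W' by simp_all
qed

text \<open>
  Consistency and the two integral equations. The lower one has the intermediate index on the
  codomain side of \<open>W\<close>, the upper one on its domain side; this decides which second lifespan limits
  the time span.
\<close>

lemma W_eqs:
  assumes "a < \<alpha>'" "\<alpha>' < \<alpha>''" "\<alpha>'' < \<alpha>" "0 \<le> s" "s \<le> t" "k \<in> E \<alpha>" "ereal (t - s) < T \<alpha>' \<alpha>"
  shows W_cod: "ereal (t - s) < T \<alpha>'' \<alpha> \<Longrightarrow> W s t \<alpha> \<alpha>' k = W s t \<alpha> \<alpha>'' k"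
    and W_int_lower: "ereal (t - s) < T \<alpha>'' \<alpha> \<Longrightarrow> integral_into (E \<alpha>') (N \<alpha>')
      (\<lambda>r. scale_comp (V s r) (B r) \<alpha>'' \<alpha>' (W r t \<alpha> \<alpha>'' k)) s t (W s t \<alpha> \<alpha>' k - V s t \<alpha> \<alpha>' k)"
    and W_dom: "ereal (t - s) < T \<alpha>' \<alpha>'' \<Longrightarrow> W s t \<alpha> \<alpha>' k = W s t \<alpha>'' \<alpha>' k"
    and W_int_upper: "ereal (t - s) < T \<alpha>' \<alpha>'' \<Longrightarrow> integral_into (E \<alpha>') (N \<alpha>')
      (\<lambda>r. W s r \<alpha>'' \<alpha>' (scale_comp (B r) (V r t) \<alpha> \<alpha>'' k)) s t (W s t \<alpha> \<alpha>' k - V s t \<alpha> \<alpha>' k)"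
proof -
  have min: "ereal (t - s) < \<tau> \<Longrightarrow> ereal (t - s) < min (T \<alpha>' \<alpha>) \<tau>" for \<tau>
    using assms(7) by simp
  note W' = W[unfolded perturbed_backward_family_def Let_def, THEN conjunct2, rule_format,
      of \<alpha>' \<alpha>'' \<alpha> s t k, OF conjI[OF assms(1) conjI[OF assms(2) conjI[OF assms(3) conjI[OF assms(4,5)]]]] assms(6)]
  note lower = W'[THEN conjunct1, rule_format, OF min]
  note upper = W'[THEN conjunct2, rule_format, OF min]
  show "ereal (t - s) < T \<alpha>'' \<alpha> \<Longrightarrow> W s t \<alpha> \<alpha>' k = W s t \<alpha> \<alpha>'' k"
    "ereal (t - s) < T \<alpha>'' \<alpha> \<Longrightarrow> integral_into (E \<alpha>') (N \<alpha>')
      (\<lambda>r. scale_comp (V s r) (B r) \<alpha>'' \<alpha>' (W r t \<alpha> \<alpha>'' k)) s t (W s t \<alpha> \<alpha>' k - V s t \<alpha> \<alpha>' k)"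
    "ereal (t - s) < T \<alpha>' \<alpha>'' \<Longrightarrow> W s t \<alpha> \<alpha>' k = W s t \<alpha>'' \<alpha>' k"
    "ereal (t - s) < T \<alpha>' \<alpha>'' \<Longrightarrow> integral_into (E \<alpha>') (N \<alpha>')
      (\<lambda>r. W s r \<alpha>'' \<alpha>' (scale_comp (B r) (V r t) \<alpha> \<alpha>'' k)) s t (W s t \<alpha> \<alpha>' k - V s t \<alpha> \<alpha>' k)"
    by (rule conjunct1[OF lower] conjunct2[OF lower] conjunct1[OF upper] conjunct2[OF upper];
        assumption)+
qed

lemma W_bdd_op:
  assumes "a < \<alpha>'" "\<alpha>' < \<alpha>" "0 \<le> s" "s \<le> t" "t - s \<le> u" "ereal u < T \<alpha>' \<alpha>"
  shows "bdd_op \<alpha> \<alpha>' (lifespan_factor (T \<alpha>' \<alpha>) u * K) (W s t \<alpha> \<alpha>')"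
proof -
  have a\<alpha>: "a < \<alpha>" using assms by simp
  have "ereal (t - s) < T \<alpha>' \<alpha>"
    using assms(5,6) by (metis ereal_less_eq(3) le_less_trans)
  then have 1: "bdd_op \<alpha> \<alpha>' (lifespan_factor (T \<alpha>' \<alpha>) (t - s) * K) (W s t \<alpha> \<alpha>')"
    using W_props(1)[OF assms(1-4)] by simp
  have le: "lifespan_factor (T \<alpha>' \<alpha>) (t - s) * K \<le> lifespan_factor (T \<alpha>' \<alpha>) u * K"
    using lifespan_factor_mono[of "t - s" u "T \<alpha>' \<alpha>"] assms K by (intro mult_right_mono) simp_all
  have "N \<alpha>' (W s t \<alpha> \<alpha>' x) \<le> lifespan_factor (T \<alpha>' \<alpha>) u * K * N \<alpha> x" if x: "x \<in> E \<alpha>" for x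
    using bdd_opD(5)[OF 1 a\<alpha> x] mult_right_mono[OF le normed_onD(2)[OF normed[OF a\<alpha>] x]] by linarith
  then show ?thesis
    using 1 le by (simp add: op_bound_def)
qed

lemma less_lifespan:
  assumes "ereal x < \<tau>" obtains u where "x < u" "ereal u < \<tau>"
  using ereal_dense2[OF assms] that by auto

lemma W_cont_upper:
  assumes "a < \<alpha>'" "\<alpha>' < \<alpha>" "0 \<le> s" and S: "S \<subseteq> {t. s \<le> t \<and> ereal (t - s) < T \<alpha>' \<alpha>}"
    and y: "cont_in S \<alpha> y"
  shows "cont_in S \<alpha>' (\<lambda>r. W s r \<alpha> \<alpha>' (y r))"
proof (rule cont_into_op_apply[OF normed normed y])
  fix t assume t: "t \<in> S"
  then obtain u where u: "t - s < u" "ereal u < T \<alpha>' \<alpha>"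
    using S less_lifespan by (metis (lifting) mem_Collect_eq subset_iff)
  have "\<forall>\<^sub>F r in at t within S. r \<in> S" by (simp add: eventually_at_filter)
  moreover have "\<forall>\<^sub>F r in at t within S. r < u + s"
    using u(1) by (intro order_tendstoD(2)[of "\<lambda>r. r" t]) (simp_all add: tendsto_ident_at)
  ultimately have "\<forall>\<^sub>F r in at t within S.
      bdd_op \<alpha> \<alpha>' (lifespan_factor (T \<alpha>' \<alpha>) u * K) (W s r \<alpha> \<alpha>')"
  proof eventually_elim
    case (elim r)
    then show ?case using S u(2) assms(1-3) by (intro W_bdd_op) auto
  qed
  then show "\<exists>C. \<forall>\<^sub>F r in at t within S. bdd_op \<alpha> \<alpha>' C (W s r \<alpha> \<alpha>')" ..
next
  fix x assume x: "x \<in> E \<alpha>"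
  have "continuous_on S (\<lambda>r. (s, r))" by (intro continuous_intros)
  from cont_into_compose[OF W_props(3)[OF assms(1,2) x] this]
  show "cont_in S \<alpha>' (\<lambda>r. W s r \<alpha> \<alpha>' x)"
    using S assms(3) by fastforce
qed (use assms in simp_all)

lemma W_cont_lower:
  assumes "a < \<alpha>'" "\<alpha>' < \<alpha>" "k \<in> E \<alpha>"
    and S: "S \<subseteq> {s. 0 \<le> s \<and> s \<le> t \<and> ereal (t - s) < T \<alpha>' \<alpha>}"
  shows "cont_in S \<alpha>' (\<lambda>s. W s t \<alpha> \<alpha>' k)"
proof -
  have "continuous_on S (\<lambda>s. (s, t))" by (intro continuous_intros)
  from cont_into_compose[OF W_props(3)[OF assms(1-3)] this]
  show ?thesis using S by fastforce
qed

text \<open>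
  A strict lifespan bound leaves room for a slightly larger codomain index, because
  \<open>T \<beta> \<alpha>\<close> is continuous in \<open>\<beta>\<close>.
\<close>

lemma lifespan_codomain_gap:
  assumes "a < \<alpha>''" "\<alpha>'' < \<alpha>" "ereal u < T \<alpha>'' \<alpha>"
  shows "\<exists>\<beta>. \<alpha>'' < \<beta> \<and> \<beta> < \<alpha> \<and> ereal u < T \<beta> \<alpha>"
proof (cases "M \<alpha> = 0")
  case True
  then show ?thesis
    using assms by (intro exI[of _ "(\<alpha>'' + \<alpha>) / 2"]) (simp add: lifespan_def)
next
  case False
  define c where "c = 2 * K * exp 1 * M \<alpha>"
  have "0 \<le> M \<alpha>" using B2 assms by (simp add: cond_B2_def)
  then have "c > 0" using False K by (simp add: c_def)
  then have "u * c < \<alpha> - \<alpha>''"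
    using assms(3) False by (simp add: lifespan_def c_def[symmetric] pos_less_divide_eq)
  then obtain \<beta> where \<beta>: "\<alpha>'' < \<beta>" "\<beta> < \<alpha>" "\<beta> < \<alpha> - u * c"
    using dense[of \<alpha>'' "min \<alpha> (\<alpha> - u * c)"] assms(2) by auto
  then have "u < (\<alpha> - \<beta>) / c"
    using \<open>c > 0\<close> by (simp add: pos_less_divide_eq)
  then show ?thesis using \<beta> False by (auto simp: lifespan_def c_def)
qed

text \<open>
  The domain index can be lowered slightly: \<open>M \<beta> \<le> M \<alpha>''\<close> for \<open>\<beta> < \<alpha>''\<close>, so \<open>T \<alpha>' \<beta>\<close> is at least the
  expression with \<open>M \<alpha>''\<close> in the denominator, which is continuous in \<open>\<beta>\<close>.
\<close>

lemma lifespan_domain_gap: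
  assumes "a < \<alpha>'" "\<alpha>' < \<alpha>''" "ereal u < T \<alpha>' \<alpha>''" "0 \<le> u"
  shows "\<exists>\<beta>. \<alpha>' < \<beta> \<and> \<beta> < \<alpha>'' \<and> ereal u < T \<alpha>' \<beta>"
proof -
  have M: "0 \<le> M \<beta>" "M \<beta> \<le> M \<alpha>''" if "a < \<beta>" "\<beta> < \<alpha>''" for \<beta>
    using B2 that by (auto simp: cond_B2_def mono_on_def)
  define c where "c \<beta> = 2 * K * exp 1 * M \<beta>" for \<beta>
  have c: "0 \<le> c \<beta>" "c \<beta> \<le> c \<alpha>''" if "a < \<beta>" "\<beta> < \<alpha>''" for \<beta>
    using M[OF that] K by (simp_all add: c_def)
  have "u * c \<alpha>'' < \<alpha>'' - \<alpha>'"
  proof (cases "M \<alpha>'' = 0")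
    case False
    then have "c \<alpha>'' > 0" using c(1)[of \<alpha>'] c(2)[of \<alpha>'] assms K B2 by (auto simp: c_def cond_B2_def less_le)
    then show ?thesis
      using assms(3) False by (simp add: lifespan_def c_def[symmetric] pos_less_divide_eq)
  qed (use assms in \<open>simp add: c_def\<close>)
  then obtain \<beta> where \<beta>: "\<alpha>' < \<beta>" "\<beta> < \<alpha>''" "\<alpha>' + u * c \<alpha>'' < \<beta>"
    using dense[of "max \<alpha>' (\<alpha>' + u * c \<alpha>'')" \<alpha>''] assms(2) by auto
  have a\<beta>: "a < \<beta>" using \<beta> assms by simp
  have "u * c \<beta> \<le> u * c \<alpha>''"
    using c(2)[OF a\<beta> \<beta>(2)] assms(4) by (rule mult_left_mono)
  then have "u * c \<beta> < \<beta> - \<alpha>'" using \<beta> by simp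
  moreover have "M \<beta> \<noteq> 0 \<Longrightarrow> c \<beta> > 0" using M(1)[OF a\<beta> \<beta>(2)] K by (simp add: c_def)
  ultimately have "ereal u < T \<alpha>' \<beta>"
    by (simp add: lifespan_def c_def[symmetric] pos_less_divide_eq)
  then show ?thesis using \<beta> by blast
qed

lemma lifespan_antimono:
  assumes "a < \<alpha>" "\<alpha>' \<le> \<beta>"
  shows "T \<beta> \<alpha> \<le> T \<alpha>' \<alpha>"
  using B2 K assms by (auto simp: lifespan_def cond_B2_def intro!: divide_right_mono)

section \<open>The derivative in the upper time\<close>

text \<open>
  With \<open>y = A t k\<close>, the integral equation for \<open>k\<close> at the times \<open>t\<close> and \<open>t'\<close> gives the two integrands, and
  the one for \<open>y\<close> at \<open>t\<close> gives the integral of the derivative in \<open>t\<close>, namely \<open>W s t y - V s t y\<close>. The added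
  interval contributes \<open>W s t (B t k)\<close>. The remaining term \<open>V s t y\<close> is the derivative of \<open>V s t k\<close>.
\<close>

lemma W_upper_right_derivative:
  assumes \<alpha>: "a < \<alpha>'" "\<alpha>' < \<alpha>''" "\<alpha>'' < \<alpha>" and k: "k \<in> E \<alpha>" and s: "0 \<le> s" "s \<le> t"
    and t: "ereal (t - s) < T \<alpha>' \<alpha>" "ereal (t - s) < T \<alpha>' \<alpha>''" and "e > 0"
  shows "\<exists>d>0. \<forall>t'. t < t' \<and> t' < t + d \<longrightarrow>
    N \<alpha>' (W s t' \<alpha> \<alpha>' k - W s t \<alpha> \<alpha>' k - (t' - t) *\<^sub>R W s t \<alpha>'' \<alpha>' (A t \<alpha> \<alpha>'' k + B t \<alpha> \<alpha>'' k))
      \<le> e * (t' - t)"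
proof -
  have a: "a < \<alpha>''" "a < \<alpha>" "\<alpha>' < \<alpha>" and t0: "0 \<le> t" using \<alpha> s by simp_all
  obtain u where u: "t - s < u" "ereal u < T \<alpha>' \<alpha>" "ereal u < T \<alpha>' \<alpha>''"
    using less_lifespan[of "t - s" "min (T \<alpha>' \<alpha>) (T \<alpha>' \<alpha>'')"] t by auto
  \<comment> \<open>The integral equation is used for \<open>k\<close> in \<open>E \<alpha>\<close> and for \<open>A t k\<close> in \<open>E \<alpha>''\<close>, so its intermediate
    index \<open>\<beta>\<close> must lie below \<open>\<alpha>''\<close>; the index \<open>\<gamma>\<close> between \<open>B\<close> and \<open>V\<close> then serves both cases.\<close>
  then obtain \<beta> where \<beta>: "\<alpha>' < \<beta>" "\<beta> < \<alpha>''" "ereal u < T \<alpha>' \<beta>"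
    using lifespan_domain_gap[OF \<alpha>(1,2) u(3)] s by auto
  define \<gamma> where "\<gamma> = (\<beta> + \<alpha>'') / 2"
  have \<gamma>: "\<beta> < \<gamma>" "\<gamma> < \<alpha>''" "a < \<beta>" "a < \<gamma>" "\<beta> < \<alpha>" "\<alpha>' < \<gamma>" "\<gamma> < \<alpha>"
    using \<alpha> \<beta> by (simp_all add: \<gamma>_def)
  have lt: "ereal x < \<tau>" if "x \<le> u" "ereal u < \<tau>" for x \<tau>
    using that by (metis ereal_less_eq(3) le_less_trans)
  define y where "y = A t \<alpha> \<alpha>'' k"
  have y: "y \<in> E \<alpha>''" unfolding y_def by (rule A_mem[OF a(1) \<alpha>(3) t0 k])
  define L where "L r x = W s r \<beta> \<alpha>' (B r \<gamma> \<beta> x)" for r x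
  define Cw where "Cw = lifespan_factor (T \<alpha>' \<beta>) u * K"
  define D where "D = Cw * (M \<gamma> / (\<gamma> - \<beta>))"
  have Wob: "bdd_op \<beta> \<alpha>' Cw (W s r \<beta> \<alpha>')" if "s \<le> r" "r - s \<le> u" for r
    unfolding Cw_def by (rule W_bdd_op[OF \<alpha>(1) \<beta>(1) s(1) that \<beta>(3)])
  have Lob: "bdd_op \<gamma> \<alpha>' D (L r)" if "s \<le> r" "r - s \<le> u" for r
    using op_bound_compose[OF sub[OF \<gamma>(4)] sub[OF \<gamma>(3)] B_bdd_op[OF \<gamma>(3,1)] Wob[OF that]] s that
    by (simp add: L_def[abs_def] D_def)
  have D: "0 \<le> D" using bdd_opD(6)[OF Lob[OF s(2)] \<gamma>(4)] u by simp
  have comp: "W s r \<beta> \<alpha>' (scale_comp (B r) (V r t') \<alpha>0 \<beta> x) = L r (V r t' \<alpha>0 \<gamma> x)"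
    if "s \<le> r" "r \<le> t'" "\<gamma> < \<alpha>0" "x \<in> E \<alpha>0" for r t' x \<alpha>0
    unfolding L_def using B that s \<gamma>
    by (subst scale_comp_eq[OF _ V_scale, of _ r t' \<beta> \<gamma>]) auto
  define c where "c = W s t \<beta> \<alpha>' (B t \<alpha> \<beta> k)"
  have BE: "B r \<alpha> \<beta> k \<in> E \<beta>" "B r \<gamma> \<beta> k = B r \<alpha> \<beta> k" "B r \<alpha> \<beta> k = B r \<alpha> \<alpha>'' k" "B r \<alpha> \<alpha>'' k \<in> E \<alpha>''"
    if "0 \<le> r" for r
  proof -
    note Br = B[rule_format, OF that]
    show "B r \<alpha> \<beta> k \<in> E \<beta>" "B r \<alpha> \<alpha>'' k \<in> E \<alpha>''"
      using scale_op_mem[OF Br \<gamma>(3,5) k] scale_op_mem[OF Br a(1) \<alpha>(3) k] .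
    show "B r \<gamma> \<beta> k = B r \<alpha> \<beta> k" "B r \<alpha> \<beta> k = B r \<alpha> \<alpha>'' k"
      using scale_opD(2)[OF Br \<gamma>(3,1,7) k] scale_opD(1)[OF Br \<gamma>(3) \<beta>(2) \<alpha>(3) k] by simp_all
  qed
  have cE: "c \<in> E \<alpha>'"
    unfolding c_def using bdd_opD(1)[OF Wob[OF s(2)] \<gamma>(3) BE(1)[OF t0]] u by simp
  \<comment> \<open>The relative error \<open>e1\<close> of the increment of \<open>V\<close> enters once directly and once through \<open>L r\<close>, of norm
    at most \<open>D\<close>, integrated over \<open>{s..t}\<close>. Together these use half of \<open>e\<close>.\<close>
  define P where "P = 1 + (t - s) * D"
  define e1 where "e1 = e / (2 * P)"
  have "0 < P" unfolding P_def using s D by (simp add: add_pos_nonneg)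
  then have e1: "e1 > 0" "e1 * P = e / 2"
    using \<open>e > 0\<close> by (simp_all add: e1_def)
  obtain d1 where d1: "d1 > 0" "\<And>t' r. t < t' \<Longrightarrow> t' < t + d1 \<Longrightarrow> r \<in> {0..t} \<Longrightarrow>
      N \<gamma> (V r t' \<alpha> \<gamma> k - V r t \<alpha> \<gamma> k - (t' - t) *\<^sub>R V r t \<alpha>'' \<gamma> y) \<le> (t' - t) * e1"
    using V_right_derivative_uniform[OF \<gamma>(4,2) \<alpha>(3) k t0 e1(1)] unfolding y_def by blast
  let ?S = "{r. s \<le> r \<and> ereal (r - s) < T \<alpha>' \<beta>}"
  have ctS: "cont_in ?S \<alpha>' (\<lambda>r. W s r \<beta> \<alpha>' (B r \<alpha> \<beta> k))"
    using s by (intro W_cont_upper B_cont cont_into_const normed \<alpha> \<beta> k a \<gamma> s) auto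
  have tS: "t \<in> ?S" using s u \<beta>(3) lt by simp
  obtain d2 where d2: "d2 > 0" "\<And>r. r \<in> ?S \<Longrightarrow> \<bar>r - t\<bar> < d2 \<Longrightarrow>
      N \<alpha>' (W s r \<beta> \<alpha>' (B r \<alpha> \<beta> k) - c) < e / 4"
    using cont_intoD(2)[OF normed[OF \<alpha>(1)] ctS tS, of "e / 4"] \<open>e > 0\<close> unfolding c_def by auto
  obtain C d3 where C: "d3 > 0" "\<And>p. p \<ge> 0 \<Longrightarrow> \<bar>p - t\<bar> < d3 \<Longrightarrow> bdd_op \<alpha> \<alpha>'' C (A p \<alpha> \<alpha>'')"
    using A_bounded[OF a(1) \<alpha>(3) t0] by blast
  define H where "H = K * (C * N \<alpha> k)"
  have "0 \<le> C" using bdd_opD(6)[OF C(2)[OF t0] a(2)] C(1) by simp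
  then have H: "0 \<le> H" unfolding H_def using K normed_onD(2)[OF normed[OF a(2)] k] by simp
  define d4 where "d4 = e / (4 * (D * H + 1))"
  have d4: "d4 > 0" "d4 * (D * H) \<le> e / 4"
    using \<open>e > 0\<close> D H by (simp_all add: d4_def field_simps add_pos_nonneg)
  define d where "d = min (u - (t - s)) (min (min d1 d2) (min d3 d4))"
  have dpos: "d > 0" using u d1 d2 C d4 by (simp add: d_def)
  have "N \<alpha>' (W s t' \<alpha> \<alpha>' k - W s t \<alpha> \<alpha>' k - (t' - t) *\<^sub>R W s t \<alpha>'' \<alpha>' (A t \<alpha> \<alpha>'' k + B t \<alpha> \<alpha>'' k))
      \<le> e * (t' - t)"
    if t': "t < t'" "t' < t + d" for t'
  proof -
    have st': "s \<le> t'" "t' - s \<le> u" "0 \<le> t'" using s t' by (simp_all add: d_def)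
    have VE: "V r q \<alpha>0 \<gamma> x \<in> E \<gamma>" if "0 \<le> r" "r \<le> q" "\<gamma> < \<alpha>0" "x \<in> E \<alpha>0" for r q \<alpha>0 x
      using bdd_opD(1)[OF V_bdd_op[OF \<gamma>(4) that(3) that(1,2)]] that \<gamma>(4) by simp
    have I2: "integral_into (E \<alpha>') (N \<alpha>') (\<lambda>r. W s r \<beta> \<alpha>' (scale_comp (B r) (V r q) \<alpha>0 \<beta> x)) s q
        (W s q \<alpha>0 \<alpha>' x - V s q \<alpha>0 \<alpha>' x)"
      if "s \<le> q" "q - s \<le> u" "x \<in> E \<alpha>0" "\<beta> < \<alpha>0" "ereal u < T \<alpha>' \<alpha>0" for q \<alpha>0 x
      using that s \<alpha> \<beta> by (intro W_int_upper lt[of "q - s"]) auto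
    have "N \<alpha>' ((W s t' \<alpha> \<alpha>' k - V s t' \<alpha> \<alpha>' k) - (W s t \<alpha> \<alpha>' k - V s t \<alpha> \<alpha>' k)
        - (t' - t) *\<^sub>R (W s t \<alpha>'' \<alpha>' y - V s t \<alpha>'' \<alpha>' y) - (t' - t) *\<^sub>R c)
      \<le> (t - s) * (D * ((t' - t) * e1)) + (t' - t) * (e / 2)" (is "N \<alpha>' ?R \<le> _")
    proof (rule integral_into_increment_le[OF normed[OF \<alpha>(1)] s(2) less_imp_le[OF t'(1)] _ _
          I2[OF st'(1,2) k] I2[OF s(2) _ k] I2[OF s(2) _ y] cE])
      show "{s..t} \<union> {t..t'} = {s..t'}" using s t' by auto
      show "interior {s..t} \<inter> interior {t..t'} = {}" by (auto simp: interior_atLeastAtMost_real)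
    next
      fix r assume "r \<in> {s..t}"
      then have r: "s \<le> r" "r \<le> t" "0 \<le> r" "r \<le> t'" "r - s \<le> u" using s t' u by auto
      note Lr = Lob[OF r(1,5)]
      let ?v' = "V r t' \<alpha> \<gamma> k" and ?v = "V r t \<alpha> \<gamma> k" and ?w = "V r t \<alpha>'' \<gamma> y"
      have vE: "?v' \<in> E \<gamma>" "?v \<in> E \<gamma>" "?w \<in> E \<gamma>"
        using VE[OF r(3,4) \<gamma>(7) k] VE[OF r(3,2) \<gamma>(7) k] VE[OF r(3,2) \<gamma>(2) y] by simp_all
      have E1: "?v' - ?v \<in> E \<gamma>" "(t' - t) *\<^sub>R ?w \<in> E \<gamma>"
        using vE by (auto intro: subspace_diff[OF sub[OF \<gamma>(4)]] subspace_scale[OF sub[OF \<gamma>(4)]])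
      have E2: "?v' - ?v - (t' - t) *\<^sub>R ?w \<in> E \<gamma>"
        by (rule subspace_diff[OF sub[OF \<gamma>(4)] E1])
      have "L r ?v' - L r ?v - (t' - t) *\<^sub>R L r ?w = L r (?v' - ?v - (t' - t) *\<^sub>R ?w)"
        using bdd_opD(4)[OF Lr \<gamma>(4) E1] bdd_opD(4)[OF Lr \<gamma>(4) vE(1,2)] bdd_opD(3)[OF Lr \<gamma>(4) vE(3)] by simp
      moreover have "N \<alpha>' (L r (?v' - ?v - (t' - t) *\<^sub>R ?w)) \<le> D * ((t' - t) * e1)"
        using d1(2)[OF t'(1)] t'(2) r by (intro bdd_opD(7)[OF Lr \<gamma>(4) E2]) (simp add: d_def)
      ultimately show "N \<alpha>' (W s r \<beta> \<alpha>' (scale_comp (B r) (V r t') \<alpha> \<beta> k)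
          - W s r \<beta> \<alpha>' (scale_comp (B r) (V r t) \<alpha> \<beta> k)
          - (t' - t) *\<^sub>R W s r \<beta> \<alpha>' (scale_comp (B r) (V r t) \<alpha>'' \<beta> y)) \<le> D * ((t' - t) * e1)"
        using comp[OF r(1,4) \<gamma>(7) k] comp[OF r(1,2) \<gamma>(7) k] comp[OF r(1,2) \<gamma>(2) y] by simp
    next
      fix r assume "r \<in> {t..t'}"
      then have r: "t \<le> r" "r \<le> t'" "s \<le> r" "0 \<le> r" "r - s \<le> u" "r - t < d" using s t' st' by auto
      note Lr = Lob[OF r(3,5)]
      have k\<gamma>: "k \<in> E \<gamma>" by (rule incl(1)[OF \<gamma>(4,7) k])
      note v' = VE[OF r(4,2) \<gamma>(7) k]
      have diff: "V r t' \<alpha> \<gamma> k - k \<in> E \<gamma>" by (rule subspace_diff[OF sub[OF \<gamma>(4)] v' k\<gamma>])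
      have "N \<gamma> (V r t' \<alpha> \<gamma> k - V r r \<alpha> \<gamma> k) \<le> (t' - r) * (K * (C * N \<alpha> k))"
      proof (rule V_incr_upper[OF \<gamma>(4,2) \<alpha>(3) r(4) order_refl r(2) k])
        fix p assume "p \<in> {r..t'}"
        then have "bdd_op \<alpha> \<alpha>'' C (A p \<alpha> \<alpha>'')"
          using r t0 t' by (intro C(2)) (auto simp: d_def)
        from bdd_opD(5)[OF this a(2) k] show "N \<alpha>'' (A p \<alpha> \<alpha>'' k) \<le> C * N \<alpha> k" .
      qed
      then have "N \<gamma> (V r t' \<alpha> \<gamma> k - k) \<le> (t' - r) * H"
        using V_refl[OF \<gamma>(4,7) r(4) k] by (simp add: H_def)
      from bdd_opD(7)[OF Lr \<gamma>(4) diff this]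
      have "N \<alpha>' (L r (V r t' \<alpha> \<gamma> k - k)) \<le> (t' - r) * (D * H)" by (simp add: mult_ac)
      also have "\<dots> \<le> d4 * (D * H)"
        using D H r t' by (intro mult_right_mono) (simp_all add: d_def)
      finally have 1: "N \<alpha>' (L r (V r t' \<alpha> \<gamma> k - k)) \<le> e / 4" using d4(2) by simp
      have Lk: "L r k = W s r \<beta> \<alpha>' (B r \<alpha> \<beta> k)" by (simp add: L_def BE(2)[OF r(4)])
      have 2: "N \<alpha>' (L r k - c) \<le> e / 4"
        unfolding Lk using r lt[OF r(5) \<beta>(3)] by (intro less_imp_le d2(2)) (auto simp: d_def)
      have eq: "L r (V r t' \<alpha> \<gamma> k) - c = L r (V r t' \<alpha> \<gamma> k - k) + (L r k - c)"
        using bdd_opD(4)[OF Lr \<gamma>(4) v' k\<gamma>] by simp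
      have "N \<alpha>' (L r (V r t' \<alpha> \<gamma> k - k) + (L r k - c)) \<le> N \<alpha>' (L r (V r t' \<alpha> \<gamma> k - k)) + N \<alpha>' (L r k - c)"
        by (intro normed_onD(6)[OF normed[OF \<alpha>(1)]] subspace_diff[OF sub[OF \<alpha>(1)]]
            bdd_opD(1)[OF Lr \<gamma>(4)] diff k\<gamma> cE)
      then have "N \<alpha>' (L r (V r t' \<alpha> \<gamma> k) - c) \<le> e / 2" unfolding eq using 1 2 by simp
      then show "N \<alpha>' (W s r \<beta> \<alpha>' (scale_comp (B r) (V r t') \<alpha> \<beta> k) - c) \<le> e / 2"
        using comp[OF r(3,2) \<gamma>(7) k] by simp
    qed (use u \<gamma> \<beta> in simp_all)
    moreover
    let ?Q = "V s t' \<alpha> \<gamma> k - V s t \<alpha> \<gamma> k - (t' - t) *\<^sub>R V s t \<alpha>'' \<gamma> y"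
    have QE: "?Q \<in> E \<gamma>"
      using VE[OF s(1) st'(1) \<gamma>(7) k] VE[OF s \<gamma>(7) k] VE[OF s \<gamma>(2) y]
      by (intro subspace_diff[OF sub[OF \<gamma>(4)]] subspace_scale[OF sub[OF \<gamma>(4)]])
    have "N \<gamma> ?Q \<le> (t' - t) * e1"
      using s t' by (intro d1(2)) (simp_all add: d_def)
    then have "N \<alpha>' ?Q \<le> (t' - t) * e1"
      using incl(2)[OF \<alpha>(1) \<gamma>(6) QE] by simp
    moreover have "N \<alpha>' (?Q + ?R) \<le> N \<alpha>' ?Q + N \<alpha>' ?R"
    proof (rule normed_onD(6)[OF normed[OF \<alpha>(1)] incl(1)[OF \<alpha>(1) \<gamma>(6) QE]])
      show "?R \<in> E \<alpha>'"
        using s st' k y u \<gamma> \<beta>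
        by (intro subspace_increment[OF sub[OF \<alpha>(1)] _ _ _ cE]
            integral_into_mem(1)[OF normed[OF \<alpha>(1)] I2]) simp_all
    qed
    moreover have "(t' - t) * e1 + ((t - s) * (D * ((t' - t) * e1)) + (t' - t) * (e / 2)) = e * (t' - t)"
    proof -
      have "(t' - t) * e1 + ((t - s) * (D * ((t' - t) * e1)) + (t' - t) * (e / 2))
          = (t' - t) * (e1 * P + e / 2)" by (simp add: P_def algebra_simps)
      then show ?thesis using e1(2) by simp
    qed
    ultimately have "N \<alpha>' (?Q + ?R) \<le> e * (t' - t)" by linarith
    moreover have dec: "W s t' \<alpha> \<alpha>' k - W s t \<alpha> \<alpha>' k - (t' - t) *\<^sub>R W s t \<alpha>'' \<alpha>' (A t \<alpha> \<alpha>'' k + B t \<alpha> \<alpha>'' k)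
        = ?Q + ?R"
    proof -
      have V: "V s q \<alpha> \<alpha>' k = V s q \<alpha> \<gamma> k" if "s \<le> q" for q
        using scale_opD(1)[OF V_scale[OF s(1) that] \<alpha>(1) \<gamma>(6,7) k] .
      have Vy: "V s t \<alpha>'' \<alpha>' y = V s t \<alpha>'' \<gamma> y"
        using scale_opD(1)[OF V_scale[OF s] \<alpha>(1) \<gamma>(6,2) y] .
      have "c = W s t \<alpha>'' \<alpha>' (B t \<alpha> \<alpha>'' k)"
        unfolding c_def BE(3)[OF t0]
        using u \<beta>(3) lt by (intro W_dom[symmetric] \<alpha> \<beta> s BE(4) t0) auto
      moreover have "W s t \<alpha>'' \<alpha>' (y + B t \<alpha> \<alpha>'' k) = W s t \<alpha>'' \<alpha>' y + W s t \<alpha>'' \<alpha>' (B t \<alpha> \<alpha>'' k)"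
        by (rule bdd_opD(2)[OF W_props(1)[OF \<alpha>(1,2) s t(2)] a(1) y BE(4)[OF t0]])
      ultimately show ?thesis
        unfolding y_def[symmetric] V[OF st'(1)] V[OF s(2)] Vy by (simp add: algebra_simps)
    qed
    ultimately show ?thesis by (simp only: dec)
  qed
  then show ?thesis using dpos by blast
qed

theorem W_upper_C1:
  assumes \<alpha>: "a < \<alpha>'" "\<alpha>' < \<alpha>''" "\<alpha>'' < \<alpha>" and k: "k \<in> E \<alpha>" and s: "0 \<le> s"
  shows "C1_into {t. s \<le> t \<and> ereal (t - s) < min (T \<alpha>' \<alpha>) (T \<alpha>' \<alpha>'')} (E \<alpha>') (N \<alpha>')
    (\<lambda>t. W s t \<alpha> \<alpha>' k) (\<lambda>t. W s t \<alpha>'' \<alpha>' (A t \<alpha> \<alpha>'' k + B t \<alpha> \<alpha>'' k))"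
    (is "C1_into ?S _ _ _ _")
proof (rule C1_into_of_right_derivative[OF normed[OF \<alpha>(1)]])
  have a: "a < \<alpha>''" "a < \<alpha>" "\<alpha>' < \<alpha>" using \<alpha> by simp_all
  have "ereal (z - s) < min (T \<alpha>' \<alpha>) (T \<alpha>' \<alpha>'')"
    if "ereal (y - s) < min (T \<alpha>' \<alpha>) (T \<alpha>' \<alpha>'')" "z \<le> y" for y z
    using that(1) by (rule le_less_trans[rotated]) (use that(2) in simp)
  then show "is_interval ?S" unfolding is_interval_1 by (auto simp del: min_less_iff_conj)
  show "cont_in ?S \<alpha>' (\<lambda>t. W s t \<alpha> \<alpha>' k)"
    by (intro W_cont_upper \<alpha> a s cont_into_const normed k) auto
  have S0: "?S \<subseteq> {0..}" using s by auto
  show "cont_in ?S \<alpha>' (\<lambda>t. W s t \<alpha>'' \<alpha>' (A t \<alpha> \<alpha>'' k + B t \<alpha> \<alpha>'' k))"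
    by (intro W_cont_upper[OF \<alpha>(1,2) s] cont_into_add[OF normed[OF a(1)]] A_cont[OF a(1) \<alpha>(3) S0]
        B_cont[OF a(1) \<alpha>(3) S0] cont_into_const normed a k) auto
  show "\<exists>d>0. \<forall>x\<in>?S. t < x \<and> x < t + d \<longrightarrow>
      N \<alpha>' (W s x \<alpha> \<alpha>' k - W s t \<alpha> \<alpha>' k - (x - t) *\<^sub>R W s t \<alpha>'' \<alpha>' (A t \<alpha> \<alpha>'' k + B t \<alpha> \<alpha>'' k))
        \<le> e * (x - t)" if "t \<in> ?S" "e > 0" for t e
    using W_upper_right_derivative[OF \<alpha> k s, of t e] that by auto
qed

section \<open>The derivative in the lower time\<close>

text \<open>
  The vectors \<open>y r = B r (W r t k)\<close> do not depend on \<open>s\<close>, so only \<open>V s r\<close> is differentiated. The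
  integral of the derivative is obtained by applying the bounded operator \<open>A s\<close> to the integral
  equation for \<open>W s t k\<close> in \<open>E \<alpha>''\<close>; it equals \<open>A s (W s t k - V s t k)\<close>.
\<close>

lemma W_lower_left_derivative:
  assumes \<alpha>: "a < \<alpha>'" "\<alpha>' < \<alpha>''" "\<alpha>'' < \<alpha>" and k: "k \<in> E \<alpha>" and s: "0 \<le> s" "s \<le> t"
    and t: "ereal (t - s) < T \<alpha>' \<alpha>" "ereal (t - s) < T \<alpha>'' \<alpha>" and "e > 0"
  shows "\<exists>d>0. \<forall>s'. 0 \<le> s' \<and> s - d < s' \<and> s' < s \<longrightarrow>
    N \<alpha>' (W s' t \<alpha> \<alpha>' k - W s t \<alpha> \<alpha>' k
        - (s' - s) *\<^sub>R - (A s \<alpha>'' \<alpha>' (W s t \<alpha> \<alpha>'' k) + B s \<alpha>'' \<alpha>' (W s t \<alpha> \<alpha>'' k)))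
      \<le> e * (s - s')"
proof -
  have a: "a < \<alpha>''" "a < \<alpha>" "\<alpha>' < \<alpha>" and t0: "0 \<le> t" using \<alpha> s by simp_all
  obtain u where u: "t - s < u" "ereal u < T \<alpha>' \<alpha>" "ereal u < T \<alpha>'' \<alpha>"
    using less_lifespan[of "t - s" "min (T \<alpha>' \<alpha>) (T \<alpha>'' \<alpha>)"] t by auto
  \<comment> \<open>The integral equation is used in \<open>E \<alpha>'\<close> and in \<open>E \<alpha>''\<close>, so its intermediate index \<open>\<beta>\<close> must lie
    above \<open>\<alpha>''\<close>; the index \<open>\<gamma>\<close> between \<open>V\<close> and \<open>B\<close> then serves both cases.\<close>
  then obtain \<beta> where \<beta>: "\<alpha>'' < \<beta>" "\<beta> < \<alpha>" "ereal u < T \<beta> \<alpha>"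
    using lifespan_codomain_gap[OF a(1) \<alpha>(3) u(3)] by auto
  define \<gamma> where "\<gamma> = (\<alpha>'' + \<beta>) / 2"
  have \<gamma>: "\<alpha>'' < \<gamma>" "\<gamma> < \<beta>" "a < \<beta>" "a < \<gamma>" "\<alpha>' < \<beta>" "\<alpha>' < \<gamma>" "\<gamma> < \<alpha>"
    using \<alpha> \<beta> by (simp_all add: \<gamma>_def)
  have lt: "ereal x < \<tau>" if "x \<le> u" "ereal u < \<tau>" for x \<tau>
    using that by (metis ereal_less_eq(3) le_less_trans)
  define y where "y r = B r \<beta> \<gamma> (W r t \<alpha> \<beta> k)" for r
  define Y where "Y = M \<beta> / (\<beta> - \<gamma>) * (lifespan_factor (T \<beta> \<alpha>) u * K * N \<alpha> k)"
  have y: "y r \<in> E \<gamma>" "N \<gamma> (y r) \<le> Y" "W r t \<alpha> \<beta> k \<in> E \<beta>" if r: "0 \<le> r" "r \<le> t" "t - r \<le> u" for r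
  proof -
    have w: "bdd_op \<alpha> \<beta> (lifespan_factor (T \<beta> \<alpha>) u * K) (W r t \<alpha> \<beta>)"
      by (rule W_bdd_op[OF \<gamma>(3) \<beta>(2) r \<beta>(3)])
    show "W r t \<alpha> \<beta> k \<in> E \<beta>" by (rule bdd_opD(1)[OF w a(2) k])
    note w' = bdd_opD(1)[OF w a(2) k] bdd_opD(5)[OF w a(2) k]
    note Bob = B_bdd_op[OF \<gamma>(4,2) r(1)]
    show "y r \<in> E \<gamma>" "N \<gamma> (y r) \<le> Y"
      unfolding y_def Y_def using bdd_opD(1,7)[OF Bob \<gamma>(3)] w' by simp_all
  qed
  have us: "t - s \<le> u" using u by simp
  have Y: "0 \<le> Y" using y(2)[OF s us] normed_onD(2)[OF normed[OF \<gamma>(4)] y(1)[OF s us]] by linarith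
  have comp: "scale_comp (V q r) (B r) \<beta> \<alpha>0 (W r t \<alpha> \<beta> k) = V q r \<gamma> \<alpha>0 (y r)"
    if "0 \<le> q" "q \<le> r" "r \<le> t" "t - r \<le> u" "a < \<alpha>0" "\<alpha>0 < \<gamma>" for q r \<alpha>0
    unfolding y_def using B that \<gamma> y(3)[of r]
    by (intro scale_comp_eq[OF V_scale]) auto
  have k\<gamma>: "k \<in> E \<gamma>" by (rule incl(1)[OF \<gamma>(4,7) k])
  \<comment> \<open>The relative error \<open>e1\<close> of the increment of \<open>V\<close> enters at the vector \<open>k\<close>, and at the vectors \<open>y r\<close>,
    of norm at most \<open>Y\<close>, integrated over \<open>{s..t}\<close>. Together these use at most half of \<open>e\<close>.\<close>
  define P where "P = N \<gamma> k + (t - s) * Y + 1"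
  define e1 where "e1 = e / (2 * P)"
  have "0 < P" unfolding P_def
    using s Y normed_onD(2)[OF normed[OF \<gamma>(4)] k\<gamma>] by (simp add: add_nonneg_pos)
  then have e1: "e1 > 0" "e1 * P = e / 2"
    using \<open>e > 0\<close> by (simp_all add: e1_def)
  obtain d1 where d1: "d1 > 0" "\<And>s' r x. 0 \<le> s' \<Longrightarrow> s - d1 < s' \<Longrightarrow> s' < s \<Longrightarrow> s \<le> r \<Longrightarrow> x \<in> E \<gamma> \<Longrightarrow>
      N \<alpha>' (V s' r \<gamma> \<alpha>' x - V s r \<gamma> \<alpha>' x - (s - s') *\<^sub>R A s \<alpha>'' \<alpha>' (V s r \<gamma> \<alpha>'' x))
        \<le> (s - s') * (e1 * N \<gamma> x)"
    using V_left_derivative_uniform[OF \<alpha>(1,2) \<gamma>(1) s(1) e1(1)] by blast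
  let ?S = "{r. 0 \<le> r \<and> r \<le> t \<and> ereal (t - r) < T \<beta> \<alpha>}"
  have ctS: "cont_in ?S \<gamma> y"
    unfolding y_def[abs_def] by (intro B_cont[OF \<gamma>(4,2)] W_cont_lower[OF \<gamma>(3) \<beta>(2) k]) auto
  have sS: "s \<in> ?S" using s lt[OF us \<beta>(3)] by simp
  obtain d2 where d2: "d2 > 0" "\<And>r. r \<in> ?S \<Longrightarrow> \<bar>r - s\<bar> < d2 \<Longrightarrow> N \<gamma> (y r - y s) < e / (4 * K)"
    using cont_intoD(2)[OF normed[OF \<gamma>(4)] ctS sS, of "e / (4 * K)"] \<open>e > 0\<close> K by auto
  obtain C d3 where C: "d3 > 0" "\<And>p. p \<ge> 0 \<Longrightarrow> \<bar>p - s\<bar> < d3 \<Longrightarrow> bdd_op \<alpha>'' \<alpha>' C (A p \<alpha>'' \<alpha>')"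
    using A_bounded[OF \<alpha>(1,2) s(1)] by blast
  have As: "bdd_op \<alpha>'' \<alpha>' C (A s \<alpha>'' \<alpha>')" using C s by simp
  have C0: "0 \<le> C" by (rule bdd_opD(6)[OF As a(1)])
  define H where "H = C * (K * Y)"
  have H: "0 \<le> H" unfolding H_def using K C0 Y by simp
  define d4 where "d4 = e / (4 * (H + 1))"
  have d4: "d4 > 0" "d4 * H \<le> e / 4"
    using \<open>e > 0\<close> H by (simp_all add: d4_def field_simps add_pos_nonneg)
  define d where "d = min (u - (t - s)) (min (min d1 d2) (min d3 d4))"
  have dpos: "d > 0" using u d1 d2 C d4 by (simp add: d_def)
  define w where "w = W s t \<alpha> \<alpha>'' k"
  have w_eq: "w = W s t \<alpha> \<beta> k"
    unfolding w_def by (rule W_cod[OF a(1) \<beta>(1,2) s k t(2) lt[OF us \<beta>(3)]])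
  have wE: "w \<in> E \<alpha>''" "w \<in> E \<beta>"
    using y(3)[OF s us] incl(1)[OF a(1) \<beta>(1)] by (simp_all add: w_eq)
  have ys: "y s = B s \<alpha>'' \<alpha>' w"
    using scale_opD(1)[OF B[rule_format, OF s(1)] \<alpha>(1) \<gamma>(6,2) wE(2)]
      scale_opD(2)[OF B[rule_format, OF s(1)] \<alpha>(1,2) \<beta>(1) wE(2)]
    by (simp add: y_def w_eq)
  have ysE: "y s \<in> E \<alpha>'" by (rule incl(1)[OF \<alpha>(1) \<gamma>(6) y(1)[OF s us]])
  have "N \<alpha>' (W s' t \<alpha> \<alpha>' k - W s t \<alpha> \<alpha>' k
        - (s' - s) *\<^sub>R - (A s \<alpha>'' \<alpha>' (W s t \<alpha> \<alpha>'' k) + B s \<alpha>'' \<alpha>' (W s t \<alpha> \<alpha>'' k)))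
      \<le> e * (s - s')"
    if s': "0 \<le> s'" "s - d < s'" "s' < s" for s'
  proof -
    have st': "s' \<le> t" "t - s' \<le> u" using s s' by (simp_all add: d_def)
    have VE: "V q r \<gamma> \<alpha>0 x \<in> E \<alpha>0" if "0 \<le> q" "q \<le> r" "a < \<alpha>0" "\<alpha>0 < \<gamma>" "x \<in> E \<gamma>" for q r \<alpha>0 x
      using bdd_opD(1)[OF V_bdd_op[OF that(3,4,1,2)] \<gamma>(4) that(5)] .
    have I2: "integral_into (E \<alpha>0) (N \<alpha>0) (\<lambda>r. scale_comp (V q r) (B r) \<beta> \<alpha>0 (W r t \<alpha> \<beta> k)) q t
        (W q t \<alpha> \<alpha>0 k - V q t \<alpha> \<alpha>0 k)"
      if "0 \<le> q" "q \<le> t" "t - q \<le> u" "a < \<alpha>0" "\<alpha>0 < \<beta>" "ereal u < T \<alpha>0 \<alpha>" for q \<alpha>0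
      using that \<beta> k by (intro W_int_lower lt[of "t - q"]) auto
    note J = integral_into_op[OF normed[OF a(1)] normed[OF \<alpha>(1)] As I2[OF s us a(1) \<beta>(1) u(3)]]
    have "N \<alpha>' ((W s' t \<alpha> \<alpha>' k - V s' t \<alpha> \<alpha>' k) - (W s t \<alpha> \<alpha>' k - V s t \<alpha> \<alpha>' k)
        - (s - s') *\<^sub>R A s \<alpha>'' \<alpha>' (W s t \<alpha> \<alpha>'' k - V s t \<alpha> \<alpha>'' k) - (s - s') *\<^sub>R y s)
      \<le> (t - s) * ((s - s') * (e1 * Y)) + (s - s') * (e / 2)" (is "N \<alpha>' ?R \<le> _")
    proof (rule integral_into_increment_le[OF normed[OF \<alpha>(1)] s(2) less_imp_le[OF s'(3)] _ _
          I2[OF s'(1) st' \<alpha>(1) \<gamma>(5) u(2)] I2[OF s us \<alpha>(1) \<gamma>(5) u(2)] J ysE])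
      show "{s..t} \<union> {s'..s} = {s'..t}" using s s' by auto
      show "interior {s..t} \<inter> interior {s'..s} = {}" by (auto simp: interior_atLeastAtMost_real)
    next
      fix r assume "r \<in> {s..t}"
      then have r: "s \<le> r" "r \<le> t" "0 \<le> r" "s' \<le> r" "t - r \<le> u" using s s' u by auto
      have "N \<alpha>' (V s' r \<gamma> \<alpha>' (y r) - V s r \<gamma> \<alpha>' (y r) - (s - s') *\<^sub>R A s \<alpha>'' \<alpha>' (V s r \<gamma> \<alpha>'' (y r)))
          \<le> (s - s') * (e1 * N \<gamma> (y r))"
        using s' r by (intro d1(2) y(1)) (simp_all add: d_def)
      also have "\<dots> \<le> (s - s') * (e1 * Y)"
        using y(2)[OF r(3,2,5)] e1(1) s' by (intro mult_left_mono) simp_all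
      finally show "N \<alpha>' (scale_comp (V s' r) (B r) \<beta> \<alpha>' (W r t \<alpha> \<beta> k)
          - scale_comp (V s r) (B r) \<beta> \<alpha>' (W r t \<alpha> \<beta> k)
          - (s - s') *\<^sub>R A s \<alpha>'' \<alpha>' (scale_comp (V s r) (B r) \<beta> \<alpha>'' (W r t \<alpha> \<beta> k)))
          \<le> (s - s') * (e1 * Y)"
        unfolding comp[OF s'(1) r(4,2,5) \<alpha>(1) \<gamma>(6)] comp[OF s(1) r(1,2,5) \<alpha>(1) \<gamma>(6)]
          comp[OF s(1) r(1,2,5) a(1) \<gamma>(1)] .
    next
      fix r assume "r \<in> {s'..s}"
      then have r: "s' \<le> r" "r \<le> s" "r \<le> t" "0 \<le> r" "t - r \<le> u" "s - r < d" using s s' st' by auto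
      note yr = y(1)[OF r(4,3,5)] and ys' = y(1)[OF s us]
      note Vob = V_bdd_op[OF \<alpha>(1) \<gamma>(6) s'(1) r(1)]
      have diff: "y r - y s \<in> E \<gamma>" by (rule subspace_diff[OF sub[OF \<gamma>(4)] yr ys'])
      have "N \<gamma> (y r - y s) \<le> e / (4 * K)"
        using r lt[OF r(5) \<beta>(3)] by (intro less_imp_le d2(2)) (auto simp: d_def)
      from bdd_opD(7)[OF Vob \<gamma>(4) diff this]
      have 1: "N \<alpha>' (V s' r \<gamma> \<alpha>' (y r - y s)) \<le> e / 4" using K by simp
      have "N \<alpha>' (V s' r \<gamma> \<alpha>' (y s) - V r r \<gamma> \<alpha>' (y s)) \<le> (r - s') * (C * (K * N \<gamma> (y s)))"
      proof (rule V_incr_lower[OF \<alpha>(1,2) \<gamma>(1) s'(1) r(1) order_refl ys'])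
        fix p assume "p \<in> {s'..r}"
        then show "bdd_op \<alpha>'' \<alpha>' C (A p \<alpha>'' \<alpha>')"
          using r s' by (intro C(2)) (auto simp: d_def)
      qed
      also have "\<dots> \<le> d4 * H"
        unfolding H_def using r s' y(2)[OF s us] C0 K normed_onD(2)[OF normed[OF \<gamma>(4)] ys'] d4(1)
        by (intro mult_mono) (simp_all add: d_def)
      finally have 2: "N \<alpha>' (V s' r \<gamma> \<alpha>' (y s) - y s) \<le> e / 4"
        using d4(2) V_refl[OF \<alpha>(1) \<gamma>(6) r(4) ys'] by simp
      have eq: "V s' r \<gamma> \<alpha>' (y r) - y s = V s' r \<gamma> \<alpha>' (y r - y s) + (V s' r \<gamma> \<alpha>' (y s) - y s)"
        using bdd_opD(4)[OF Vob \<gamma>(4) yr ys'] by simp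
      have "N \<alpha>' (V s' r \<gamma> \<alpha>' (y r - y s) + (V s' r \<gamma> \<alpha>' (y s) - y s))
          \<le> N \<alpha>' (V s' r \<gamma> \<alpha>' (y r - y s)) + N \<alpha>' (V s' r \<gamma> \<alpha>' (y s) - y s)"
        by (intro normed_onD(6)[OF normed[OF \<alpha>(1)]] subspace_diff[OF sub[OF \<alpha>(1)]]
            bdd_opD(1)[OF Vob \<gamma>(4)] diff ys' ysE)
      then have "N \<alpha>' (V s' r \<gamma> \<alpha>' (y r) - y s) \<le> e / 2" unfolding eq using 1 2 by simp
      then show "N \<alpha>' (scale_comp (V s' r) (B r) \<beta> \<alpha>' (W r t \<alpha> \<beta> k) - y s) \<le> e / 2"
        unfolding comp[OF s'(1) r(1,3,5) \<alpha>(1) \<gamma>(6)] .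
    qed
    moreover
    let ?Q = "V s' t \<gamma> \<alpha>' k - V s t \<gamma> \<alpha>' k - (s - s') *\<^sub>R A s \<alpha>'' \<alpha>' (V s t \<gamma> \<alpha>'' k)"
    have QE: "?Q \<in> E \<alpha>'"
      using VE[OF s'(1) st'(1) \<alpha>(1) \<gamma>(6) k\<gamma>] VE[OF s \<alpha>(1) \<gamma>(6) k\<gamma>] VE[OF s a(1) \<gamma>(1) k\<gamma>] bdd_opD(1)[OF As a(1)]
      by (intro subspace_diff[OF sub[OF \<alpha>(1)]] subspace_scale[OF sub[OF \<alpha>(1)]])
    have "N \<alpha>' ?Q \<le> (s - s') * (e1 * N \<gamma> k)"
      using s s' k\<gamma> by (intro d1(2)) (simp_all add: d_def)
    moreover have "N \<alpha>' (?Q + ?R) \<le> N \<alpha>' ?Q + N \<alpha>' ?R"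
      using integral_into_mem(1)[OF normed[OF \<alpha>(1)] I2[OF s'(1) st' \<alpha>(1) \<gamma>(5) u(2)]]
        integral_into_mem(1)[OF normed[OF \<alpha>(1)] I2[OF s us \<alpha>(1) \<gamma>(5) u(2)]]
        integral_into_mem(1)[OF normed[OF \<alpha>(1)] J]
      by (intro normed_onD(6)[OF normed[OF \<alpha>(1)] QE] subspace_increment[OF sub[OF \<alpha>(1)] _ _ _ ysE])
    moreover have "(s - s') * (e1 * N \<gamma> k) + ((t - s) * ((s - s') * (e1 * Y)) + (s - s') * (e / 2))
        \<le> e * (s - s')"
    proof -
      have "(s - s') * (e1 * N \<gamma> k) + ((t - s) * ((s - s') * (e1 * Y)) + (s - s') * (e / 2))
          = (s - s') * (e1 * P + e / 2) - (s - s') * e1" by (simp add: P_def algebra_simps)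
      also have "\<dots> \<le> (s - s') * (e1 * P + e / 2)" using e1(1) s' by simp
      also have "\<dots> = e * (s - s')" unfolding e1(2) by simp
      finally show ?thesis .
    qed
    ultimately have "N \<alpha>' (?Q + ?R) \<le> e * (s - s')" by linarith
    moreover have dec: "W s' t \<alpha> \<alpha>' k - W s t \<alpha> \<alpha>' k
        - (s' - s) *\<^sub>R - (A s \<alpha>'' \<alpha>' (W s t \<alpha> \<alpha>'' k) + B s \<alpha>'' \<alpha>' (W s t \<alpha> \<alpha>'' k)) = ?Q + ?R"
    proof -
      have V: "V q t \<alpha> \<alpha>0 k = V q t \<gamma> \<alpha>0 k" if "0 \<le> q" "q \<le> t" "a < \<alpha>0" "\<alpha>0 < \<gamma>" for q \<alpha>0
        using scale_opD(2)[OF V_scale[OF that(1,2)] that(3,4) \<gamma>(7) k] .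
      have Aw: "A s \<alpha>'' \<alpha>' (w - V s t \<gamma> \<alpha>'' k) = A s \<alpha>'' \<alpha>' w - A s \<alpha>'' \<alpha>' (V s t \<gamma> \<alpha>'' k)"
        by (rule bdd_opD(4)[OF As a(1) wE(1) VE[OF s a(1) \<gamma>(1) k\<gamma>]])
      show ?thesis
        unfolding w_def[symmetric] ys V[OF s'(1) st'(1) \<alpha>(1) \<gamma>(6)] V[OF s \<alpha>(1) \<gamma>(6)]
          V[OF s a(1) \<gamma>(1)] Aw
        by (simp add: algebra_simps)
    qed
    ultimately show ?thesis by (simp only: dec)
  qed
  then show ?thesis using dpos by blast
qed

theorem W_lower_C1:
  assumes \<alpha>: "a < \<alpha>'" "\<alpha>' < \<alpha>''" "\<alpha>'' < \<alpha>" and k: "k \<in> E \<alpha>" and t: "0 \<le> t"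
  shows "C1_into {s. 0 \<le> s \<and> s \<le> t \<and> ereal (t - s) < min (T \<alpha>' \<alpha>) (T \<alpha>'' \<alpha>)} (E \<alpha>') (N \<alpha>')
    (\<lambda>s. W s t \<alpha> \<alpha>' k) (\<lambda>s. - (A s \<alpha>'' \<alpha>' (W s t \<alpha> \<alpha>'' k) + B s \<alpha>'' \<alpha>' (W s t \<alpha> \<alpha>'' k)))"
    (is "C1_into ?S _ _ _ _")
proof (rule C1_into_of_left_derivative[OF normed[OF \<alpha>(1)]])
  have a: "a < \<alpha>''" "a < \<alpha>" "\<alpha>' < \<alpha>" using \<alpha> by simp_all
  have "ereal (t - z) < min (T \<alpha>' \<alpha>) (T \<alpha>'' \<alpha>)"
    if "ereal (t - y) < min (T \<alpha>' \<alpha>) (T \<alpha>'' \<alpha>)" "y \<le> z" for y z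
    using that(1) by (rule le_less_trans[rotated]) (use that(2) in simp)
  then show "is_interval ?S" unfolding is_interval_1 by (auto simp del: min_less_iff_conj)
  show "cont_in ?S \<alpha>' (\<lambda>s. W s t \<alpha> \<alpha>' k)"
    by (intro W_cont_lower \<alpha> a k) auto
  have S0: "?S \<subseteq> {0..}" by auto
  have w: "cont_in ?S \<alpha>'' (\<lambda>s. W s t \<alpha> \<alpha>'' k)"
    by (intro W_cont_lower \<alpha> a k) auto
  show "cont_in ?S \<alpha>' (\<lambda>s. - (A s \<alpha>'' \<alpha>' (W s t \<alpha> \<alpha>'' k) + B s \<alpha>'' \<alpha>' (W s t \<alpha> \<alpha>'' k)))"
    by (intro cont_into_minus cont_into_add normed \<alpha>(1) A_cont[OF \<alpha>(1,2) S0 w] B_cont[OF \<alpha>(1,2) S0 w])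
  show "\<exists>d>0. \<forall>x\<in>?S. s - d < x \<and> x < s \<longrightarrow>
      N \<alpha>' (W x t \<alpha> \<alpha>' k - W s t \<alpha> \<alpha>' k
          - (x - s) *\<^sub>R - (A s \<alpha>'' \<alpha>' (W s t \<alpha> \<alpha>'' k) + B s \<alpha>'' \<alpha>' (W s t \<alpha> \<alpha>'' k)))
        \<le> e * (s - x)" if "s \<in> ?S" "e > 0" for s e
    using W_lower_left_derivative[OF \<alpha> k, of s t e] that by auto
qed

section \<open>Uniqueness of backward solutions\<close>

text \<open>
  The difference quotient of \<open>r \<mapsto> W p r (v r)\<close> splits into \<open>W\<close> applied to that of \<open>v\<close> and the difference
  quotient of \<open>W\<close> at a fixed vector. The first converges to \<open>- W p r ((A r + B r) (v r))\<close> by the equation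
  for \<open>v\<close>, the second to its negative by the derivative in the upper time. Solutions are differentiable
  only into the larger space \<open>E \<beta>\<close>, hence the three indices.
\<close>

lemma W_propagates_solution:
  assumes \<alpha>: "a < \<alpha>''" "\<alpha>'' < \<beta>" "\<beta> < \<alpha>'" and pq: "0 \<le> p" "p \<le> q"
    and T: "ereal (q - p) < T \<alpha>'' \<alpha>'" "ereal (q - p) < T \<alpha>'' \<beta>"
    and v: "\<And>r. r \<in> {p..q} \<Longrightarrow> v r \<in> E \<alpha>'"
    and deriv: "\<And>r. r \<in> {p..q} \<Longrightarrow>
      deriv_into (E \<beta>) (N \<beta>) v (- (A r \<alpha>' \<beta> (v r) + B r \<alpha>' \<beta> (v r))) r {p..q}"
  shows "W p q \<alpha>' \<alpha>'' (v q) = v p"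
proof -
  have a: "a < \<beta>" "a < \<alpha>'" "\<alpha>'' < \<alpha>'" using \<alpha> by simp_all
  let ?I = "{p..q}"
  let ?f = "\<lambda>r. W p r \<alpha>' \<alpha>'' (v r)"
  have lt: "ereal (r - p) < \<tau>" if "r \<in> ?I" "ereal (q - p) < \<tau>" for r \<tau>
    using that(2) by (rule le_less_trans[rotated]) (use that(1) in simp)
  have W\<beta>: "bdd_op \<beta> \<alpha>'' (lifespan_factor (T \<alpha>'' \<beta>) (q - p) * K) (W p r \<beta> \<alpha>'')" if "r \<in> ?I" for r
    using that by (intro W_bdd_op[OF \<alpha>(1,2) pq(1) _ _ T(2)]) auto
  have W\<alpha>: "W p r \<alpha>' \<alpha>'' x = W p r \<beta> \<alpha>'' x" if "r \<in> ?I" "x \<in> E \<alpha>'" for r x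
    using lt[OF that(1)] T that by (intro W_dom[OF \<alpha> pq(1)]) auto
  have inc: "x \<in> E \<alpha>' \<Longrightarrow> x \<in> E \<beta>" for x by (rule incl(1)[OF a(1) \<alpha>(3)])
  have fE: "?f r \<in> E \<alpha>''" if "r \<in> ?I" for r
    using bdd_opD(1)[OF W\<beta>[OF that] a(1) inc[OF v[OF that]]] W\<alpha>[OF that v[OF that]] by simp
  have "deriv_into (E \<alpha>'') (N \<alpha>'') ?f 0 r ?I" if r: "r \<in> ?I" for r
  proof -
    define g where "g = A r \<alpha>' \<beta> (v r) + B r \<alpha>' \<beta> (v r)"
    have ev: "\<forall>\<^sub>F x in at r within ?I. x \<in> ?I" by (simp add: eventually_at_filter)
    have quot: "limitin (ntop (E \<beta>) (N \<beta>)) (\<lambda>x. inverse (x - r) *\<^sub>R (v x - v r)) (- g) (at r within ?I)"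
      using deriv[OF r] by (simp add: deriv_into_def g_def)
    then have gE: "- g \<in> E \<beta>" by (simp add: limitin_ntop_iff[OF normed[OF a(1)]])
    then have gE': "g \<in> E \<beta>" using subspace_neg[OF sub[OF a(1)]] by fastforce
    have "cont_in ?I \<alpha>'' (\<lambda>x. W p x \<beta> \<alpha>'' (- g))"
      using lt T by (intro W_cont_upper[OF \<alpha>(1,2) pq(1)] cont_into_const normed a gE) auto
    then have "limitin (ntop (E \<alpha>'') (N \<alpha>'')) (\<lambda>x. W p x \<beta> \<alpha>'' (- g)) (W p r \<beta> \<alpha>'' (- g)) (at r within ?I)"
      using r by (simp add: cont_into_iff)
    from limitin_op_apply[OF normed[OF a(1)] normed[OF \<alpha>(1)] eventually_mono[OF ev W\<beta>] quot this]
    have lim1: "limitin (ntop (E \<alpha>'') (N \<alpha>''))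
        (\<lambda>x. W p x \<beta> \<alpha>'' (inverse (x - r) *\<^sub>R (v x - v r))) (W p r \<beta> \<alpha>'' (- g)) (at r within ?I)" .
    let ?S = "{t. p \<le> t \<and> ereal (t - p) < min (T \<alpha>'' \<alpha>') (T \<alpha>'' \<beta>)}"
    have IS: "?I \<subseteq> ?S" using lt T by auto
    have "deriv_into (E \<alpha>'') (N \<alpha>'') (\<lambda>t. W p t \<alpha>' \<alpha>'' (v r)) (W p r \<beta> \<alpha>'' g) r ?S"
      using W_upper_C1[OF \<alpha> v[OF r] pq(1)] IS r unfolding C1_into_def g_def by blast
    from deriv_into_cong[OF normed[OF \<alpha>(1)] this IS r refl]
    have lim2: "limitin (ntop (E \<alpha>'') (N \<alpha>''))
        (\<lambda>x. inverse (x - r) *\<^sub>R (W p x \<alpha>' \<alpha>'' (v r) - W p r \<alpha>' \<alpha>'' (v r))) (W p r \<beta> \<alpha>'' g) (at r within ?I)"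
      by (simp add: deriv_into_def)
    have "bounded_op (E \<beta>) (N \<beta>) (E \<alpha>'') (N \<alpha>'') (W p r \<beta> \<alpha>'')"
      using W\<beta>[OF r] by (simp add: op_bound_def)
    from bounded_opD(6)[OF this sub[OF a(1)] gE'] have "W p r \<beta> \<alpha>'' (- g) + W p r \<beta> \<alpha>'' g = 0"
      by simp
    then have lim: "limitin (ntop (E \<alpha>'') (N \<alpha>''))
        (\<lambda>x. W p x \<beta> \<alpha>'' (inverse (x - r) *\<^sub>R (v x - v r)) +
          inverse (x - r) *\<^sub>R (W p x \<alpha>' \<alpha>'' (v r) - W p r \<alpha>' \<alpha>'' (v r))) 0 (at r within ?I)"
      using limitin_ntop_add[OF normed[OF \<alpha>(1)] lim1 lim2] by simp
    show ?thesis
      unfolding deriv_into_def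
    proof (rule limitin_eventually_cong[OF lim eventually_mono[OF ev]])
      fix x assume x: "x \<in> ?I"
      have "v x - v r \<in> E \<beta>" "v x \<in> E \<beta>" "v r \<in> E \<beta>"
        using inc v[OF x] v[OF r] subspace_diff[OF sub[OF a(1)]] by auto
      then have "W p x \<beta> \<alpha>'' (inverse (x - r) *\<^sub>R (v x - v r))
          = inverse (x - r) *\<^sub>R (W p x \<alpha>' \<alpha>'' (v x) - W p x \<alpha>' \<alpha>'' (v r))"
        using bdd_opD(3,4)[OF W\<beta>[OF x] a(1)] W\<alpha>[OF x v[OF x]] W\<alpha>[OF x v[OF r]] by simp
      then show "W p x \<beta> \<alpha>'' (inverse (x - r) *\<^sub>R (v x - v r)) +
          inverse (x - r) *\<^sub>R (W p x \<alpha>' \<alpha>'' (v r) - W p r \<alpha>' \<alpha>'' (v r))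
          = inverse (x - r) *\<^sub>R (?f x - ?f r)"
        by (simp flip: scaleR_add_right)
    qed
  qed
  from deriv_into_zero_constant[OF normed[OF \<alpha>(1)] fE this pq(2)]
  show ?thesis using W_props(2)[OF \<alpha>(1) a(3) pq(1) v[of p]] pq by simp
qed

lemma lifespan_pos: "a < \<alpha>' \<Longrightarrow> \<alpha>' < \<alpha> \<Longrightarrow> 0 < T \<alpha>' \<alpha>"
  using B2 K by (auto simp: lifespan_def cond_B2_def less_le)

text \<open>
  Going from \<open>t\<close> down to \<open>s\<close> in equal steps shorter than the lifespans on \<open>E \<alpha>'\<close>, each step transports
  the equality of \<open>v\<close> and \<open>r \<mapsto> W r t k\<close> by the same operator \<open>W p q\<close>.
\<close>

theorem backward_solution_unique:
  assumes \<alpha>: "a < \<alpha>'" "\<alpha>' < \<alpha>" and k: "k \<in> E \<alpha>" and t: "0 < t" "0 < T0" "T0 \<le> t"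
    and v: "backward_solution a E N A B \<alpha>' k t T0 v"
    and s: "s \<le> t" "ereal (t - s) < min (ereal T0) (T \<alpha>' \<alpha>)"
  shows "v s = W s t \<alpha> \<alpha>' k"
proof -
  define \<alpha>'' where "\<alpha>'' = (a + \<alpha>') / 2"
  have \<alpha>'': "a < \<alpha>''" "\<alpha>'' < \<alpha>'" using \<alpha> by (simp_all add: \<alpha>''_def)
  define \<beta> where "\<beta> = (\<alpha>'' + \<alpha>') / 2"
  have "\<alpha>'' < \<beta>" "\<beta> < \<alpha>'" using \<alpha>'' by (simp_all add: \<beta>_def)
  then have \<beta>: "a < \<alpha>''" "\<alpha>'' < \<beta>" "\<beta> < \<alpha>'" "a < \<beta>" "\<alpha>'' < \<alpha>'" "\<beta> < \<alpha>"
    using \<alpha> \<alpha>'' by simp_all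
  have "ereal 0 < min (T \<alpha>'' \<alpha>') (T \<alpha>'' \<beta>)"
    using lifespan_pos[OF \<beta>(1,5)] lifespan_pos[OF \<beta>(1,2)] by (simp flip: zero_ereal_def)
  then obtain \<delta> where \<delta>: "0 < \<delta>" "ereal \<delta> < T \<alpha>'' \<alpha>'" "ereal \<delta> < T \<alpha>'' \<beta>"
    by (rule less_lifespan) simp
  obtain m :: nat where m: "(t - s) / \<delta> \<le> real m" using real_arch_simple by blast
  \<comment> \<open>\<open>Suc m\<close> instead of \<open>m\<close> avoids a division by zero for \<open>s = t\<close>.\<close>
  define h where "h = (t - s) / real (Suc m)"
  have h: "0 \<le> h" "h \<le> \<delta>" "real (Suc m) * h = t - s"
  proof -
    show "0 \<le> h" "real (Suc m) * h = t - s" using s(1) by (simp_all add: h_def)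
    have "t - s \<le> real m * \<delta>" using m \<delta>(1) by (simp add: pos_divide_le_eq)
    also have "\<dots> \<le> \<delta> * real (Suc m)" using \<delta>(1) by (simp add: algebra_simps)
    finally show "h \<le> \<delta>" unfolding h_def by (simp add: pos_divide_le_eq)
  qed
  have T0: "t - s < T0" and Ts: "ereal (t - s) < T \<alpha>' \<alpha>" using s(2) by simp_all
  have T\<beta>: "T \<alpha>' \<alpha> \<le> T \<beta> \<alpha>" using \<alpha> \<beta> by (intro lifespan_antimono) simp_all
  let ?w = "\<lambda>r. W r t \<alpha> \<alpha>' k"
  let ?S = "{s. 0 \<le> s \<and> s \<le> t \<and> ereal (t - s) < min (T \<beta> \<alpha>) (T \<alpha>' \<alpha>)}"
  have inS: "r \<in> ?S" "0 \<le> r" "ereal (t - r) < T \<alpha>' \<alpha>" "ereal (t - r) < T \<beta> \<alpha>" if "s \<le> r" "r \<le> t" for r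
  proof -
    show 1: "ereal (t - r) < T \<alpha>' \<alpha>" using Ts by (rule le_less_trans[rotated]) (use that in simp)
    show "ereal (t - r) < T \<beta> \<alpha>" using less_le_trans[OF 1 T\<beta>] .
    then show "r \<in> ?S" "0 \<le> r" using 1 that T0 t by simp_all
  qed
  have v_deriv: "v r \<in> E \<alpha>'"
      "deriv_into (E \<beta>) (N \<beta>) v (- (A r \<alpha>' \<beta> (v r) + B r \<alpha>' \<beta> (v r))) r {p..q}"
    if "r \<in> {p..q}" "s \<le> p" "q \<le> t" for r p q
  proof -
    have sub: "{p..q} \<subseteq> {t - T0..t}" using that T0 by auto
    then have r: "r \<in> {t - T0..t}" using that(1) by blast
    have ctv: "cont_in {t - T0..t} \<alpha>' v" using v by (simp add: backward_solution_def)
    show "v r \<in> E \<alpha>'" by (rule cont_intoD(1)[OF normed[OF \<alpha>(1)] ctv r])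
    have "deriv_into (E \<beta>) (N \<beta>) v (- (A r \<alpha>' \<beta> (v r) + B r \<alpha>' \<beta> (v r))) r {t - T0..t}"
      using v \<beta>(3,4) r by (simp add: backward_solution_def C1_into_def)
    from deriv_into_cong[OF normed[OF \<beta>(4)] this sub that(1) refl]
    show "deriv_into (E \<beta>) (N \<beta>) v (- (A r \<alpha>' \<beta> (v r) + B r \<alpha>' \<beta> (v r))) r {p..q}" .
  qed
  have w_deriv: "?w r \<in> E \<alpha>'"
      "deriv_into (E \<beta>) (N \<beta>) ?w (- (A r \<alpha>' \<beta> (?w r) + B r \<alpha>' \<beta> (?w r))) r {p..q}"
    if "r \<in> {p..q}" "s \<le> p" "q \<le> t" for r p q
  proof -
    have r: "s \<le> r" "r \<le> t" using that by auto
    have sub: "{p..q} \<subseteq> ?S" using that inS(1) by (meson atLeastAtMost_iff order_trans subsetI)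
    show "?w r \<in> E \<alpha>'"
      using bdd_opD(1)[OF W_props(1)[OF \<alpha> inS(2)[OF r] r(2) inS(3)[OF r]] _ k] \<alpha> by simp
    have "deriv_into (E \<beta>) (N \<beta>) (\<lambda>s. W s t \<alpha> \<beta> k) (- (A r \<alpha>' \<beta> (?w r) + B r \<alpha>' \<beta> (?w r))) r ?S"
      using W_lower_C1[OF \<beta>(4,3) \<alpha>(2) k less_imp_le[OF t(1)]] inS(1)[OF r] unfolding C1_into_def
      by blast
    moreover have "W x t \<alpha> \<beta> k = ?w x" if x: "x \<in> {p..q}" for x
    proof -
      have "s \<le> x" "x \<le> t" using x that \<open>s \<le> p\<close> \<open>q \<le> t\<close> by auto
      then show ?thesis
        using inS[of x] by (intro W_cod[OF \<beta>(4,3) \<alpha>(2) _ _ k]) simp_all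
    qed
    ultimately show "deriv_into (E \<beta>) (N \<beta>) ?w (- (A r \<alpha>' \<beta> (?w r) + B r \<alpha>' \<beta> (?w r))) r {p..q}"
      by (rule deriv_into_cong[OF normed[OF \<beta>(4)] _ sub that(1)])
  qed
  have "v (t - real i * h) = ?w (t - real i * h)" if "i \<le> Suc m" for i
    using that
  proof (induction i)
    case 0
    have "v t = k" using v by (simp add: backward_solution_def)
    then show ?case using W_props(2)[OF \<alpha> _ k] t by simp
  next
    case (Suc i)
    let ?p = "t - real (Suc i) * h" and ?q = "t - real i * h"
    have IH: "v ?q = ?w ?q" using Suc by simp
    have "real (Suc i) * h \<le> real (Suc m) * h"
      using Suc.prems h(1) by (intro mult_right_mono) simp_all
    then have p: "s \<le> ?p" using h(3) by simp
    have q: "?q \<le> t" using h(1) by simp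
    have qp: "?p \<le> ?q" "?q - ?p = h" using h(1) by (simp_all add: algebra_simps)
    have p0: "0 \<le> ?p" using inS(2)[OF p] qp(1) q by linarith
    have hT: "ereal (?q - ?p) < T \<alpha>'' \<alpha>'" "ereal (?q - ?p) < T \<alpha>'' \<beta>"
      unfolding qp(2) using \<delta>(2,3) h(2) by (metis ereal_less_eq(3) le_less_trans)+
    have "v ?p = W ?p ?q \<alpha>' \<alpha>'' (v ?q)"
      by (rule W_propagates_solution[OF \<beta>(1-3) p0 qp(1) hT v_deriv, symmetric]) (rule p q | assumption)+
    also have "\<dots> = W ?p ?q \<alpha>' \<alpha>'' (?w ?q)" unfolding IH ..
    also have "\<dots> = ?w ?p"
      by (rule W_propagates_solution[OF \<beta>(1-3) p0 qp(1) hT w_deriv]) (rule p q | assumption)+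
    finally show ?case .
  qed
  from this[of "Suc m"] show ?thesis unfolding h(3) by simp
qed

end

theorem corollary3p12:
  fixes a K :: real and M :: "real \<Rightarrow> real"
    and E :: "real \<Rightarrow> 'a::real_vector set" and N :: "real \<Rightarrow> 'a \<Rightarrow> real"
    and A B :: "real \<Rightarrow> 'a collection" and V W :: "real \<Rightarrow> real \<Rightarrow> 'a collection"
  assumes scale: "banach_scale a E N"
    and A: "\<forall>t\<ge>0. scale_op a E N (A t)" and A1: "cond_A1 a E N A"
    and A2: "cond_A2 a E N V" and A3: "cond_A3 a E N A V" and A4: "cond_A4 a E N K V"
    and B: "\<forall>t\<ge>0. scale_op a E N (B t)" and B1: "cond_B1 a E N B" and B2: "cond_B2 a E N M B"
    and W: "perturbed_backward_family a E N K M V B W"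
  shows
    "(\<forall>\<alpha>' \<alpha>'' \<alpha> k s. a < \<alpha>' \<and> \<alpha>' < \<alpha>'' \<and> \<alpha>'' < \<alpha> \<and> k \<in> E \<alpha> \<and> 0 \<le> s \<longrightarrow>
        C1_into {t. s \<le> t \<and> ereal (t - s) < min (lifespan K M \<alpha>' \<alpha>) (lifespan K M \<alpha>' \<alpha>'')}
          (E \<alpha>') (N \<alpha>')
          (\<lambda>t. W s t \<alpha> \<alpha>' k)
          (\<lambda>t. W s t \<alpha>'' \<alpha>' (A t \<alpha> \<alpha>'' k + B t \<alpha> \<alpha>'' k))) \<and>
     (\<forall>\<alpha>' \<alpha>'' \<alpha> k t. a < \<alpha>' \<and> \<alpha>' < \<alpha>'' \<and> \<alpha>'' < \<alpha> \<and> k \<in> E \<alpha> \<and> 0 \<le> t \<longrightarrow>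
        C1_into {s. 0 \<le> s \<and> s \<le> t \<and>
                    ereal (t - s) < min (lifespan K M \<alpha>' \<alpha>) (lifespan K M \<alpha>'' \<alpha>)}
          (E \<alpha>') (N \<alpha>')
          (\<lambda>s. W s t \<alpha> \<alpha>' k)
          (\<lambda>s. - (A s \<alpha>'' \<alpha>' (W s t \<alpha> \<alpha>'' k) + B s \<alpha>'' \<alpha>' (W s t \<alpha> \<alpha>'' k)))) \<and>
     (\<forall>\<alpha>' \<alpha> k t T v. a < \<alpha>' \<and> \<alpha>' < \<alpha> \<and> k \<in> E \<alpha> \<and> 0 < t \<and> 0 < T \<and> T \<le> t \<and>
        backward_solution a E N A B \<alpha>' k t T v \<longrightarrow>
        (\<forall>s. s \<le> t \<and> ereal (t - s) < min (ereal T) (lifespan K M \<alpha>' \<alpha>) \<longrightarrow>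
           v s = W s t \<alpha> \<alpha>' k))"
proof -
  interpret perturbed_scale a K M E N A B V W
    by (rule perturbed_scale.intro[OF assms])
  show ?thesis
    using W_upper_C1 W_lower_C1 backward_solution_unique by blast
qed

end
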